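(* Let $n\ge1$, let $g:\mathbb{R}^n\to(0,\infty)$ be a positive smooth function, and let $\lambda:\mathbb{R}\to(0,\infty)$ be a function for which there is a constant $C_0>0$ such that $C_0^{-1}\le\lambda(r)/\lambda(r')\le C_0$ for all $r,r'\in\mathbb{R}$ with $|r-r'|\le1$. Then there exist a constant $C>0$ and an integer $M\ge0$ such that \[ \|\mathrm{Op}^g(a)u\|_{L^2(g^{1/2}dq)}\le C\,|a|_{\lambda:M,0,0,t}\,\|u\|_{L^2(g^{1/2}dq)} \] for all $t\in[0,1]$, $a\in BS^0_0(\lambda;t)$ and $u\in C_c^\infty(\mathbb{R}^n)$.
   Context: Notation: $q=(r,\theta)$, $q'=(r',\theta')$ and $p=(\rho,\eta)$ lie in $\mathbb{R}\times\mathbb{R}^{n-1}=\mathbb{R}^n$; multiindices are split as $A=(\alpha_0,\alpha)$, $B=(\beta_0,\beta)$, $A'=(\alpha'_0,\alpha')\in\mathbb{Z}_{\ge0}\times\mathbb{Z}_{\ge0}^{n-1}$, $|A|=\alpha_0+|\alpha|$; $\langle\rho\oplus\eta\rangle:=(1+\rho^2+|\eta|^2)^{1/2}$. Bisymbols: for $t\in[0,1]$ and $l=(j,k)\in\mathbb{Z}^2$ put $\lambda^t_{jk}:=\lambda(tj+(1-t)k)$ and $\partial_{q,lt}^A:=\partial_r^{\alpha_0}((\lambda^t_{jk})^{-1}\partial_\theta)^\alpha$, $\partial_{p,lt}^B:=\partial_\rho^{\beta_0}(\lambda^t_{jk}\partial_\eta)^\beta$, $\partial_{q',lt}^{A'}:=\partial_{r'}^{\alpha'_0}((\lambda^t_{jk})^{-1}\partial_{\theta'})^{\alpha'}$.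 For $m\in\mathbb{R}$, $\sigma\in[0,1]$, $a\in C^\infty(\mathbb{R}^{3n})$ (a function of $(q,p,q')$) belongs to $BS^m_\sigma(\lambda;t)$ iff for all $A,B,A'$ there is $C_{ABA't}>0$ with $|\partial_{q,lt}^A\partial_{p,lt}^B\partial_{q',lt}^{A'}a(q,p,q')|\le C_{ABA't}\langle\rho\oplus(\lambda^t_{jk})^{-1}\eta\rangle^{m-\sigma|B|}$ for all $l=(j,k)\in\mathbb{Z}^2$ and all $(q,p,q')$ with $|r-j|\le1$, $|r'-k|\le1$. Seminorms: $|a|_{\lambda:M,m,\sigma,t}:=\sum_{|A|+|B|+|A'|\le M}\ \sup_{(j,k)\in\mathbb{Z}^2}\ \sup_{|r-j|\le1,\,|r'-k|\le1}\langle\rho\oplus(\lambda^t_{jk})^{-1}\eta\rangle^{-m+\sigma|B|}|\partial_{q,lt}^A\partial_{p,lt}^B\partial_{q',lt}^{A'}a(q,p,q')|$. Quantization: $\mathrm{Op}^g(a)u(q):=(2\pi)^{-n}g(q)^{-1/4}\int_{\mathbb{R}^n}dp\int_{\mathbb{R}^n}dq'\,a(q,p,q')e^{ip\cdot(q-q')}u(q')g(q')^{1/4}$ (iterated integral, first in $q'$, then in $p$). $L^2(g^{1/2}dq)$ is the $L^2$ space on $\mathbb{R}^n$ with measure $g(q)^{1/2}dq$. *)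

theory Defs
  imports "HOL-Analysis.Analysis"
begin

text \<open>
  A point of \<open>\<real> \<times> \<real>\<^sup>n\<^sup>-\<^sup>1\<close> is a vector in \<open>real ^ 'n\<close> with a linearly ordered index
  type: the least index carries the first component (\<open>r\<close> or \<open>\<rho>\<close>), the remaining indices
  carry the second one (\<open>\<theta>\<close> or \<open>\<eta>\<close>).  This includes \<open>n = 1\<close>, where there are none of the latter.
\<close>

type_synonym 'n point = "(real, 'n) vec"

definition radial :: "'n::{finite,linorder}" where
  "radial = Min UNIV"

definition scale_ang :: "real \<Rightarrow> 'n::{finite,linorder} point \<Rightarrow> 'n point" where
  "scale_ang c p = (\<chi> i. if i = radial then p $ i else c * p $ i)"

text \<open>\<open>jbr (scale_ang c p)\<close> is \<open>\<langle>\<rho> \<oplus> c \<eta>\<rangle>\<close> for \<open>p = (\<rho>, \<eta>)\<close>.\<close>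

definition jbr :: "'n::finite point \<Rightarrow> real" where
  "jbr p = sqrt (1 + (norm p)\<^sup>2)"

definition dir_deriv ::
  "'a::real_normed_vector \<Rightarrow> ('a \<Rightarrow> 'b::real_normed_vector) \<Rightarrow> 'a \<Rightarrow> 'b" where
  "dir_deriv v f = (\<lambda>x. frechet_derivative f (at x) v)"

primrec C_k :: "nat \<Rightarrow> ('a::real_normed_vector \<Rightarrow> 'b::real_normed_vector) \<Rightarrow> bool" where
  "C_k 0 f \<longleftrightarrow> continuous_on UNIV f"
| "C_k (Suc k) f \<longleftrightarrow> (\<forall>x. f differentiable (at x)) \<and> (\<forall>v. C_k k (dir_deriv v f))"

definition smooth :: "('a::real_normed_vector \<Rightarrow> 'b::real_normed_vector) \<Rightarrow> bool" where
  "smooth f \<longleftrightarrow> (\<forall>k. C_k k f)"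

definition test_function :: "('a::real_normed_vector \<Rightarrow> complex) \<Rightarrow> bool" where
  "test_function u \<longleftrightarrow> smooth u \<and> compact (closure {x. u x \<noteq> 0})"

type_synonym 'n multiindex = "'n \<Rightarrow> nat"

definition mi_size :: "('n::finite) multiindex \<Rightarrow> nat" where
  "mi_size A = (\<Sum>i\<in>UNIV. A i)"

text \<open>
  With \<open>e i\<close> the \<open>i\<close>-th coordinate direction of one block of variables,
  \<open>wderiv e c A\<close> is \<open>\<partial>\<^sub>r\<close> to the power \<open>\<alpha>\<^sub>0\<close> times \<open>c \<partial>\<^sub>\<theta>\<close> to the power \<open>\<alpha>\<close>,
  where \<open>A = (\<alpha>\<^sub>0, \<alpha>)\<close>; the derivatives are composed in the order of the indices.
\<close>

definition wderiv1 ::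
  "('n::{finite,linorder} \<Rightarrow> 'e::real_normed_vector) \<Rightarrow> real \<Rightarrow> 'n
    \<Rightarrow> ('e \<Rightarrow> complex) \<Rightarrow> 'e \<Rightarrow> complex" where
  "wderiv1 e c i f = (\<lambda>x. (if i = radial then 1 else c) *\<^sub>R dir_deriv (e i) f x)"

definition wderiv ::
  "('n::{finite,linorder} \<Rightarrow> 'e::real_normed_vector) \<Rightarrow> real \<Rightarrow> 'n multiindex
    \<Rightarrow> ('e \<Rightarrow> complex) \<Rightarrow> 'e \<Rightarrow> complex" where
  "wderiv e c A = foldr (\<lambda>i. wderiv1 e c i ^^ A i) (sorted_list_of_set UNIV)"

type_synonym 'n amplitude = "'n point \<times> 'n point \<times> 'n point \<Rightarrow> complex"

definition deriv_q :: "real \<Rightarrow> 'n::{finite,linorder} multiindex \<Rightarrow> 'n amplitude \<Rightarrow> 'n amplitude" where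
  "deriv_q c A = wderiv (\<lambda>i. (axis i 1, 0, 0)) (inverse c) A"

definition deriv_p :: "real \<Rightarrow> 'n::{finite,linorder} multiindex \<Rightarrow> 'n amplitude \<Rightarrow> 'n amplitude" where
  "deriv_p c B = wderiv (\<lambda>i. (0, axis i 1, 0)) c B"

definition deriv_q' :: "real \<Rightarrow> 'n::{finite,linorder} multiindex \<Rightarrow> 'n amplitude \<Rightarrow> 'n amplitude" where
  "deriv_q' c A' = wderiv (\<lambda>i. (0, 0, axis i 1)) (inverse c) A'"

definition lam_t :: "(real \<Rightarrow> real) \<Rightarrow> real \<Rightarrow> int \<Rightarrow> int \<Rightarrow> real" where
  "lam_t lam t j k = lam (t * of_int j + (1 - t) * of_int k)"

definition cell :: "int \<Rightarrow> int \<Rightarrow> ('n::{finite,linorder} point \<times> 'n point \<times> 'n point) set" where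
  "cell j k = {(q, p, q'). \<bar>q $ radial - of_int j\<bar> \<le> 1 \<and> \<bar>q' $ radial - of_int k\<bar> \<le> 1}"

definition BS :: "(real \<Rightarrow> real) \<Rightarrow> real \<Rightarrow> real \<Rightarrow> real \<Rightarrow> 'n::{finite,linorder} amplitude set" where
  "BS lam m \<sigma> t = {a. smooth a \<and>
     (\<forall>A B A'. \<exists>C>0. \<forall>j k. \<forall>(q, p, q')\<in>cell j k.
        norm (deriv_q (lam_t lam t j k) A
               (deriv_p (lam_t lam t j k) B
                 (deriv_q' (lam_t lam t j k) A' a)) (q, p, q'))
        \<le> C * jbr (scale_ang (inverse (lam_t lam t j k)) p) powr (m - \<sigma> * mi_size B))}"

text \<open>
  The suprema are real-valued, hence meaningful only for \<open>a \<in> BS lam m \<sigma> t\<close>,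
  where they are taken over bounded sets.
\<close>

definition BS_seminorm ::
  "(real \<Rightarrow> real) \<Rightarrow> nat \<Rightarrow> real \<Rightarrow> real \<Rightarrow> real \<Rightarrow> 'n::{finite,linorder} amplitude \<Rightarrow> real" where
  "BS_seminorm lam M m \<sigma> t a =
     (\<Sum>(A, B, A')\<in>{(A, B, A'). mi_size A + mi_size B + mi_size A' \<le> M}.
        SUP (j, k)\<in>UNIV. SUP (q, p, q')\<in>cell j k.
          jbr (scale_ang (inverse (lam_t lam t j k)) p) powr (- m + \<sigma> * mi_size B) *
          norm (deriv_q (lam_t lam t j k) A
                 (deriv_p (lam_t lam t j k) B
                   (deriv_q' (lam_t lam t j k) A' a)) (q, p, q')))"

lemma finite_multiindex_triples:
  "finite {(A :: 'n::finite multiindex, B :: 'n multiindex, A' :: 'n multiindex).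
     mi_size A + mi_size B + mi_size A' \<le> M}"
proof -
  let ?F = "{A :: 'n multiindex. \<forall>i. A i \<in> {..M}}"
  have "finite ?F"
    using finite_set_of_finite_funs[of "UNIV :: 'n set" "{..M}"] by simp
  then have "finite (?F \<times> ?F \<times> ?F)" by simp
  moreover have le: "A i \<le> mi_size A" for A :: "'n multiindex" and i
    unfolding mi_size_def by (rule member_le_sum) auto
  have "{(A, B, A'). mi_size A + mi_size B + mi_size A' \<le> M} \<subseteq> ?F \<times> ?F \<times> ?F"
    by (auto intro: order_trans[OF le])
  ultimately show ?thesis by (rule rev_finite_subset)
qed

definition Op :: "('n::finite point \<Rightarrow> real) \<Rightarrow> 'n amplitude \<Rightarrow> ('n point \<Rightarrow> complex) \<Rightarrow> 'n point \<Rightarrow> complex" where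
  "Op g a u q =
     of_real ((2 * pi) powr (- real CARD('n)) * g q powr (- 1/4)) *
     (LINT p|lborel. LINT q'|lborel.
        a (q, p, q') * exp (\<i> * of_real (p \<bullet> (q - q'))) * u q' * of_real (g q' powr (1/4)))"

definition weighted :: "('n::finite point \<Rightarrow> real) \<Rightarrow> 'n point measure" where
  "weighted g = density lborel (\<lambda>q. ennreal (g q powr (1/2)))"

definition in_L2 :: "'a measure \<Rightarrow> ('a \<Rightarrow> complex) \<Rightarrow> bool" where
  "in_L2 N f \<longleftrightarrow> f \<in> borel_measurable N \<and> integrable N (\<lambda>x. (norm (f x))\<^sup>2)"

text \<open>Meaningful only together with \<^const>\<open>in_L2\<close>, since a divergent Bochner integral is \<open>0\<close>.\<close>

definition L2_norm :: "'a measure \<Rightarrow> ('a \<Rightarrow> complex) \<Rightarrow> real" where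
  "L2_norm N f = sqrt (LINT x|N. (norm (f x))\<^sup>2)"

end

theory Submission
  imports Defs "HOL-Probability.Probability"
begin

text \<open>
  Conjugating with \<open>g\<^sup>1\<^sup>/\<^sup>4\<close> reduces to \<open>g = 1\<close>.  By duality one bounds the form
  \<open>\<integral> a(q, p, q') e\<^bsup>i p (q - q')\<^esup> w(q) v(q')\<close>, with a Gaussian in \<open>p\<close> added to make it absolutely convergent.
  For \<open>w\<close> and \<open>v\<close> supported where \<open>r\<close> and \<open>r'\<close> have integer parts \<open>j\<close> and \<open>k\<close>, cut the \<open>\<theta>\<close>-space into cubes of side
  \<open>1 / \<lambda>\<close> with \<open>\<lambda> = \<lambda>\<^sup>t\<^sub>j\<^sub>k\<close>, which is the scale of the symbol estimates.  On a pair of boxes, the fundamental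
  theorem of calculus in each coordinate of \<open>q\<close> and \<open>q'\<close> represents \<open>a\<close> as a superposition of
  multipliers depending on \<open>p\<close> alone, times indicator functions of \<open>q\<close> and of \<open>q'\<close>, and for multipliers the bound is
  Plancherel's inequality.  In the coordinates in which the boxes are apart, two integrations by
  parts in \<open>p\<close> gain the square of the inverse distance, so that Schur's test sums over all pairs of boxes.
  Performing these steps in the order \<open>q'\<close>, \<open>p\<close>, \<open>q\<close> produces the derivatives of \<open>a\<close> exactly as the
  seminorms compose them.
\<close>

subsection \<open>Plancherel's inequality\<close>

text \<open>The scale 1 / \<lambda> changes with the pair (j, k), so no single grid in \<theta>
  serves all slabs. The sum is therefore nested: unit slabs in the radial coordinate fix (j, k), and
  only then is a common angular grid laid for that pair. Since the gain is a product of
  one-dimensional weights, Schur's test can be applied in one coordinate at a time. This is why two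
  integrations by parts per coordinate are made: 1 / d is not summable over the integers, 1 / d^2
  is.

  The cut-offs may be sharp because neither w nor v is ever differentiated: derivatives in q and q'
  fall on the amplitude alone, and those left by the integrations by parts in p fall on the
  amplitude or on the Gaussian. The latter imposes a condition: \<lambda>-scaled derivatives of a
  Gaussian of width 1 / \<epsilon> are kept below 1 by requiring \<lambda> \<epsilon> \<le> 1. As
  \<lambda> need not be bounded over all pairs, w is confined to a ball, so that finitely many pairs
  occur, and \<epsilon> shrinks as the ball grows.\<close>

lemma lborel_fubini:
  fixes f :: "'a::euclidean_space \<times> 'b::euclidean_space \<Rightarrow> 'c::{banach, second_countable_topology}"
  assumes "integrable lborel f"
  shows "(LINT z|lborel. f z) = (LINT x|lborel. LINT y|lborel. f (x, y))"
    and "(LINT z|lborel. f z) = (LINT y|lborel. LINT x|lborel. f (x, y))"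
    and "integrable lborel (\<lambda>y. LINT x|lborel. f (x, y))"
    and "integrable lborel (\<lambda>x. LINT y|lborel. f (x, y))"
proof -
  have i: "integrable (lborel \<Otimes>\<^sub>M lborel) (\<lambda>(x, y). f (x, y))"
    using assms by (simp add: lborel_prod)
  show "(LINT z|lborel. f z) = (LINT x|lborel. LINT y|lborel. f (x, y))"
    using lborel_pair.integral_fst[OF i] by (simp add: lborel_prod)
  show "(LINT z|lborel. f z) = (LINT y|lborel. LINT x|lborel. f (x, y))"
    using lborel_pair.integral_snd[OF i] by (simp add: lborel_prod)
  show "integrable lborel (\<lambda>y. LINT x|lborel. f (x, y))"
    using lborel_pair.integrable_snd[OF i] by simp
  show "integrable lborel (\<lambda>x. LINT y|lborel. f (x, y))"
    using lborel_pair.integrable_fst[OF i] by simp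
qed

lemma (in pair_sigma_finite) integrable_mult_pair:
  fixes f :: "'a \<Rightarrow> 'c::{real_normed_field, banach, second_countable_topology}" and g :: "'b \<Rightarrow> 'c"
  assumes f: "integrable M1 f" and g: "integrable M2 g"
  shows "integrable (M1 \<Otimes>\<^sub>M M2) (\<lambda>z. f (fst z) * g (snd z))"
proof (rule Fubini_integrable)
  have [measurable]: "f \<in> borel_measurable M1" "g \<in> borel_measurable M2"
    using f g by (auto dest: borel_measurable_integrable)
  show "(\<lambda>z. f (fst z) * g (snd z)) \<in> borel_measurable (M1 \<Otimes>\<^sub>M M2)" by measurable
  show "integrable M1 (\<lambda>x. LINT y|M2. norm (f (fst (x, y)) * g (snd (x, y))))"
    using f g by (simp add: norm_mult)
  show "AE x in M1. integrable M2 (\<lambda>y. f (fst (x, y)) * g (snd (x, y)))"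
    using g by simp
qed

lemma integrable_lborel_mult:
  fixes f :: "'a::euclidean_space \<Rightarrow> 'c::{real_normed_field, banach, second_countable_topology}"
    and g :: "'b::euclidean_space \<Rightarrow> 'c"
  assumes "integrable lborel f" "integrable lborel g"
  shows "integrable lborel (\<lambda>z. f (fst z) * g (snd z))"
  using lborel_pair.integrable_mult_pair[OF assms] by (simp add: lborel_prod)

lemma norm_integral_le:
  fixes f :: "'a \<Rightarrow> 'b::{banach, second_countable_topology}"
  assumes "integrable M g" "\<And>x. norm (f x) \<le> g x"
  shows "norm (integral\<^sup>L M f) \<le> integral\<^sup>L M g"
  using assms by (intro order_trans[OF integral_norm_bound] integral_mono') (auto intro: order_trans[OF norm_ge_zero])

lemma Basis_vec_eq: "Basis = range (\<lambda>i. axis i 1 :: real ^ 'n)"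
  by (auto simp: Basis_vec_def)

lemma inj_axis_1: "inj (\<lambda>i. axis i 1 :: real ^ 'n)"
  by (rule injI) (simp add: axis_eq_axis)

lemma prod_Basis_vec:
  fixes f :: "'n::finite \<Rightarrow> real \<Rightarrow> 'b::comm_monoid_mult"
  shows "(\<Prod>b\<in>Basis. f (axis_index b) (x \<bullet> b)) = (\<Prod>i\<in>UNIV. f i (x $ i))"
  unfolding Basis_vec_eq
  by (subst prod.reindex[OF inj_axis_1]) (simp add: inner_axis)

text \<open>\<open>lborel\<close> on a Euclidean space is the image of the product measure over
  \<open>Basis\<close>. Reindexing \<open>Basis\<close> by \<open>axis\<close> turns the product
  formula for that measure into one over coordinates.\<close>

lemma
  fixes f :: "'n::finite \<Rightarrow> real \<Rightarrow> complex"
  assumes f: "\<And>i. integrable lborel (f i)"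
  shows integrable_prod_vec: "integrable lborel (\<lambda>x :: real ^ 'n. \<Prod>i\<in>UNIV. f i (x $ i))"
    and integral_prod_vec: "integral\<^sup>L lborel (\<lambda>x :: real ^ 'n. \<Prod>i\<in>UNIV. f i (x $ i)) = (\<Prod>i\<in>UNIV. LINT t|lborel. f i t)"
proof -
  interpret product_sigma_finite "\<lambda>_ :: real ^ 'n. lborel :: real measure" ..
  have [measurable]: "\<And>i. f i \<in> borel_measurable borel"
    using f by (auto dest: borel_measurable_integrable)
  let ?g = "\<lambda>b :: real ^ 'n. f (axis_index b)"
  let ?T = "\<lambda>y :: real ^ 'n \<Rightarrow> real. \<Sum>b\<in>Basis. y b *\<^sub>R b"
  have T: "?T \<in> (\<Pi>\<^sub>M b\<in>Basis. lborel) \<rightarrow>\<^sub>M borel" by measurable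
  have eq: "(\<Prod>i\<in>UNIV. f i (?T y $ i)) = (\<Prod>b\<in>Basis. ?g b (y b))" for y
    unfolding prod_Basis_vec[symmetric] by (intro prod.cong refl) simp
  have m: "(\<lambda>x :: real ^ 'n. \<Prod>i\<in>UNIV. f i (x $ i)) \<in> borel_measurable borel" by measurable
  have i: "integrable (\<Pi>\<^sub>M b\<in>Basis. lborel) (\<lambda>y. \<Prod>b\<in>Basis. ?g b (y b))"
    by (intro product_integrable_prod f) simp
  show "integrable lborel (\<lambda>x :: real ^ 'n. \<Prod>i\<in>UNIV. f i (x $ i))"
    by (subst lborel_eq) (simp only: integrable_distr_eq[OF T m] eq i)
  have "integral\<^sup>L lborel (\<lambda>x :: real ^ 'n. \<Prod>i\<in>UNIV. f i (x $ i)) = (\<Prod>b\<in>Basis. LINT t|lborel. ?g b t)"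
    by (subst lborel_eq, simp only: integral_distr[OF T m] eq)
      (rule product_integral_prod, auto intro: f)
  also have "\<dots> = (\<Prod>i\<in>UNIV. LINT t|lborel. f i t)"
    unfolding Basis_vec_eq by (subst prod.reindex[OF inj_axis_1]) (simp add: axis_index_axis)
  finally show "integral\<^sup>L lborel (\<lambda>x :: real ^ 'n. \<Prod>i\<in>UNIV. f i (x $ i)) = (\<Prod>i\<in>UNIV. LINT t|lborel. f i t)" .
qed

text \<open>A convergence factor, hence normalised by its value 1 at 0: the standard deviation is
  \<open>inverse \<epsilon>\<close>, and the factor tends to 1 as \<epsilon> tends to 0.\<close>

definition gauss :: "real \<Rightarrow> real \<Rightarrow> real" where
  "gauss \<epsilon> t = exp (- (\<epsilon> * t)\<^sup>2 / 2)"

lemma gauss_eq_normal_density: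
  "\<epsilon> > 0 \<Longrightarrow> gauss \<epsilon> t = sqrt (2 * pi) / \<epsilon> * normal_density 0 (inverse \<epsilon>) t"
  unfolding gauss_def normal_density_def
  by (simp add: real_sqrt_mult real_sqrt_divide field_simps power_mult_distrib)

lemma gauss_le_1: "gauss \<epsilon> t \<le> 1" and gauss_pos: "gauss \<epsilon> t > 0"
  by (auto simp: gauss_def)

lemma continuous_gauss: "continuous_on A (gauss \<epsilon>)"
  unfolding gauss_def[abs_def] by (intro continuous_intros) auto

lemma borel_measurable_gauss [measurable]: "gauss \<epsilon> \<in> borel_measurable borel"
  by (intro borel_measurable_continuous_onI continuous_gauss)

lemma integrable_gauss: "\<epsilon> > 0 \<Longrightarrow> integrable lborel (gauss \<epsilon>)"
  using integrable_normal_density[of 0 "inverse \<epsilon>"]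
  by (subst Bochner_Integration.integrable_cong[OF refl gauss_eq_normal_density]) auto

text \<open>Substituting t / \<epsilon> for t reduces the integral to the characteristic function of
  the standard normal distribution.\<close>

lemma integral_gauss_cis:
  assumes "\<epsilon> > 0"
  shows "(LINT t|lborel. of_real (gauss \<epsilon> t) * cis (t * x))
     = of_real (2 * pi * normal_density 0 \<epsilon> x)"
proof -
  have "(LINT t|lborel. std_normal_density t *\<^sub>R cis (x / \<epsilon> * t)) = char std_normal_distribution (x / \<epsilon>)"
    unfolding char_def by (subst integral_density) (auto simp: cis_conv_exp)
  also have "\<dots> = of_real (exp (- (x / \<epsilon>)\<^sup>2 / 2))"
    by (simp add: char_std_normal_distribution)
  finally have c: "(LINT t|lborel. std_normal_density t *\<^sub>R cis (x / \<epsilon> * t)) = of_real (exp (- (x / \<epsilon>)\<^sup>2 / 2))" .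
  have "(LINT t|lborel. of_real (gauss \<epsilon> t) * cis (t * x))
     = (1 / \<epsilon>) *\<^sub>R (LINT t|lborel. of_real (gauss \<epsilon> (0 + (1 / \<epsilon>) * t)) * cis ((0 + (1 / \<epsilon>) * t) * x))"
    using assms by (subst lborel_integral_real_affine[of "1 / \<epsilon>" _ 0]) auto
  also have "(\<lambda>t. of_real (gauss \<epsilon> (0 + (1 / \<epsilon>) * t)) * cis ((0 + (1 / \<epsilon>) * t) * x))
    = (\<lambda>t. of_real (sqrt (2 * pi)) * (std_normal_density t *\<^sub>R cis (x / \<epsilon> * t)))"
    using assms by (auto simp: gauss_def std_normal_density_def scaleR_conv_of_real field_simps)
  also have "(1 / \<epsilon>) *\<^sub>R (LINT t|lborel. of_real (sqrt (2 * pi)) * (std_normal_density t *\<^sub>R cis (x / \<epsilon> * t)))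
     = of_real (1 / \<epsilon> * (sqrt (2 * pi) * exp (- (x / \<epsilon>)\<^sup>2 / 2)))"
    by (subst Bochner_Integration.integral_mult_right_zero) (simp only: c, simp add: scaleR_conv_of_real)
  also have "1 / \<epsilon> * (sqrt (2 * pi) * exp (- (x / \<epsilon>)\<^sup>2 / 2)) = 2 * pi * normal_density 0 \<epsilon> x"
    using assms unfolding normal_density_def
    by (simp add: real_sqrt_mult field_simps power_divide)
  finally show ?thesis .
qed

text \<open>No continuity is asked, so that sharp cut-offs and factors bounded on the support stay
  in the class. Its members lie in L^1 and in L^2, which makes Fubini available throughout.\<close>

definition bdd_supp :: "('a::euclidean_space \<Rightarrow> complex) \<Rightarrow> bool" where
  "bdd_supp w \<longleftrightarrow> w \<in> borel_measurable borel \<and> (\<exists>C. \<forall>x. norm (w x) \<le> C) \<and> bounded {x. w x \<noteq> 0}"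

lemma bdd_supp_measurable: "bdd_supp w \<Longrightarrow> w \<in> borel_measurable borel"
  by (simp add: bdd_supp_def)

lemma bdd_supp_mult:
  assumes w: "bdd_supp w" and f: "f \<in> borel_measurable borel" and C: "\<And>x. w x \<noteq> 0 \<Longrightarrow> norm (f x) \<le> C"
  shows "bdd_supp (\<lambda>x. f x * w x)"
proof -
  obtain K where K: "\<And>x. norm (w x) \<le> K" using w by (auto simp: bdd_supp_def)
  have "norm (f x * w x) \<le> \<bar>C\<bar> * K" for x
  proof (cases "w x = 0")
    case True
    then show ?thesis using K[of x] by simp
  next
    case False
    then show ?thesis unfolding norm_mult using C[OF False] K[of x] by (intro mult_mono) auto
  qed
  moreover have "bounded {x. f x * w x \<noteq> 0}"
    by (rule bounded_subset[of "{x. w x \<noteq> 0}"]) (use w in \<open>auto simp: bdd_supp_def\<close>)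
  ultimately show ?thesis using w f by (auto simp: bdd_supp_def intro!: borel_measurable_times)
qed

lemma bdd_supp_integrable:
  assumes "bdd_supp w"
  shows "integrable lborel w"
proof -
  obtain K where K: "\<And>x. norm (w x) \<le> K" using assms by (auto simp: bdd_supp_def)
  obtain R where R: "\<And>x. w x \<noteq> 0 \<Longrightarrow> norm x \<le> R" using assms by (auto simp: bdd_supp_def bounded_iff)
  have "set_integrable lborel (cball 0 R) w"
  proof (rule set_integrable_bound[where f="\<lambda>_. K"])
    show "set_integrable lborel (cball (0 :: 'a) R) (\<lambda>_. K)"
      unfolding set_integrable_def by (intro integrable_scaleR_left impI integrable_real_indicator) (use emeasure_bounded_finite[of "cball (0::'a) R"] in auto)
    show "set_borel_measurable lborel (cball 0 R) w"
      using bdd_supp_measurable[OF assms] by (simp add: set_borel_measurable_def borel_measurable_indicator borel_measurable_scaleR)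
    show "AE x in lborel. x \<in> cball 0 R \<longrightarrow> norm (w x) \<le> norm K"
      using order_trans[OF K abs_ge_self] by (intro AE_I2) auto
  qed
  moreover have "(\<lambda>x. indicator (cball 0 R) x *\<^sub>R w x) = w"
    using R by (force simp: indicator_def)
  ultimately show ?thesis by (simp add: set_integrable_def)
qed

lemma borel_measurable_cnj [measurable]:
  "f \<in> borel_measurable M \<Longrightarrow> (\<lambda>x. cnj (f x)) \<in> borel_measurable M"
  by (rule borel_measurable_continuous_on[of cnj]) (auto intro: continuous_intros)

lemma borel_measurable_cis [measurable]:
  "f \<in> borel_measurable M \<Longrightarrow> (\<lambda>x. cis (f x)) \<in> borel_measurable M"
  by (rule borel_measurable_continuous_on[of cis]) (auto intro: continuous_intros)

lemma measurable_vec_nth_borel [measurable]: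
  "f \<in> M \<rightarrow>\<^sub>M (borel :: (real ^ 'n::finite) measure) \<Longrightarrow> (\<lambda>x. f x $ i) \<in> borel_measurable M"
  by (rule borel_measurable_continuous_on[of "\<lambda>v. v $ i"]) (auto intro: continuous_intros)

lemma measurable_fst_borel [measurable]:
  "fst \<in> (borel :: ('a::euclidean_space \<times> 'b::euclidean_space) measure) \<rightarrow>\<^sub>M borel"
  by (simp add: borel_prod[symmetric])

lemma measurable_snd_borel [measurable]:
  "snd \<in> (borel :: ('a::euclidean_space \<times> 'b::euclidean_space) measure) \<rightarrow>\<^sub>M borel"
  by (simp add: borel_prod[symmetric])

lemma bdd_supp_cnj: "bdd_supp w \<Longrightarrow> bdd_supp (\<lambda>x. cnj (w x))"
  by (auto simp: bdd_supp_def)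

lemma bdd_supp_integrable_norm2:
  assumes "bdd_supp w"
  shows "integrable lborel (\<lambda>x. (norm (w x))\<^sup>2)"
proof -
  obtain K where K: "\<And>x. norm (w x) \<le> K" using assms by (auto simp: bdd_supp_def)
  have "bdd_supp (\<lambda>x. cnj (w x) * w x)"
    by (rule bdd_supp_mult[OF assms, where C=K]) (use assms K in \<open>auto simp: bdd_supp_def\<close>)
  from integrable_norm[OF bdd_supp_integrable[OF this]] show ?thesis
    by (simp add: norm_mult power2_eq_square)
qed

section \<open>The L^2 norm and the Cauchy-Schwarz inequality\<close>

lemma L2_norm_nonneg: "0 \<le> L2_norm N f"
  by (simp add: L2_norm_def)

lemma L2_norm_sq: "(L2_norm N f)\<^sup>2 = (LINT x|N. (norm (f x))\<^sup>2)"
  by (simp add: L2_norm_def)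

lemma L2_norm_mono:
  assumes "integrable N (\<lambda>x. (norm (g x))\<^sup>2)" "f \<in> borel_measurable N" "\<And>x. norm (f x) \<le> norm (g x)"
  shows "L2_norm N f \<le> L2_norm N g"
proof -
  have le: "(norm (f x))\<^sup>2 \<le> (norm (g x))\<^sup>2" for x using assms(3) by (intro power_mono) auto
  have "integrable N (\<lambda>x. (norm (f x))\<^sup>2)"
    by (rule Bochner_Integration.integrable_bound[OF assms(1)]) (use assms le in auto)
  then show ?thesis unfolding L2_norm_def
    by (intro real_sqrt_le_mono integral_mono le assms)
qed

lemma bdd_supp_L2_mono:
  "bdd_supp w \<Longrightarrow> f \<in> borel_measurable borel \<Longrightarrow> (\<And>x. norm (f x) \<le> norm (w x))
    \<Longrightarrow> L2_norm lborel f \<le> L2_norm lborel w"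
  by (rule L2_norm_mono) (auto intro: bdd_supp_integrable_norm2)

lemma
  fixes f g :: "'a \<Rightarrow> complex"
  assumes [measurable]: "f \<in> borel_measurable N" "g \<in> borel_measurable N"
    and f: "integrable N (\<lambda>x. (norm (f x))\<^sup>2)" and g: "integrable N (\<lambda>x. (norm (g x))\<^sup>2)"
  shows integrable_mult_L2: "integrable N (\<lambda>x. f x * g x)"
    and integral_mult_L2: "(LINT x|N. norm (f x * g x)) \<le> L2_norm N f * L2_norm N g"
proof -
  have cs: "(\<integral>\<^sup>+x. ennreal (norm (f x * g x)) \<partial>N)\<^sup>2
      \<le> ennreal ((LINT x|N. (norm (f x))\<^sup>2) * (LINT x|N. (norm (g x))\<^sup>2))"
    using Cauchy_Schwarz_nn_integral[of "\<lambda>x. ennreal (norm (f x))" N "\<lambda>x. ennreal (norm (g x))"]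
    by (simp add: ennreal_power nn_integral_eq_integral f g ennreal_mult norm_mult)
  have "(\<integral>\<^sup>+x. ennreal (norm (f x * g x)) \<partial>N)\<^sup>2 < \<infinity>"
    using cs by (rule le_less_trans) simp
  then have "(\<integral>\<^sup>+x. ennreal (norm (f x * g x)) \<partial>N) < \<infinity>"
    by (simp add: power_less_top_ennreal)
  then show i: "integrable N (\<lambda>x. f x * g x)"
    by (simp add: integrable_iff_bounded)
  have "ennreal ((LINT x|N. norm (f x * g x))\<^sup>2) = (\<integral>\<^sup>+x. ennreal (norm (f x * g x)) \<partial>N)\<^sup>2"
    using i by (simp add: nn_integral_eq_integral ennreal_power)
  also note cs
  finally have "(LINT x|N. norm (f x * g x))\<^sup>2 \<le> (LINT x|N. (norm (f x))\<^sup>2) * (LINT x|N. (norm (g x))\<^sup>2)"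
    by (subst (asm) ennreal_le_iff) auto
  then have "(LINT x|N. norm (f x * g x))\<^sup>2 \<le> (L2_norm N f * L2_norm N g)\<^sup>2"
    by (simp add: power_mult_distrib L2_norm_sq)
  then show "(LINT x|N. norm (f x * g x)) \<le> L2_norm N f * L2_norm N g"
    by (rule power2_le_imp_le) (simp add: L2_norm_nonneg)
qed


text \<open>What is needed of a convergence factor in one coordinate of p. The bound 1 allows a
  Gaussian to be exchanged for one of its rescaled derivatives without touching any constant;
  continuity is there for the fundamental theorem of calculus.\<close>

definition reg :: "(real \<Rightarrow> real) \<Rightarrow> bool" where
  "reg \<gamma> \<longleftrightarrow> continuous_on UNIV \<gamma> \<and> (\<forall>t. \<bar>\<gamma> t\<bar> \<le> 1) \<and> integrable lborel \<gamma>"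

definition tensor :: "('n::finite \<Rightarrow> real \<Rightarrow> real) \<Rightarrow> real ^ 'n \<Rightarrow> real" where
  "tensor \<gamma> p = (\<Prod>i\<in>UNIV. \<gamma> i (p $ i))"

lemma reg_gauss: "\<epsilon> > 0 \<Longrightarrow> reg (gauss \<epsilon>)"
  using gauss_le_1[of \<epsilon>] gauss_pos[of \<epsilon>]
  by (auto simp: reg_def continuous_gauss integrable_gauss abs_of_pos)

lemma reg_measurable: "reg \<gamma> \<Longrightarrow> \<gamma> \<in> borel_measurable borel"
  by (simp add: reg_def borel_measurable_continuous_onI)

lemma tensor_measurable [measurable]:
  assumes "\<And>i. \<gamma> i \<in> borel_measurable borel"
  shows "tensor \<gamma> \<in> borel_measurable borel"
  unfolding tensor_def[abs_def] using assms by measurable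

lemma abs_tensor_le_1: "(\<And>i. reg (\<gamma> i)) \<Longrightarrow> \<bar>tensor \<gamma> p\<bar> \<le> 1"
  unfolding tensor_def abs_prod by (intro prod_le_1) (auto simp: reg_def)

lemma
  fixes f :: "'n::finite \<Rightarrow> real \<Rightarrow> real"
  assumes "\<And>i. integrable lborel (f i)"
  shows integrable_tensor: "integrable lborel (tensor f)"
    and integral_tensor: "integral\<^sup>L lborel (tensor f) = (\<Prod>i\<in>UNIV. LINT t|lborel. f i t)"
proof -
  have "integrable lborel (\<lambda>x. Re (\<Prod>i\<in>UNIV. complex_of_real (f i (x $ i))))"
    by (intro integrable_Re integrable_prod_vec integrable_of_real assms)
  then show i: "integrable lborel (tensor f)"
    unfolding of_real_prod[symmetric] Re_complex_of_real tensor_def[abs_def] .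
  have "of_real (integral\<^sup>L lborel (tensor f)) = integral\<^sup>L lborel (\<lambda>x. \<Prod>i\<in>UNIV. complex_of_real (f i (x $ i)))"
    unfolding tensor_def[abs_def] of_real_prod[symmetric] by (rule integral_complex_of_real[symmetric])
  also have "\<dots> = (\<Prod>i\<in>UNIV. LINT t|lborel. complex_of_real (f i t))"
    by (rule integral_prod_vec[of "\<lambda>i t. complex_of_real (f i t)"]) (intro integrable_of_real assms)
  also have "\<dots> = (\<Prod>i\<in>UNIV. complex_of_real (LINT t|lborel. f i t))"
    by (simp only: integral_complex_of_real)
  finally have "of_real (integral\<^sup>L lborel (tensor f)) = (\<Prod>i\<in>UNIV. complex_of_real (LINT t|lborel. f i t))" .
  then show "integral\<^sup>L lborel (tensor f) = (\<Prod>i\<in>UNIV. LINT t|lborel. f i t)"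
    unfolding of_real_prod[symmetric] of_real_eq_iff .
qed

lemma cis_sum: "finite A \<Longrightarrow> cis (\<Sum>i\<in>A. f i) = (\<Prod>i\<in>A. cis (f i))"
  by (induction A rule: finite_induct) (auto simp: cis_mult[symmetric])

lemma tendsto_tensor_gauss:
  assumes "\<epsilon> \<longlonglongrightarrow> 0"
  shows "(\<lambda>n. tensor (\<lambda>_. gauss (\<epsilon> n)) p) \<longlonglongrightarrow> 1"
proof -
  have "(\<lambda>n. \<Prod>i\<in>UNIV. gauss (\<epsilon> n) (p $ i)) \<longlonglongrightarrow> (\<Prod>i\<in>(UNIV :: 'a set). exp (- (0 * p $ i)\<^sup>2 / 2))"
    unfolding gauss_def using assms by (intro tendsto_intros) auto
  then show ?thesis by (simp add: tensor_def)
qed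

lemma norm_integral_le_nn_integral:
  fixes f :: "'a \<Rightarrow> 'b::{banach, second_countable_topology}"
  shows "ennreal (norm (integral\<^sup>L M f)) \<le> (\<integral>\<^sup>+x. norm (f x) \<partial>M)"
  by (cases "integrable M f") (auto simp: not_integrable_integral_eq intro: integral_norm_bound_ennreal)

text \<open>The Fourier transform of the Gaussian convergence factor. Its mass
  \<open>(2 * pi) ^ CARD('n)\<close> is the same for every \<epsilon> and becomes the constant in
  Plancherel's inequality.\<close>

definition gauss_kernel :: "real \<Rightarrow> real ^ 'n::finite \<Rightarrow> real" where
  "gauss_kernel \<epsilon> = tensor (\<lambda>_ t. 2 * pi * normal_density 0 \<epsilon> t)"

lemma gauss_kernel_nonneg: "0 \<le> gauss_kernel \<epsilon> x"
  by (auto simp: gauss_kernel_def tensor_def intro!: prod_nonneg mult_nonneg_nonneg)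

lemma gauss_kernel_measurable [measurable]: "gauss_kernel \<epsilon> \<in> borel_measurable borel"
  unfolding gauss_kernel_def by measurable

lemma gauss_kernel_minus: "gauss_kernel \<epsilon> (x - y) = gauss_kernel \<epsilon> (y - x)"
  by (simp add: gauss_kernel_def tensor_def normal_density_def power2_commute)

lemma nn_integral_gauss_kernel_diff:
  fixes x :: "real ^ 'n::finite"
  assumes "\<epsilon> > 0"
  shows "(\<integral>\<^sup>+y. ennreal (gauss_kernel \<epsilon> (x - y)) \<partial>lborel) = ennreal ((2 * pi) ^ CARD('n))"
proof -
  have "integrable lborel (gauss_kernel \<epsilon> :: real ^ 'n \<Rightarrow> real)"
    unfolding gauss_kernel_def by (rule integrable_tensor) (simp add: assms)
  moreover have "integral\<^sup>L lborel (gauss_kernel \<epsilon> :: real ^ 'n \<Rightarrow> real) = (2 * pi) ^ CARD('n)"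
    unfolding gauss_kernel_def by (subst integral_tensor) (simp_all add: assms)
  ultimately have *: "(\<integral>\<^sup>+y. ennreal (gauss_kernel \<epsilon> (y :: real ^ 'n)) \<partial>lborel) = ennreal ((2 * pi) ^ CARD('n))"
    by (simp add: nn_integral_eq_integral gauss_kernel_nonneg)
  have "(\<integral>\<^sup>+y. ennreal (gauss_kernel \<epsilon> (y :: real ^ 'n)) \<partial>lborel) = (\<integral>\<^sup>+y. ennreal (gauss_kernel \<epsilon> (- x + y)) \<partial>lborel)"
    by (subst lborel_distr_plus[of "- x", symmetric], subst nn_integral_distr) simp_all
  also have "\<dots> = (\<integral>\<^sup>+y. ennreal (gauss_kernel \<epsilon> (x - y)) \<partial>lborel)"
    by (subst gauss_kernel_minus) simp
  finally show ?thesis using * by simp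
qed

lemma borel_measurable_gauss_kernel_diff: "(\<lambda>x. ennreal (gauss_kernel \<epsilon> (x - y))) \<in> borel_measurable lborel"
  by measurable

lemma nn_integral_gauss_kernel_diff':
  fixes y :: "real ^ 'n::finite"
  assumes "\<epsilon> > 0"
  shows "(\<integral>\<^sup>+x. ennreal (gauss_kernel \<epsilon> (x - y)) \<partial>lborel) = ennreal ((2 * pi) ^ CARD('n))"
  unfolding gauss_kernel_minus[of \<epsilon> _ y] by (rule nn_integral_gauss_kernel_diff[OF assms])

lemma integral_tensor_gauss_cis:
  fixes x :: "real ^ 'n::finite"
  assumes "\<epsilon> > 0"
  shows "(LINT p|lborel. of_real (tensor (\<lambda>_. gauss \<epsilon>) p) * cis (p \<bullet> x)) = of_real (gauss_kernel \<epsilon> x)"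
proof -
  have "(LINT p|lborel. of_real (tensor (\<lambda>_. gauss \<epsilon>) p) * cis (p \<bullet> x))
    = integral\<^sup>L lborel (\<lambda>p. \<Prod>i\<in>UNIV. (\<lambda>i t. of_real (gauss \<epsilon> t) * cis (t * x $ i)) i (p $ i))"
    by (simp add: tensor_def inner_vec_def cis_sum prod.distrib)
  also have "\<dots> = (\<Prod>i\<in>UNIV. LINT t|lborel. of_real (gauss \<epsilon> t) * cis (t * x $ i))"
  proof (rule integral_prod_vec)
    fix i
    show "complex_integrable lborel (\<lambda>t. complex_of_real (gauss \<epsilon> t) * cis (t * x $ i))"
      by (rule Bochner_Integration.integrable_bound[OF integrable_gauss[OF assms]])
        (auto simp: norm_mult)
  qed
  also have "\<dots> = of_real (gauss_kernel \<epsilon> x)"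
    by (simp add: integral_gauss_cis[OF assms] gauss_kernel_def tensor_def)
  finally show ?thesis .
qed

text \<open>With a Gaussian weight, the integral of the squared modulus of \<open>W\<close> is a
  double integral of w(x) times the conjugate of w(y) against \<open>gauss_kernel\<close>. The
  inequality 2ab \<le> a^2 + b^2 and the mass of the kernel bound it uniformly in \<epsilon>, and
  Fatou's lemma removes the weight. The inequality alone is wanted, so the kernel need not be shown
  to concentrate at 0. The two signs serve the two sides of the bilinear form.\<close>

lemma
  fixes w :: "real ^ 'n::finite \<Rightarrow> complex"
  assumes w: "bdd_supp w" and s: "s = 1 \<or> s = - 1"
  defines "W \<equiv> \<lambda>p. LINT q|lborel. cis (s * (p \<bullet> q)) * w q"
  shows fourier_measurable: "W \<in> borel_measurable borel"
    and integrable_fourier: "integrable lborel (\<lambda>p. (norm (W p))\<^sup>2)"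
    and L2_fourier: "L2_norm lborel W \<le> sqrt ((2 * pi) ^ CARD('n)) * L2_norm lborel w"
proof -
  note [measurable] = bdd_supp_measurable[OF w]
  note iw = bdd_supp_integrable[OF w] and iw2 = bdd_supp_integrable_norm2[OF w]
  show Wm [measurable]: "W \<in> borel_measurable borel"
    unfolding W_def by measurable
  let ?P = "(2 * pi) ^ CARD('n)"
  let ?I = "LINT q|lborel. (norm (w q))\<^sup>2"
  have key: "(\<integral>\<^sup>+p. ennreal (tensor (\<lambda>_. gauss \<epsilon>) p * (norm (W p))\<^sup>2) \<partial>lborel) \<le> ennreal (?P * ?I)"
    if \<epsilon>: "\<epsilon> > 0" for \<epsilon>
  proof -
    let ?G = "tensor (\<lambda>_. gauss \<epsilon>) :: real ^ 'n \<Rightarrow> real"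
    have G0: "?G p \<ge> 0" for p unfolding tensor_def by (intro prod_nonneg) (auto intro: less_imp_le gauss_pos)
    have Gi: "integrable lborel ?G" by (intro integrable_tensor integrable_gauss \<epsilon>)
    define F where "F = (\<lambda>z :: (real ^ 'n) \<times> (real ^ 'n) \<times> (real ^ 'n). of_real (?G (fst z)) * cis (s * (fst z \<bullet> (fst (snd z) - snd (snd z))))
       * (w (fst (snd z)) * cnj (w (snd (snd z)))))"
    have ww: "integrable lborel (\<lambda>y. w (fst y) * cnj (w (snd y)))"
      by (intro integrable_lborel_mult iw bdd_supp_integrable bdd_supp_cnj w)
    have F: "integrable lborel F"
    proof (rule Bochner_Integration.integrable_bound)
      show "integrable lborel (\<lambda>z. of_real (?G (fst z)) * ((\<lambda>y. w (fst y) * cnj (w (snd y))) (snd z)))"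
        by (intro integrable_lborel_mult integrable_of_real Gi ww)
      show "F \<in> borel_measurable lborel" unfolding F_def by measurable
    qed (simp add: F_def norm_mult)
    have W2: "W p * cnj (W p) = (LINT y|lborel. cis (s * (p \<bullet> (fst y - snd y))) * (w (fst y) * cnj (w (snd y))))" for p
    proof -
      have c: "bdd_supp (\<lambda>q. cis (s * (p \<bullet> q)) * w q)" by (rule bdd_supp_mult[OF w, where C=1]) auto
      have "(LINT y|lborel. cis (s * (p \<bullet> (fst y - snd y))) * (w (fst y) * cnj (w (snd y))))
        = (LINT y|lborel. (cis (s * (p \<bullet> fst y)) * w (fst y)) * cnj (cis (s * (p \<bullet> snd y)) * w (snd y)))"
        by (intro Bochner_Integration.integral_cong refl)
          (simp add: cis_cnj inner_diff_right right_diff_distrib cis_divide[symmetric] divide_inverse cis_inverse)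
      also have "\<dots> = (LINT x|lborel. LINT y|lborel. (cis (s * (p \<bullet> x)) * w x) * cnj (cis (s * (p \<bullet> y)) * w y))"
        by (subst lborel_fubini(1)) (use integrable_lborel_mult[OF bdd_supp_integrable[OF c] bdd_supp_integrable[OF bdd_supp_cnj[OF c]]] in simp_all)
      also have "\<dots> = W p * cnj (W p)"
        unfolding W_def Bochner_Integration.integral_mult_left_zero Bochner_Integration.integral_mult_right_zero
        by (rule arg_cong[OF Bochner_Integration.integral_cnj])
      finally show ?thesis by simp
    qed
    have "(LINT z|lborel. F z) = (LINT p|lborel. of_real (?G p * (norm (W p))\<^sup>2))"
      unfolding lborel_fubini(1)[OF F] unfolding F_def
      by (simp only: fst_conv snd_conv mult.assoc Bochner_Integration.integral_mult_right_zero W2[symmetric]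
          of_real_mult complex_norm_square)
    then have 1: "of_real (LINT p|lborel. ?G p * (norm (W p))\<^sup>2) = (LINT z|lborel. F z)"
      by (simp only: integral_complex_of_real)
    have "(LINT z|lborel. F z) = (LINT y|lborel. of_real (gauss_kernel \<epsilon> (fst y - snd y)) * (w (fst y) * cnj (w (snd y))))"
      unfolding lborel_fubini(2)[OF F] unfolding F_def
    proof (rule Bochner_Integration.integral_cong[OF refl])
      fix y :: "(real ^ 'n) \<times> (real ^ 'n)"
      \<comment> \<open>The kernel is even, so both signs \<open>s\<close> lead to it.\<close>
      have "(LINT x|lborel. of_real (?G x) * cis (s * (x \<bullet> (fst y - snd y)))) = of_real (gauss_kernel \<epsilon> (fst y - snd y))"
        using s integral_tensor_gauss_cis[OF \<epsilon>, of "fst y - snd y"] integral_tensor_gauss_cis[OF \<epsilon>, of "snd y - fst y"]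
        by (auto simp: gauss_kernel_minus[of \<epsilon> "snd y"] inner_diff_right)
      then show "(LINT x|lborel. of_real (?G (fst (x, y))) * cis (s * (fst (x, y) \<bullet> (fst (snd (x, y)) - snd (snd (x, y))))) *
          (w (fst (snd (x, y))) * cnj (w (snd (snd (x, y)))))) = of_real (gauss_kernel \<epsilon> (fst y - snd y)) * (w (fst y) * cnj (w (snd y)))"
        by simp
    qed
    then have "ennreal (norm (of_real (LINT p|lborel. ?G p * (norm (W p))\<^sup>2) :: complex))
      = ennreal (norm (LINT y|lborel. of_real (gauss_kernel \<epsilon> (fst y - snd y)) * (w (fst y) * cnj (w (snd y)))))"
      using 1 by simp
    also have "\<dots> \<le> (\<integral>\<^sup>+y. norm (of_real (gauss_kernel \<epsilon> (fst y - snd y)) * (w (fst y) * cnj (w (snd y)))) \<partial>lborel)"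
      by (rule norm_integral_le_nn_integral)
    \<comment> \<open>Both sides are doubled so that 2ab \<le> a^2 + b^2 applies without a division
      in \<open>ennreal\<close>; the factor 2 cancels at the end.\<close>
    finally have "2 * ennreal (norm (of_real (LINT p|lborel. ?G p * (norm (W p))\<^sup>2) :: complex))
      \<le> 2 * (\<integral>\<^sup>+y. norm (of_real (gauss_kernel \<epsilon> (fst y - snd y)) * (w (fst y) * cnj (w (snd y)))) \<partial>lborel)"
      by (rule mult_left_mono) simp
    also have "\<dots> = (\<integral>\<^sup>+y. 2 * ennreal (norm (of_real (gauss_kernel \<epsilon> (fst y - snd y)) * (w (fst y) * cnj (w (snd y))))) \<partial>lborel)"
      by (rule nn_integral_cmult[symmetric]) measurable
    also have "\<dots> \<le> (\<integral>\<^sup>+y. ennreal ((norm (w (fst y)))\<^sup>2) * ennreal (gauss_kernel \<epsilon> (fst y - snd y))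
        + ennreal ((norm (w (snd y)))\<^sup>2) * ennreal (gauss_kernel \<epsilon> (fst y - snd y)) \<partial>lborel)"
    proof (rule nn_integral_mono)
      fix y :: "(real ^ 'n) \<times> (real ^ 'n)"
      let ?g = "gauss_kernel \<epsilon> (fst y - snd y)" and ?a = "norm (w (fst y))" and ?b = "norm (w (snd y))"
      have "?g * (2 * (?a * ?b)) \<le> ?g * (?a\<^sup>2 + ?b\<^sup>2)"
        using sum_squares_bound[of ?a ?b] by (intro mult_left_mono gauss_kernel_nonneg) simp
      then have "2 * (?g * (?a * ?b)) \<le> ?a\<^sup>2 * ?g + ?b\<^sup>2 * ?g"
        by (simp add: algebra_simps)
      then have "ennreal (2 * (?g * (?a * ?b))) \<le> ennreal (?a\<^sup>2 * ?g + ?b\<^sup>2 * ?g)"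
        by (rule ennreal_leI)
      then show "2 * ennreal (norm (of_real ?g * (w (fst y) * cnj (w (snd y))))) \<le>
          ennreal (?a\<^sup>2) * ennreal ?g + ennreal (?b\<^sup>2) * ennreal ?g"
        by (simp add: ennreal_mult ennreal_plus norm_mult gauss_kernel_nonneg mult_nonneg_nonneg del: power_mono_iff)
    qed
    also have "\<dots> = (\<integral>\<^sup>+y. ennreal ((norm (w (fst y)))\<^sup>2) * ennreal (gauss_kernel \<epsilon> (fst y - snd y)) \<partial>lborel)
        + (\<integral>\<^sup>+y. ennreal ((norm (w (snd y)))\<^sup>2) * ennreal (gauss_kernel \<epsilon> (fst y - snd y)) \<partial>lborel)"
      by (rule nn_integral_add) measurable
    also have "(\<integral>\<^sup>+y. ennreal ((norm (w (fst y)))\<^sup>2) * ennreal (gauss_kernel \<epsilon> (fst y - snd y)) \<partial>lborel)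
      = (\<integral>\<^sup>+x. \<integral>\<^sup>+y. ennreal ((norm (w x))\<^sup>2) * ennreal (gauss_kernel \<epsilon> (x - y)) \<partial>lborel \<partial>lborel)"
    proof -
      have m: "(\<lambda>y :: (real ^ 'n) \<times> (real ^ 'n). ennreal ((norm (w (fst y)))\<^sup>2) * ennreal (gauss_kernel \<epsilon> (fst y - snd y))) \<in> borel_measurable borel"
        by measurable
      show ?thesis
        using lborel.nn_integral_fst[of _ "lborel :: (real ^ 'n) measure", unfolded lborel_prod, simplified, OF m] by simp
    qed
    also have "\<dots> = ennreal (?P * ?I)"
      by (simp add: nn_integral_cmult nn_integral_gauss_kernel_diff[OF \<epsilon>] nn_integral_multc nn_integral_eq_integral iw2
          ennreal_mult mult.commute)
    also have "(\<integral>\<^sup>+y. ennreal ((norm (w (snd y)))\<^sup>2) * ennreal (gauss_kernel \<epsilon> (fst y - snd y)) \<partial>lborel)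
      = (\<integral>\<^sup>+y. \<integral>\<^sup>+x. ennreal ((norm (w y))\<^sup>2) * ennreal (gauss_kernel \<epsilon> (x - y)) \<partial>lborel \<partial>lborel)"
    proof -
      have m: "(\<lambda>y :: (real ^ 'n) \<times> (real ^ 'n). ennreal ((norm (w (snd y)))\<^sup>2) * ennreal (gauss_kernel \<epsilon> (fst y - snd y))) \<in> borel_measurable borel"
        by measurable
      show ?thesis
        using lborel_pair.nn_integral_snd[of "\<lambda>y :: (real ^ 'n) \<times> (real ^ 'n). ennreal ((norm (w (snd y)))\<^sup>2) * ennreal (gauss_kernel \<epsilon> (fst y - snd y))", unfolded lborel_prod] m
        by simp
    qed
    also have "\<dots> = ennreal (?P * ?I)"
      unfolding nn_integral_cmult[OF borel_measurable_gauss_kernel_diff] nn_integral_gauss_kernel_diff'[OF \<epsilon>]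
      by (subst nn_integral_multc) (auto simp: nn_integral_eq_integral iw2 ennreal_mult mult.commute)
    also have "ennreal (?P * ?I) + ennreal (?P * ?I) = 2 * ennreal (?P * ?I)"
      by (rule mult_2[symmetric])
    finally have *: "ennreal \<bar>LINT p|lborel. ?G p * (norm (W p))\<^sup>2\<bar> \<le> ennreal (?P * ?I)"
      by (simp add: ennreal_mult_le_mult_iff)
    have Wb: "norm (W p) \<le> (LINT q|lborel. norm (w q))" for p
      unfolding W_def by (rule order_trans[OF integral_norm_bound]) (simp add: norm_mult)
    have "integrable lborel (\<lambda>p. ?G p * (norm (W p))\<^sup>2)"
    proof (rule Bochner_Integration.integrable_bound)
      show "integrable lborel (\<lambda>p. ?G p * (LINT q|lborel. norm (w q))\<^sup>2)"
        by (intro integrable_mult_left Gi)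
      show "AE x in lborel. norm (?G x * (norm (W x))\<^sup>2) \<le> norm (?G x * (LINT q|lborel. norm (w q))\<^sup>2)"
        using Wb G0 by (intro AE_I2) (auto simp: abs_mult intro!: mult_left_mono power_mono)
    qed measurable
    then have "(\<integral>\<^sup>+p. ennreal (?G p * (norm (W p))\<^sup>2) \<partial>lborel) = ennreal (LINT p|lborel. ?G p * (norm (W p))\<^sup>2)"
      by (rule nn_integral_eq_integral) (intro AE_I2 mult_nonneg_nonneg G0 zero_le_power2)
    also have "\<dots> \<le> ennreal \<bar>LINT p|lborel. ?G p * (norm (W p))\<^sup>2\<bar>"
      by (rule ennreal_leI) simp
    also note *
    finally show ?thesis .
  qed
  have lim: "(\<lambda>n. ennreal (tensor (\<lambda>_. gauss (1 / real (Suc n))) p * (norm (W p))\<^sup>2)) \<longlonglongrightarrow> ennreal ((norm (W p))\<^sup>2)" for p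
    using tendsto_tensor_gauss[of "\<lambda>n. 1 / real (Suc n)" p] LIMSEQ_Suc[OF lim_1_over_n]
    by (intro tendsto_ennrealI) (auto intro!: tendsto_eq_intros)
  have "(\<integral>\<^sup>+p. ennreal ((norm (W p))\<^sup>2) \<partial>lborel)
      = (\<integral>\<^sup>+p. liminf (\<lambda>n. ennreal (tensor (\<lambda>_. gauss (1 / real (Suc n))) p * (norm (W p))\<^sup>2)) \<partial>lborel)"
    by (intro nn_integral_cong) (rule lim_imp_Liminf[OF sequentially_bot lim, symmetric])
  also have "\<dots> \<le> liminf (\<lambda>n. \<integral>\<^sup>+p. ennreal (tensor (\<lambda>_. gauss (1 / real (Suc n))) p * (norm (W p))\<^sup>2) \<partial>lborel)"
    by (rule nn_integral_liminf) measurable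
  also have "\<dots> \<le> ennreal (?P * ?I)"
    by (intro Liminf_le always_eventually allI key) simp_all
  finally have fin: "(\<integral>\<^sup>+p. ennreal ((norm (W p))\<^sup>2) \<partial>lborel) \<le> ennreal (?P * ?I)" .
  then have "(\<integral>\<^sup>+p. ennreal (norm ((norm (W p))\<^sup>2)) \<partial>lborel) < \<infinity>"
    by (simp add: le_less_trans)
  then show i: "integrable lborel (\<lambda>p. (norm (W p))\<^sup>2)"
    by (intro integrableI_bounded) measurable
  have "(LINT p|lborel. (norm (W p))\<^sup>2) \<le> ?P * ?I"
    using fin by (subst (asm) nn_integral_eq_integral[OF i]) (auto simp: ennreal_le_iff)
  then show "L2_norm lborel W \<le> sqrt ((2 * pi) ^ CARD('n)) * L2_norm lborel w"
    unfolding L2_norm_def real_sqrt_mult[symmetric] by (rule real_sqrt_le_mono)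
qed

subsection \<open>Freezing coordinates\<close>

lemma dir_deriv_scaleR:
  assumes "\<And>x. f differentiable (at x)"
  shows "dir_deriv v (\<lambda>x. c *\<^sub>R f x) = (\<lambda>x. c *\<^sub>R dir_deriv v f x)"
proof
  fix x
  have "((\<lambda>x. c *\<^sub>R f x) has_derivative (\<lambda>h. c *\<^sub>R frechet_derivative f (at x) h)) (at x)"
    using assms[of x] by (intro has_derivative_scaleR_right) (simp add: frechet_derivative_works)
  then show "dir_deriv v (\<lambda>x. c *\<^sub>R f x) x = c *\<^sub>R dir_deriv v f x"
    unfolding dir_deriv_def by (simp add: frechet_derivative_at[symmetric])
qed

lemma C_k_scaleR: "C_k k f \<Longrightarrow> C_k k (\<lambda>x. c *\<^sub>R f x)"
proof (induction k arbitrary: f)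
  case 0
  then show ?case by (auto intro: continuous_intros)
next
  case (Suc k)
  then show ?case by (auto simp: dir_deriv_scaleR intro: differentiable_scaleR)
qed

lemma smooth_scaleR: "smooth f \<Longrightarrow> smooth (\<lambda>x. c *\<^sub>R f x)"
  by (simp add: smooth_def C_k_scaleR)

lemma smooth_dir_deriv: "smooth f \<Longrightarrow> smooth (dir_deriv v f)"
  unfolding smooth_def using C_k.simps(2) by blast

lemma smooth_continuous: "smooth f \<Longrightarrow> continuous_on A f"
  unfolding smooth_def using C_k.simps(1) continuous_on_subset by blast

lemma smooth_differentiable: "smooth f \<Longrightarrow> f differentiable (at x)"
  unfolding smooth_def using C_k.simps(2) by blast

lemma smooth_borel_measurable: "smooth f \<Longrightarrow> f \<in> borel_measurable borel"
  by (intro borel_measurable_continuous_onI smooth_continuous)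

lemma smooth_wderiv1: "smooth f \<Longrightarrow> smooth (wderiv1 e c i f)"
  unfolding wderiv1_def by (intro smooth_scaleR smooth_dir_deriv)

lemma smooth_wderiv1_pow: "smooth f \<Longrightarrow> smooth ((wderiv1 e c i ^^ k) f)"
  by (induction k) (auto intro: smooth_wderiv1)

lemma smooth_foldr_wderiv1: "smooth f \<Longrightarrow> smooth (foldr (\<lambda>i. wderiv1 e c i ^^ A i) xs f)"
  by (induction xs) (auto intro: smooth_wderiv1_pow)

lemma smooth_wderiv: "smooth f \<Longrightarrow> smooth (wderiv e c A f)"
  unfolding wderiv_def by (rule smooth_foldr_wderiv1)

lemma smooth_has_vector_derivative:
  assumes "smooth f"
  shows "((\<lambda>s. f (x + s *\<^sub>R v)) has_vector_derivative dir_deriv v f (x + s *\<^sub>R v)) (at s within S)"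
proof -
  have "(f has_derivative frechet_derivative f (at (x + s *\<^sub>R v))) (at (x + s *\<^sub>R v))"
    using smooth_differentiable[OF assms] by (simp add: frechet_derivative_works)
  moreover have "((\<lambda>s. x + s *\<^sub>R v) has_derivative (\<lambda>h. h *\<^sub>R v)) (at s within S)"
    by (auto intro!: derivative_eq_intros)
  ultimately have "((\<lambda>s. f (x + s *\<^sub>R v)) has_derivative (\<lambda>h. frechet_derivative f (at (x + s *\<^sub>R v)) (h *\<^sub>R v))) (at s within S)"
    by (rule has_derivative_compose[rotated])
  moreover have "linear (frechet_derivative f (at (x + s *\<^sub>R v)))"
    using smooth_differentiable[OF assms] by (rule linear_frechet_derivative)
  ultimately show ?thesis
    by (simp add: has_vector_derivative_def dir_deriv_def linear_cmul)
qed

text \<open>The factor that \<open>wderiv1\<close> puts before the i-th derivative. With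
  \<open>inverse c\<close> in place of \<open>c\<close> it is also the side of the boxes, so that
  integrating an unscaled derivative over a side costs exactly one scaled derivative.\<close>

definition wgt :: "real \<Rightarrow> 'n::{finite,linorder} \<Rightarrow> real" where
  "wgt c i = (if i = radial then 1 else c)"

lemma wgt_pos: "c > 0 \<Longrightarrow> wgt c i > 0"
  by (simp add: wgt_def)

lemma dir_deriv_eq_wderiv1: "c > 0 \<Longrightarrow> dir_deriv (e i) f x = inverse (wgt c i) *\<^sub>R wderiv1 e c i f x"
  by (simp add: wderiv1_def wgt_def)

definition bdd_supp_on :: "'a::euclidean_space set \<Rightarrow> ('a \<Rightarrow> complex) \<Rightarrow> bool" where
  "bdd_supp_on B w \<longleftrightarrow> bdd_supp w \<and> (\<forall>x. w x \<noteq> 0 \<longrightarrow> x \<in> B)"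

lemma bdd_supp_on_mult:
  assumes "bdd_supp_on B w" "f \<in> borel_measurable borel" "\<And>x. x \<in> B \<Longrightarrow> norm (f x) \<le> C"
  shows "bdd_supp_on B (\<lambda>x. f x * w x)"
  using assms bdd_supp_mult[of w f C] by (auto simp: bdd_supp_on_def)

text \<open>In \<open>freeze_block\<close>, \<open>xs\<close> lists the coordinates that still
  follow the variable point; the others are frozen at those of \<open>y\<close>.\<close>

definition mix :: "'n::finite list \<Rightarrow> real ^ 'n \<Rightarrow> real ^ 'n \<Rightarrow> real ^ 'n" where
  "mix xs y x = (\<chi> i. if i \<in> set xs then x $ i else y $ i)"

definition vupd :: "real ^ 'n::finite \<Rightarrow> 'n \<Rightarrow> real \<Rightarrow> real ^ 'n" where
  "vupd y i s = (\<chi> j. if j = i then s else y $ j)"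

lemma mix_snoc: "mix (xs @ [i]) y x = mix xs (vupd y i (x $ i)) x"
  by (auto simp: mix_def vupd_def vec_eq_iff)

lemma mix_vupd_shift:
  "i \<notin> set xs \<Longrightarrow> mix xs (vupd y i s) x = mix xs (vupd y i 0) x + s *\<^sub>R axis i 1"
  by (auto simp: mix_def vupd_def vec_eq_iff axis_def)

lemma continuous_mix_vupd: "continuous_on UNIV (\<lambda>z. mix xs (vupd y i (snd z)) (fst z))"
  unfolding mix_def
proof (rule continuous_on_vec_lambda)
  fix j
  show "continuous_on UNIV (\<lambda>z. if j \<in> set xs then fst z $ j else vupd y i (snd z) $ j)"
    by (cases "j \<in> set xs"; cases "j = i") (auto simp: vupd_def intro!: continuous_intros)
qed

lemma mix_in_cbox: "x \<in> cbox lo hi \<Longrightarrow> y \<in> cbox lo hi \<Longrightarrow> mix xs y x \<in> cbox lo hi"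
  by (auto simp: mem_box_cart mix_def)

lemma vupd_in_cbox: "y \<in> cbox lo hi \<Longrightarrow> lo $ i \<le> s \<Longrightarrow> s \<le> hi $ i \<Longrightarrow> vupd y i s \<in> cbox lo hi"
  by (auto simp: mem_box_cart vupd_def)

text \<open>
  On a box with side lengths equal to the weights, writing the amplitude one coordinate at a time as
  \<open>f(x\<^sub>i) = f(lo\<^sub>i) + \<integral> 1\<^bsub>s \<le> x\<^sub>i\<^esub> \<partial>\<^sub>i f(s) ds\<close> makes it a superposition of products, where the cut-off
  \<open>1\<^bsub>s \<le> x\<^sub>i\<^esub>\<close> is absorbed in \<open>w\<close> without increasing its norm.
\<close>

lemma foldr_id: "foldr (\<lambda>i. id) xs x = x"
  by (induction xs) auto

lemma freeze_block:
  fixes N :: "'m measure" and P :: "'n::{finite,linorder} point \<Rightarrow> 'm \<Rightarrow> 'e::euclidean_space"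
    and f :: "'e \<Rightarrow> complex"
  assumes N: "sigma_finite_measure N"
    and X[measurable]: "X \<in> N \<rightarrow>\<^sub>M borel" and k[measurable]: "k \<in> borel_measurable N"
    and P[measurable]: "(\<lambda>z. P (fst z) (snd z)) \<in> borel \<Otimes>\<^sub>M N \<rightarrow>\<^sub>M borel"
    and shift: "\<And>x t i \<omega>. P (x + t *\<^sub>R axis i 1) \<omega> = P x \<omega> + t *\<^sub>R e i"
    and c: "c > 0" and box: "\<And>i. hi $ i = lo $ i + wgt c i"
    and int: "\<And>w. bdd_supp_on (cbox lo hi) w \<Longrightarrow> integrable N (\<lambda>\<omega>. k \<omega> * w (X \<omega>))"
    and f: "smooth f"
    and bound: "\<And>A x \<omega>. (\<forall>i. A i \<le> 1) \<Longrightarrow> x \<in> cbox lo hi \<Longrightarrow> k \<omega> \<noteq> 0 \<Longrightarrow>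
       norm (wderiv e c A f (P x \<omega>)) \<le> D"
    and form: "\<And>A x w. (\<forall>i. A i \<le> 1) \<Longrightarrow> x \<in> cbox lo hi \<Longrightarrow> bdd_supp_on (cbox lo hi) w \<Longrightarrow>
       norm (LINT \<omega>|N. wderiv e c A f (P x \<omega>) * (k \<omega> * w (X \<omega>))) \<le> K * L2_norm lborel w"
    and w: "bdd_supp_on (cbox lo hi) w" and K: "K \<ge> 0"
  shows "norm (LINT \<omega>|N. f (P (X \<omega>) \<omega>) * (k \<omega> * w (X \<omega>))) \<le> 2 ^ CARD('n) * K * L2_norm lborel w"
proof -
  let ?Q = "cbox lo hi"
  define d where "d xs A = foldr (\<lambda>i. wderiv1 e c i ^^ A i) xs" for xs and A :: "'n \<Rightarrow> nat"
  interpret NL: pair_sigma_finite N "lborel :: real measure"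
    by (intro pair_sigma_finite.intro N lborel.sigma_finite_measure_axioms)
  have d_append: "d (xs @ [i]) A g = d xs A ((wderiv1 e c i ^^ A i) g)" for xs i A g
    by (simp add: d_def)
  have d_cong: "d xs (A(i := m)) g = d xs A g" if "i \<notin> set xs" for xs i A m g
    unfolding d_def using that by (intro foldr_cong[THEN fun_cong] foldr_cong) auto
  \<comment> \<open>The induction removes the last index, whose derivative \<open>foldr\<close>
    applies innermost: passing from \<open>xs @ [i]\<close> to \<open>xs\<close> only replaces
    \<open>g\<close> by \<open>g\<close> itself or by \<open>wderiv1 e c i g\<close>. Thus partial
    derivatives are never interchanged.\<close>
  have claim: "norm (LINT \<omega>|N. g (P (mix xs y (X \<omega>)) \<omega>) * (k \<omega> * w (X \<omega>))) \<le> 2 ^ length xs * K * L2_norm lborel w"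
    if "distinct xs" "smooth g" "y \<in> ?Q" "bdd_supp_on ?Q w"
      and "\<And>A x \<omega>. (\<forall>i. A i \<le> 1) \<Longrightarrow> x \<in> ?Q \<Longrightarrow> k \<omega> \<noteq> 0 \<Longrightarrow> norm (d xs A g (P x \<omega>)) \<le> D"
      and "\<And>A x w. (\<forall>i. A i \<le> 1) \<Longrightarrow> x \<in> ?Q \<Longrightarrow> bdd_supp_on ?Q w \<Longrightarrow>
         norm (LINT \<omega>|N. d xs A g (P x \<omega>) * (k \<omega> * w (X \<omega>))) \<le> K * L2_norm lborel w"
    for xs g y w
    using that
  proof (induction xs arbitrary: g y w rule: rev_induct)
    case Nil
    have "mix [] y x = y" for x by (simp add: mix_def vec_eq_iff)
    then show ?case using Nil.prems(6)[of "\<lambda>_. 0" y w] Nil.prems(3,4) by (simp add: d_def)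
  next
    case (snoc i xs)
    have i: "i \<notin> set xs" and xs: "distinct xs" using snoc.prems(1) by auto
    note g = snoc.prems(2) and y = snoc.prems(3) and w = snoc.prems(4)
    let ?g' = "wderiv1 e c i g" and ?G = "dir_deriv (e i) g"
    let ?L = "2 ^ length xs * K * L2_norm lborel w"
    have L0: "?L \<ge> 0" using K by (simp add: L2_norm_nonneg)
    have wt: "wgt c i > 0" by (rule wgt_pos[OF c])
    have lohi: "lo $ i \<le> hi $ i" using box[of i] wt by simp
    have [measurable]: "w \<in> borel_measurable borel" using w by (simp add: bdd_supp_on_def bdd_supp_def)
    have gm[measurable]: "g \<in> borel_measurable borel" "?G \<in> borel_measurable borel"
      by (auto intro: smooth_borel_measurable smooth_dir_deriv g)
    have dA0: "d (xs @ [i]) (A(i := 0)) h = d xs A h" for A h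
      using d_cong[OF i, of A 0] by (simp add: d_append)
    have dA1: "d (xs @ [i]) (A(i := 1)) h = d xs A (wderiv1 e c i h)" for A h
      using d_cong[OF i, of A 1] by (simp add: d_append)
    have d0: "d xs (\<lambda>_. 0) h = h" for h by (simp add: d_def foldr_id)
    have IH0: "norm (LINT \<omega>|N. g (P (mix xs z (X \<omega>)) \<omega>) * (k \<omega> * w' (X \<omega>))) \<le> 2 ^ length xs * K * L2_norm lborel w'"
      if z: "z \<in> ?Q" and w': "bdd_supp_on ?Q w'" for z w'
    proof (rule snoc.IH[OF xs g z w'])
      fix A :: "'n \<Rightarrow> nat" and x \<omega> assume A: "\<forall>i. A i \<le> 1" and "x \<in> ?Q"
      then show "norm (d xs A g (P x \<omega>)) \<le> D" if "k \<omega> \<noteq> 0"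
        using snoc.prems(5)[of "A(i := 0)" x \<omega>, unfolded dA0] that by simp
      show "norm (LINT \<omega>|N. d xs A g (P x \<omega>) * (k \<omega> * w (X \<omega>))) \<le> K * L2_norm lborel w" if "bdd_supp_on ?Q w" for w
        using snoc.prems(6)[of "A(i := 0)" x w, unfolded dA0] A \<open>x \<in> ?Q\<close> that by simp
    qed
    have IH1: "norm (LINT \<omega>|N. ?g' (P (mix xs z (X \<omega>)) \<omega>) * (k \<omega> * w' (X \<omega>))) \<le> 2 ^ length xs * K * L2_norm lborel w'"
      if z: "z \<in> ?Q" and w': "bdd_supp_on ?Q w'" for z w'
    proof (rule snoc.IH[OF xs smooth_wderiv1[OF g] z w'])
      fix A :: "'n \<Rightarrow> nat" and x \<omega> assume A: "\<forall>i. A i \<le> 1" and "x \<in> ?Q"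
      then show "norm (d xs A ?g' (P x \<omega>)) \<le> D" if "k \<omega> \<noteq> 0"
        using snoc.prems(5)[of "A(i := 1)" x \<omega>, unfolded dA1] that by simp
      show "norm (LINT \<omega>|N. d xs A ?g' (P x \<omega>) * (k \<omega> * w (X \<omega>))) \<le> K * L2_norm lborel w" if "bdd_supp_on ?Q w" for w
        using snoc.prems(6)[of "A(i := 1)" x w, unfolded dA1] A \<open>x \<in> ?Q\<close> that by simp
    qed
    have gD: "norm (g (P x \<omega>)) \<le> D" if "x \<in> ?Q" "k \<omega> \<noteq> 0" for x \<omega>
      using snoc.prems(5)[of "(\<lambda>_. 0)(i := 0)" x \<omega>, unfolded dA0 d0] that by simp
    have GD: "norm (?G (P x \<omega>)) \<le> inverse (wgt c i) * D" if "x \<in> ?Q" "k \<omega> \<noteq> 0" for x \<omega>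
    proof -
      have "norm (?g' (P x \<omega>)) \<le> D"
        using snoc.prems(5)[of "(\<lambda>_. 0)(i := 1)" x \<omega>, unfolded dA1 d0] that by simp
      then show ?thesis
        using wt by (simp add: dir_deriv_eq_wderiv1[OF c] mult_left_mono)
    qed
    define T where T_def: "T = (\<lambda>\<omega> s. (indicator {lo $ i .. X \<omega> $ i} s *\<^sub>R ?G (P (mix xs (vupd y i s) (X \<omega>)) \<omega>)) * (k \<omega> * w (X \<omega>)))"
    have kwi: "integrable N (\<lambda>\<omega>. k \<omega> * w (X \<omega>))" by (rule int[OF w])
    have mP: "(\<lambda>z. P (mix xs (vupd y i (snd z)) (X (fst z))) (fst z)) \<in> N \<Otimes>\<^sub>M lborel \<rightarrow>\<^sub>M borel"
    proof -
      have "(\<lambda>z. (\<lambda>z. mix xs (vupd y i (snd z)) (fst z)) (X (fst z), snd z)) \<in> N \<Otimes>\<^sub>M lborel \<rightarrow>\<^sub>M borel"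
        by (rule borel_measurable_continuous_on[OF continuous_mix_vupd]) (simp add: borel_prod[symmetric])
      then have "(\<lambda>z. (mix xs (vupd y i (snd z)) (X (fst z)), fst z)) \<in> N \<Otimes>\<^sub>M lborel \<rightarrow>\<^sub>M borel \<Otimes>\<^sub>M N"
        by simp
      from measurable_compose[OF this P] show ?thesis by simp
    qed
    have mT: "case_prod T \<in> borel_measurable (N \<Otimes>\<^sub>M lborel)"
    proof -
      have [measurable]: "(\<lambda>z. ?G (P (mix xs (vupd y i (snd z)) (X (fst z))) (fst z))) \<in> borel_measurable (N \<Otimes>\<^sub>M lborel)"
        by (rule measurable_compose[OF mP gm(2)])
      have [measurable]: "(\<lambda>z. indicator {lo $ i .. X (fst z) $ i} (snd z) :: real) \<in> borel_measurable (N \<Otimes>\<^sub>M lborel)"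
      proof -
        have "indicator {lo $ i .. X (fst z) $ i} (snd z)
          = (indicator {0..} (snd z - lo $ i) * indicator {0..} (X (fst z) $ i - snd z) :: real)" for z
          by (simp add: indicator_def)
        then show ?thesis by simp
      qed
      show ?thesis unfolding T_def split_beta by measurable
    qed
    \<comment> \<open>The sup bound \<open>D\<close> serves integrability and Fubini only; the final
      estimate is in terms of \<open>K\<close>.\<close>
    have Tb: "norm (T \<omega> s) \<le> norm (k \<omega> * w (X \<omega>)) * (indicator {lo $ i .. hi $ i} s * (inverse (wgt c i) * D))" for \<omega> s
    proof (cases "k \<omega> * w (X \<omega>) = 0")
      case False
      then have x: "X \<omega> \<in> ?Q" and k: "k \<omega> \<noteq> 0" using w by (auto simp: bdd_supp_on_def)
      show ?thesis
      proof (cases "s \<in> {lo $ i .. X \<omega> $ i}")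
        case True
        moreover have "X \<omega> $ i \<le> hi $ i" using x by (simp add: mem_box_cart)
        ultimately have s: "lo $ i \<le> s" "s \<le> hi $ i" by auto
        have "norm (?G (P (mix xs (vupd y i s) (X \<omega>)) \<omega>)) \<le> inverse (wgt c i) * D"
          by (intro GD mix_in_cbox vupd_in_cbox s x y k)
        from mult_left_mono[OF this, of "norm (k \<omega> * w (X \<omega>))"] show ?thesis
          using True s by (simp add: T_def norm_mult mult_ac)
      next
        case False
        have "0 \<le> D" using gD[OF x k] norm_ge_zero order_trans by blast
        then show ?thesis using False wt by (simp add: T_def)
      qed
    qed (auto simp: T_def)
    have Ti: "integrable (N \<Otimes>\<^sub>M lborel) (case_prod T)"
    proof (rule Bochner_Integration.integrable_bound)
      show "integrable (N \<Otimes>\<^sub>M lborel) (\<lambda>z. norm (k (fst z) * w (X (fst z))) * (indicator {lo $ i .. hi $ i} (snd z) * (inverse (wgt c i) * D)))"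
        by (rule NL.integrable_mult_pair[OF integrable_norm[OF kwi]])
          (intro integrable_mult_left integrable_real_indicator, auto simp: lohi)
      show "AE z in N \<Otimes>\<^sub>M lborel. norm (case_prod T z) \<le> norm (norm (k (fst z) * w (X (fst z))) * (indicator {lo $ i .. hi $ i} (snd z) * (inverse (wgt c i) * D)))"
        using Tb by (intro AE_I2) (auto intro: order_trans[OF _ abs_ge_self] simp del: norm_mult)
    qed (rule mT)
    have ident: "g (P (mix (xs @ [i]) y (X \<omega>)) \<omega>) * (k \<omega> * w (X \<omega>))
        = g (P (mix xs (vupd y i (lo $ i)) (X \<omega>)) \<omega>) * (k \<omega> * w (X \<omega>)) + (LINT s|lborel. T \<omega> s)" for \<omega>
    proof (cases "k \<omega> * w (X \<omega>) = 0")
      case False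
      then have x: "X \<omega> \<in> ?Q" using w by (auto simp: bdd_supp_on_def)
      define x0 where "x0 = P (mix xs (vupd y i 0) (X \<omega>)) \<omega>"
      have sh: "P (mix xs (vupd y i s) (X \<omega>)) \<omega> = x0 + s *\<^sub>R e i" for s
        unfolding x0_def by (subst mix_vupd_shift[OF i]) (rule shift)
      have "(LINT s|lborel. indicator {lo $ i .. X \<omega> $ i} s *\<^sub>R ?G (x0 + s *\<^sub>R e i))
         = g (x0 + (X \<omega> $ i) *\<^sub>R e i) - g (x0 + (lo $ i) *\<^sub>R e i)"
      proof (rule integral_FTC_Icc)
        show "lo $ i \<le> X \<omega> $ i" using x by (auto simp: mem_box_cart)
        show "continuous_on {lo $ i .. X \<omega> $ i} (\<lambda>s. ?G (x0 + s *\<^sub>R e i))"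
          by (rule continuous_on_compose2[OF smooth_continuous[OF smooth_dir_deriv[OF g], of UNIV]])
            (auto intro!: continuous_intros)
      qed (rule smooth_has_vector_derivative[OF g])
      moreover have "(LINT s|lborel. T \<omega> s)
          = (LINT s|lborel. indicator {lo $ i .. X \<omega> $ i} s *\<^sub>R ?G (x0 + s *\<^sub>R e i)) * (k \<omega> * w (X \<omega>))"
        unfolding T_def sh by (rule Bochner_Integration.integral_mult_left_zero)
      ultimately show ?thesis
        by (simp only: sh mix_snoc) (simp add: algebra_simps)
    qed (auto simp: T_def)
    have y0: "vupd y i (lo $ i) \<in> ?Q" using y lohi by (intro vupd_in_cbox) auto
    have i0: "integrable N (\<lambda>\<omega>. g (P (mix xs (vupd y i (lo $ i)) (X \<omega>)) \<omega>) * (k \<omega> * w (X \<omega>)))"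
    proof (rule Bochner_Integration.integrable_bound)
      show "integrable N (\<lambda>\<omega>. D *\<^sub>R (k \<omega> * w (X \<omega>)))" using kwi by simp
      show "(\<lambda>\<omega>. g (P (mix xs (vupd y i (lo $ i)) (X \<omega>)) \<omega>) * (k \<omega> * w (X \<omega>))) \<in> borel_measurable N"
      proof -
        have "(\<lambda>\<omega>. (\<omega>, lo $ i)) \<in> N \<rightarrow>\<^sub>M N \<Otimes>\<^sub>M lborel" by simp
        from measurable_compose[OF measurable_compose[OF this mP] gm(1)]
        have [measurable]: "(\<lambda>\<omega>. g (P (mix xs (vupd y i (lo $ i)) (X \<omega>)) \<omega>)) \<in> borel_measurable N" by simp
        show ?thesis by measurable
      qed
      show "AE \<omega> in N. norm (g (P (mix xs (vupd y i (lo $ i)) (X \<omega>)) \<omega>) * (k \<omega> * w (X \<omega>))) \<le> norm (D *\<^sub>R (k \<omega> * w (X \<omega>)))"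
      proof (rule AE_I2)
        fix \<omega>
        show "norm (g (P (mix xs (vupd y i (lo $ i)) (X \<omega>)) \<omega>) * (k \<omega> * w (X \<omega>))) \<le> norm (D *\<^sub>R (k \<omega> * w (X \<omega>)))"
        proof (cases "k \<omega> * w (X \<omega>) = 0")
          case False
          then have x: "X \<omega> \<in> ?Q" and k: "k \<omega> \<noteq> 0" using w by (auto simp: bdd_supp_on_def)
          have "norm (g (P (mix xs (vupd y i (lo $ i)) (X \<omega>)) \<omega>)) \<le> \<bar>D\<bar>"
            by (rule order_trans[OF gD[OF mix_in_cbox[OF x y0] k] abs_ge_self])
          then show ?thesis unfolding norm_mult norm_scaleR by (intro mult_right_mono) auto
        qed auto
      qed
    qed
    have inner: "norm (LINT \<omega>|N. T \<omega> s) \<le> indicator {lo $ i .. hi $ i} s * (inverse (wgt c i) * ?L)" for s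
    proof (cases "s \<in> {lo $ i .. hi $ i}")
      case True
      let ?w = "\<lambda>x :: 'n point. indicator {lo $ i .. x $ i} s * w x"
      have [measurable]: "(\<lambda>x :: 'n point. indicator {lo $ i .. x $ i} s :: complex) \<in> borel_measurable borel"
        unfolding indicator_def atLeastAtMost_iff by measurable
      have w': "bdd_supp_on ?Q ?w" by (rule bdd_supp_on_mult[OF w, where C=1]) (auto simp: indicator_def)
      have "(LINT \<omega>|N. T \<omega> s) = (LINT \<omega>|N. inverse (wgt c i) *\<^sub>R (?g' (P (mix xs (vupd y i s) (X \<omega>)) \<omega>) * (k \<omega> * ?w (X \<omega>))))"
        by (intro Bochner_Integration.integral_cong refl)
          (auto simp: T_def dir_deriv_eq_wderiv1[OF c] indicator_def)
      then have "norm (LINT \<omega>|N. T \<omega> s) = inverse (wgt c i) * norm (LINT \<omega>|N. ?g' (P (mix xs (vupd y i s) (X \<omega>)) \<omega>) * (k \<omega> * ?w (X \<omega>)))"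
        using wt by simp
      also have "\<dots> \<le> inverse (wgt c i) * (2 ^ length xs * K * L2_norm lborel ?w)"
        using wt True by (intro mult_left_mono IH1 w' vupd_in_cbox y) auto
      also have "\<dots> \<le> inverse (wgt c i) * ?L"
        using wt K w by (intro mult_left_mono bdd_supp_L2_mono) (auto simp: bdd_supp_on_def indicator_def)
      finally show ?thesis using True by simp
    next
      case False
      have "T \<omega> s = 0" for \<omega>
        using False w by (auto simp: T_def bdd_supp_on_def indicator_def mem_box_cart) (meson order_trans)
      then show ?thesis using False by simp
    qed
    have "(LINT \<omega>|N. g (P (mix (xs @ [i]) y (X \<omega>)) \<omega>) * (k \<omega> * w (X \<omega>)))
       = (LINT \<omega>|N. g (P (mix xs (vupd y i (lo $ i)) (X \<omega>)) \<omega>) * (k \<omega> * w (X \<omega>))) + (LINT \<omega>|N. LINT s|lborel. T \<omega> s)"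
      unfolding ident by (rule Bochner_Integration.integral_add[OF i0 NL.integrable_fst[OF Ti]])
    also have "(LINT \<omega>|N. LINT s|lborel. T \<omega> s) = (LINT s|lborel. LINT \<omega>|N. T \<omega> s)"
      using NL.integral_fst[OF Ti] NL.integral_snd[OF Ti] by simp
    finally have "norm (LINT \<omega>|N. g (P (mix (xs @ [i]) y (X \<omega>)) \<omega>) * (k \<omega> * w (X \<omega>)))
      \<le> ?L + norm (LINT s|lborel. LINT \<omega>|N. T \<omega> s)"
      using IH0[OF y0 w] by (auto intro: order_trans[OF norm_triangle_ineq])
    also have "norm (LINT s|lborel. LINT \<omega>|N. T \<omega> s) \<le> (LINT s|lborel. indicator {lo $ i .. hi $ i} s * (inverse (wgt c i) * ?L))"
      by (rule norm_integral_le[OF _ inner]) (intro integrable_mult_left integrable_real_indicator, auto simp: lohi)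
    also have "\<dots> = ?L"
      using box[of i] wt by simp
    finally show ?case by (simp add: mult_ac)
  qed
  let ?xs = "sorted_list_of_set (UNIV :: 'n set)"
  have d_eq: "d ?xs A = wderiv e c A" for A by (simp add: d_def wderiv_def)
  have "mix ?xs y x = x" for x y by (simp add: mix_def vec_eq_iff)
  moreover have "lo \<in> ?Q" using box less_imp_le[OF wgt_pos[OF c]] by (auto simp: mem_box_cart)
  ultimately show ?thesis
    using claim[of ?xs f lo w] f w bound form by (simp add: d_eq)
qed

subsection \<open>The bilinear form of an amplitude\<close>

definition osc :: "'n::finite point \<times> 'n point \<times> 'n point \<Rightarrow> complex" where
  "osc \<omega> = cis (fst (snd \<omega>) \<bullet> (fst \<omega> - snd (snd \<omega>)))"

text \<open>Bilinear rather than sesquilinear: a conjugate, where one is wanted, is put into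
  \<open>w\<close>. The convergence factor in p is part of \<open>b\<close>.\<close>

definition osc_form :: "'n::finite amplitude \<Rightarrow> ('n point \<Rightarrow> complex) \<Rightarrow> ('n point \<Rightarrow> complex) \<Rightarrow> complex" where
  "osc_form b w v = (LINT \<omega>|lborel. b \<omega> * (osc \<omega> * (w (fst \<omega>) * v (snd (snd \<omega>)))))"

lemma osc_measurable [measurable]: "osc \<in> borel_measurable borel"
  unfolding osc_def[abs_def] by measurable

lemma norm_osc [simp]: "norm (osc \<omega>) = 1"
  by (simp add: osc_def)

lemma integrable_osc_form:
  fixes b :: "'n::finite amplitude"
  assumes b: "b \<in> borel_measurable borel" and \<Psi>: "integrable lborel (\<Psi> :: 'n point \<Rightarrow> real)"
    and w: "integrable lborel w" and v: "integrable lborel v"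
    and bound: "\<And>q p q'. w q \<noteq> 0 \<Longrightarrow> v q' \<noteq> 0 \<Longrightarrow> norm (b (q, p, q')) \<le> D * \<bar>\<Psi> p\<bar>"
  shows "integrable lborel (\<lambda>\<omega>. b \<omega> * (osc \<omega> * (w (fst \<omega>) * v (snd (snd \<omega>)))))"
proof (rule Bochner_Integration.integrable_bound)
  note [measurable] = b borel_measurable_integrable[OF w, simplified] borel_measurable_integrable[OF v, simplified]
  show "integrable lborel (\<lambda>\<omega>. norm (w (fst \<omega>)) * (\<lambda>y. (D * \<Psi> (fst y)) * norm (v (snd y))) (snd \<omega>))"
    by (intro integrable_lborel_mult integrable_norm w v integrable_mult_right \<Psi>)
  show "(\<lambda>\<omega>. b \<omega> * (osc \<omega> * (w (fst \<omega>) * v (snd (snd \<omega>))))) \<in> borel_measurable lborel"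
    by measurable
  show "AE \<omega> in lborel. norm (b \<omega> * (osc \<omega> * (w (fst \<omega>) * v (snd (snd \<omega>)))))
      \<le> norm (norm (w (fst \<omega>)) * (D * \<Psi> (fst (snd \<omega>)) * norm (v (snd (snd \<omega>)))))"
  proof (rule AE_I2)
    fix \<omega> :: "'n point \<times> 'n point \<times> 'n point"
    obtain q p q' where \<omega>: "\<omega> = (q, p, q')" by (cases \<omega>)
    show "norm (b \<omega> * (osc \<omega> * (w (fst \<omega>) * v (snd (snd \<omega>)))))
      \<le> norm (norm (w (fst \<omega>)) * (D * \<Psi> (fst (snd \<omega>)) * norm (v (snd (snd \<omega>)))))"
    proof (cases "w q = 0 \<or> v q' = 0")
      case False
      then have "norm (b (q, p, q')) \<le> \<bar>D * \<Psi> p\<bar>"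
        using bound[of q q' p] abs_ge_self[of "D * \<bar>\<Psi> p\<bar>"] by (simp add: abs_mult)
      then have "norm (b (q, p, q')) * (norm (w q) * norm (v q')) \<le> \<bar>D * \<Psi> p\<bar> * (norm (w q) * norm (v q'))"
        by (rule mult_right_mono) simp
      then show ?thesis by (simp add: \<omega> norm_mult abs_mult mult_ac)
    qed (auto simp: \<omega>)
  qed
qed

text \<open>Integrating over q and q' first leaves the integral of \<open>m p * W p * V p\<close>
  with the Fourier transforms of \<open>w\<close> and \<open>v\<close>. Cauchy-Schwarz and
  Plancherel's inequality finish, the two square roots giving \<open>(2 * pi) ^ CARD('n)\<close>.
  Integrability of \<open>m\<close> only makes the triple integral absolutely convergent; the bound
  sees its supremum.\<close>

lemma osc_form_multiplier:
  fixes m :: "'n::finite point \<Rightarrow> complex"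
  assumes w: "bdd_supp w" and v: "bdd_supp v" and m: "integrable lborel m" and bound: "\<And>p. norm (m p) \<le> D"
  shows "norm (osc_form (\<lambda>\<omega>. m (fst (snd \<omega>))) w v) \<le> D * (2 * pi) ^ CARD('n) * (L2_norm lborel w * L2_norm lborel v)"
proof -
  note [measurable] = bdd_supp_measurable[OF w] bdd_supp_measurable[OF v] borel_measurable_integrable[OF m, simplified]
  define W where "W p = (LINT q|lborel. cis (1 * (p \<bullet> q)) * w q)" for p
  define V where "V p = (LINT q|lborel. cis (- 1 * (p \<bullet> q)) * v q)" for p
  note Wf = fourier_measurable[OF w, of 1, folded W_def] integrable_fourier[OF w, of 1, folded W_def] L2_fourier[OF w, of 1, folded W_def]
  note Vf = fourier_measurable[OF v, of "-1", folded V_def] integrable_fourier[OF v, of "-1", folded V_def] L2_fourier[OF v, of "-1", folded V_def]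
  note [measurable] = Wf(1)[simplified] Vf(1)[simplified]
  have D: "D \<ge> 0" using bound[of 0] norm_ge_zero order_trans by blast
  let ?F = "\<lambda>\<omega>. m (fst (snd \<omega>)) * (osc \<omega> * (w (fst \<omega>) * v (snd (snd \<omega>))))"
  have F: "integrable lborel ?F"
  proof (rule integrable_osc_form[OF _ integrable_norm[OF m] bdd_supp_integrable[OF w] bdd_supp_integrable[OF v]])
    show "(\<lambda>\<omega> :: 'n point \<times> 'n point \<times> 'n point. m (fst (snd \<omega>))) \<in> borel_measurable borel" by measurable
    show "norm (m (fst (snd (q, p, q')))) \<le> 1 * \<bar>norm (m p)\<bar>" for q p q' :: "'n point" by simp
  qed
  have inner: "(LINT q|lborel. ?F (q, z)) = (m (fst z) * W (fst z)) * (cis (- 1 * (fst z \<bullet> snd z)) * v (snd z))" for z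
  proof -
    have "(LINT q|lborel. ?F (q, z)) = (LINT q|lborel. (m (fst z) * (cis (- 1 * (fst z \<bullet> snd z)) * v (snd z))) * (cis (1 * (fst z \<bullet> q)) * w q))"
      by (intro Bochner_Integration.integral_cong refl)
        (simp add: osc_def inner_diff_right cis_divide[symmetric] divide_inverse cis_inverse)
    then show ?thesis unfolding Bochner_Integration.integral_mult_right_zero W_def by (simp only: mult_ac)
  qed
  have "osc_form (\<lambda>\<omega>. m (fst (snd \<omega>))) w v = (LINT z|lborel. (m (fst z) * W (fst z)) * (cis (- 1 * (fst z \<bullet> snd z)) * v (snd z)))"
    unfolding osc_form_def lborel_fubini(2)[OF F] inner ..
  also have "\<dots> = (LINT p|lborel. (m p * W p) * V p)"
    by (subst lborel_fubini(1)[OF lborel_fubini(3)[OF F, unfolded inner]])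
      (simp only: fst_conv snd_conv Bochner_Integration.integral_mult_right_zero V_def)
  finally have "norm (osc_form (\<lambda>\<omega>. m (fst (snd \<omega>))) w v) = norm (LINT p|lborel. m p * (W p * V p))"
    by (simp add: mult.assoc)
  also have "\<dots> \<le> (LINT p|lborel. D * norm (W p * V p))"
  proof (rule norm_integral_le)
    show "integrable lborel (\<lambda>p. D * norm (W p * V p))"
      by (intro integrable_mult_right integrable_norm integrable_mult_L2) (use Wf Vf in simp_all)
    show "norm (m p * (W p * V p)) \<le> D * norm (W p * V p)" for p
      unfolding norm_mult[of "m p"] using bound by (intro mult_right_mono) auto
  qed
  also have "\<dots> \<le> D * (L2_norm lborel W * L2_norm lborel V)"
    unfolding Bochner_Integration.integral_mult_right_zero
    by (intro mult_left_mono integral_mult_L2 D) (use Wf Vf in simp_all)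
  also have "\<dots> \<le> D * ((sqrt ((2 * pi) ^ CARD('n)) * L2_norm lborel w) * (sqrt ((2 * pi) ^ CARD('n)) * L2_norm lborel v))"
    by (intro mult_left_mono mult_mono D) (use Wf Vf in \<open>auto intro!: mult_nonneg_nonneg simp: L2_norm_nonneg\<close>)
  finally show ?thesis by (simp add: mult_ac)
qed

text \<open>The third variable of the amplitude is fixed while that of the oscillation and of
  \<open>v\<close> still runs. The convergence factor is kept as a family of one-variable functions
  so that an integration by parts can replace just one of them.\<close>

definition frozen :: "'n::finite point \<Rightarrow> 'n amplitude \<Rightarrow> ('n \<Rightarrow> real \<Rightarrow> real) \<Rightarrow> 'n amplitude" where
  "frozen x' f \<gamma> = (\<lambda>\<omega>. f (fst \<omega>, fst (snd \<omega>), x') * of_real (tensor \<gamma> (fst (snd \<omega>))))"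

lemma tensor_reg_integrable: "(\<And>i. reg (\<gamma> i)) \<Longrightarrow> integrable lborel (tensor \<gamma>)"
  by (rule integrable_tensor) (simp add: reg_def)

lemma tensor_reg_measurable: "(\<And>i. reg (\<gamma> i)) \<Longrightarrow> tensor \<gamma> \<in> borel_measurable borel"
  by (intro tensor_measurable reg_measurable)

lemma borel_measurable_frozen:
  assumes f: "continuous_on UNIV f" and \<gamma>: "\<And>i. reg (\<gamma> i)"
  shows "frozen x' f \<gamma> \<in> borel_measurable borel"
proof -
  note [measurable] = tensor_reg_measurable[of \<gamma>, OF \<gamma>]
  have [measurable]: "(\<lambda>\<omega>. f (fst \<omega>, fst (snd \<omega>), x')) \<in> borel_measurable borel"
    by (intro borel_measurable_continuous_onI continuous_on_compose2[OF f]) (auto intro!: continuous_intros)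
  show ?thesis unfolding frozen_def by measurable
qed

lemma integrable_frozen:
  assumes f: "continuous_on UNIV f" and \<gamma>: "\<And>i. reg (\<gamma> i)"
    and w: "bdd_supp_on B w" and v: "bdd_supp v"
    and bound: "\<And>q p. q \<in> B \<Longrightarrow> norm (f (q, p, x')) \<le> D"
  shows "integrable lborel (\<lambda>\<omega>. frozen x' f \<gamma> \<omega> * (osc \<omega> * (w (fst \<omega>) * v (snd (snd \<omega>)))))"
proof (rule integrable_osc_form[OF borel_measurable_frozen[of f \<gamma>, OF f \<gamma>] tensor_reg_integrable[of \<gamma>, OF \<gamma>]])
  show "integrable lborel w" "integrable lborel v" using w v by (auto simp: bdd_supp_on_def intro: bdd_supp_integrable)
  show "norm (frozen x' f \<gamma> (q, p, q')) \<le> D * \<bar>tensor \<gamma> p\<bar>" if "w q \<noteq> 0" for q p q'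
    using bound[of q p] w that by (auto simp: frozen_def bdd_supp_on_def norm_mult intro!: mult_right_mono)
qed

lemma measurable_borel_pair_lborel:
  "measurable ((borel :: 'a::euclidean_space measure) \<Otimes>\<^sub>M (lborel :: 'b::euclidean_space measure)) N = measurable borel N"
proof (rule measurable_cong_sets[OF _ refl])
  have "sets ((borel :: 'a measure) \<Otimes>\<^sub>M (lborel :: 'b measure)) = sets (borel \<Otimes>\<^sub>M borel)"
    by (intro sets_pair_measure_cong) simp_all
  also have "\<dots> = sets borel"
    by (subst borel_prod) (rule refl)
  finally show "sets ((borel :: 'a measure) \<Otimes>\<^sub>M (lborel :: 'b measure)) = sets borel" .
qed

text \<open>Once q is frozen as well, the amplitude is a multiplier in p bounded by
  \<open>D\<close>, and \<open>osc_form_multiplier\<close> supplies the hypothesis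
  \<open>form\<close> of \<open>freeze_block\<close>.\<close>

lemma osc_form_freeze_q:
  fixes f :: "'n::{finite,linorder} amplitude"
  assumes f: "smooth f" and c: "c > 0" and box: "\<And>i. hi $ i = lo $ i + wgt (inverse c) i"
    and \<gamma>: "\<And>i. reg (\<gamma> i)"
    and bound: "\<And>A q p. (\<forall>i. A i \<le> 1) \<Longrightarrow> q \<in> cbox lo hi \<Longrightarrow> norm (deriv_q c A f (q, p, x')) \<le> D"
    and w: "bdd_supp_on (cbox lo hi) w" and v: "bdd_supp v"
  shows "norm (osc_form (frozen x' f \<gamma>) w v) \<le> 2 ^ CARD('n) * (D * (2 * pi) ^ CARD('n)) * (L2_norm lborel w * L2_norm lborel v)"
proof -
  let ?k = "\<lambda>\<omega> :: 'n point \<times> 'n point \<times> 'n point. of_real (tensor \<gamma> (fst (snd \<omega>))) * osc \<omega> * v (snd (snd \<omega>))"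
  let ?P = "\<lambda>(x :: 'n point) \<omega> :: 'n point \<times> 'n point \<times> 'n point. (x, fst (snd \<omega>), x')"
  note [measurable] = tensor_reg_measurable[of \<gamma>, OF \<gamma>] bdd_supp_measurable[OF v]
  have lo: "lo \<in> cbox lo hi" using box less_imp_le[OF wgt_pos[of "inverse c"]] c by (auto simp: mem_box_cart)
  have D: "D \<ge> 0" by (rule order_trans[OF norm_ge_zero bound[OF _ lo, of "\<lambda>_. 0" 0]]) simp
  let ?K = "D * (2 * pi) ^ CARD('n) * L2_norm lborel v"
  have "norm (LINT \<omega>|lborel. f (?P (fst \<omega>) \<omega>) * (?k \<omega> * w (fst \<omega>))) \<le> 2 ^ CARD('n) * ?K * L2_norm lborel w"
  proof (rule freeze_block[where c="inverse c" and e="\<lambda>i. (axis i 1, 0, 0)" and lo=lo and hi=hi and D=D and X=fst and P="?P" and k="?k"])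
    show "sigma_finite_measure (lborel :: ('n point \<times> 'n point \<times> 'n point) measure)" by (rule sigma_finite_lborel)
    show "fst \<in> (lborel :: ('n point \<times> 'n point \<times> 'n point) measure) \<rightarrow>\<^sub>M borel" by measurable
    show "?k \<in> borel_measurable lborel" by measurable
    have "(\<lambda>z :: 'n point \<times> 'n point \<times> 'n point \<times> 'n point. (fst z, fst (snd (snd z)), x')) \<in> borel_measurable borel"
      by (intro borel_measurable_continuous_onI continuous_intros)
    then show "(\<lambda>z. ?P (fst z) (snd z)) \<in> borel \<Otimes>\<^sub>M lborel \<rightarrow>\<^sub>M borel"
      by - (subst measurable_borel_pair_lborel)
    show "integrable lborel (\<lambda>\<omega>. ?k \<omega> * w (fst \<omega>))" if "bdd_supp_on (cbox lo hi) w" for w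
    proof -
      have "integrable lborel (\<lambda>\<omega>. frozen x' (\<lambda>_. 1) \<gamma> \<omega> * (osc \<omega> * (w (fst \<omega>) * v (snd (snd \<omega>)))))"
        by (rule integrable_frozen[OF _ \<gamma> that v, of _ _ 1]) auto
      then show ?thesis by (simp add: frozen_def mult_ac)
    qed
    show "norm (wderiv (\<lambda>i. (axis i 1, 0, 0)) (inverse c) A f (?P x \<omega>)) \<le> D"
      if "\<forall>i. A i \<le> 1" "x \<in> cbox lo hi" for A x \<omega>
      using bound[OF that] by (simp add: deriv_q_def)
    show "norm (LINT \<omega>|lborel. wderiv (\<lambda>i. (axis i 1, 0, 0)) (inverse c) A f (?P x \<omega>) * (?k \<omega> * w (fst \<omega>))) \<le> ?K * L2_norm lborel w"
      if A: "\<forall>i. A i \<le> 1" and x: "x \<in> cbox lo hi" and w: "bdd_supp_on (cbox lo hi) w" for A x w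
    proof -
      let ?h = "\<lambda>p. deriv_q c A f (x, p, x')"
      have hc: "continuous_on UNIV ?h"
        unfolding deriv_q_def
        by (rule continuous_on_compose2[OF smooth_continuous[OF smooth_wderiv[OF f], of UNIV]])
          (intro continuous_intros, simp)
      have hb: "norm (?h p * of_real (tensor \<gamma> p)) \<le> D" for p
        using mult_mono[OF bound[OF A x, of p] abs_tensor_le_1[of \<gamma> p, OF \<gamma>] D] by (simp add: norm_mult)
      have [measurable]: "?h \<in> borel_measurable borel" using hc by (rule borel_measurable_continuous_onI)
      have hi: "integrable lborel (\<lambda>p. ?h p * of_real (tensor \<gamma> p))"
      proof (rule Bochner_Integration.integrable_bound)
        show "integrable lborel (\<lambda>p. D * tensor \<gamma> p)" by (intro integrable_mult_right tensor_reg_integrable \<gamma>)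
        show "AE p in lborel. norm (?h p * of_real (tensor \<gamma> p)) \<le> norm (D * tensor \<gamma> p)"
          using bound[OF A x] D by (auto simp: norm_mult abs_mult intro!: mult_right_mono)
      qed measurable
      have "bdd_supp w" using w by (simp add: bdd_supp_on_def)
      from osc_form_multiplier[OF this v hi hb] show ?thesis
        by (simp add: osc_form_def deriv_q_def mult_ac)
    qed
  qed (use c f w D box in \<open>auto simp: L2_norm_nonneg\<close>)
  then show ?thesis by (simp add: osc_form_def frozen_def mult_ac)
qed

subsection \<open>Integration by parts\<close>

lemma
  fixes f :: "'a::euclidean_space \<Rightarrow> 'b::{banach, second_countable_topology}"
  assumes f: "integrable lborel f"
  shows integrable_lborel_translate: "integrable lborel (\<lambda>x. f (x + c))"
    and integral_lborel_translate: "(LINT x|lborel. f (x + c)) = (LINT x|lborel. f x)"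
proof -
  have [measurable]: "f \<in> borel_measurable borel" using f by (auto dest: borel_measurable_integrable)
  have "integrable (distr lborel borel ((+) c)) f" using f by (simp add: lborel_distr_plus)
  then show "integrable lborel (\<lambda>x. f (x + c))"
    by (subst (asm) integrable_distr_eq) (auto simp: add.commute)
  have "(LINT x|lborel. f x) = (LINT x|distr lborel borel ((+) c). f x)" by (simp add: lborel_distr_plus)
  also have "\<dots> = (LINT x|lborel. f (x + c))"
    by (subst integral_distr) (auto simp: add.commute)
  finally show "(LINT x|lborel. f (x + c)) = (LINT x|lborel. f x)" by simp
qed

text \<open>Average over the translates by \<open>s *\<^sub>R d\<close>, s in [0, 1]: integrating in
  s first gives H(x + d) - H(x), whose integral vanishes by translation invariance, while
  integrating in x first gives the integral of \<open>H'\<close>. Integrability thus replaces decay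
  at infinity.\<close>

lemma integral_directional_derivative_eq_0:
  fixes H H' :: "'a::euclidean_space \<Rightarrow> complex"
  assumes deriv: "\<And>x s. ((\<lambda>s. H (x + s *\<^sub>R d)) has_vector_derivative H' (x + s *\<^sub>R d)) (at s)"
    and cont: "\<And>x. continuous_on UNIV (\<lambda>s. H' (x + s *\<^sub>R d))"
    and H: "integrable lborel H" and H': "integrable lborel H'"
  shows "(LINT x|lborel. H' x) = 0"
proof -
  have [measurable]: "H' \<in> borel_measurable borel" using H' by (auto dest: borel_measurable_integrable)
  define F where "F s x = indicator {0..1::real} s *\<^sub>R H' (x + s *\<^sub>R d)" for s x
  have F: "integrable (lborel \<Otimes>\<^sub>M lborel) (case_prod F)"
  proof (rule lborel_pair.Fubini_integrable)
    have [measurable]: "(\<lambda>z. snd z + fst z *\<^sub>R d) \<in> borel_measurable (borel :: (real \<times> 'a) measure)"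
      by (intro borel_measurable_continuous_onI continuous_intros)
    have "(\<lambda>z :: real \<times> 'a. indicator {0..1::real} (fst z) *\<^sub>R H' (snd z + fst z *\<^sub>R d)) \<in> borel_measurable borel"
      by measurable
    then show "case_prod F \<in> borel_measurable (lborel \<Otimes>\<^sub>M lborel)"
      by (simp add: F_def[abs_def] split_beta lborel_prod)
    have "(LINT y|lborel. norm (F s y)) = indicator {0..1} s * (LINT x|lborel. norm (H' x))" for s
      using integral_lborel_translate[OF integrable_norm[OF H'], of "s *\<^sub>R d"] by (simp add: F_def)
    then show "integrable lborel (\<lambda>x. LINT y|lborel. norm (case_prod F (x, y)))"
      by simp
    show "AE x in lborel. integrable lborel (\<lambda>y. case_prod F (x, y))"
      unfolding F_def by (auto intro!: integrable_scaleR_right integrable_lborel_translate H')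
  qed
  have "(LINT s|lborel. F s x) = H (x + d) - H x" for x
    using integral_FTC_Icc[of 0 1 "\<lambda>s. H (x + s *\<^sub>R d)" "\<lambda>s. H' (x + s *\<^sub>R d)"]
    by (simp add: F_def deriv has_vector_derivative_at_within continuous_on_subset[OF cont])
  then have "(LINT x|lborel. LINT s|lborel. F s x) = 0"
    by (simp add: H integrable_lborel_translate integral_lborel_translate)
  moreover have "(LINT x|lborel. F s x) = indicator {0..1} s *\<^sub>R (LINT x|lborel. H' x)" for s
    by (simp add: F_def integral_lborel_translate[OF H'])
  then have "(LINT s|lborel. LINT x|lborel. F s x) = (LINT x|lborel. H' x)"
    by simp
  ultimately show ?thesis
    using lborel_pair.integral_fst[OF F] lborel_pair.integral_snd[OF F] by simp
qed

lemma
  assumes l: "l > 0"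
  shows integrable_exponential_density: "integrable lborel (exponential_density l)"
    and integral_exponential_density: "integral\<^sup>L lborel (exponential_density l) = 1"
proof -
  have "emeasure (density lborel (exponential_density l)) UNIV = 1"
    using prob_space.emeasure_space_1[OF prob_space_exponential_density[OF l]] by simp
  then have *: "(\<integral>\<^sup>+x. ennreal (exponential_density l x) \<partial>lborel) = ennreal 1"
    by (subst (asm) emeasure_density) auto
  have nn: "AE x in lborel. 0 \<le> exponential_density l x" using l by (simp add: exponential_density_def)
  show "integrable lborel (exponential_density l)"
    by (rule integrableI_nn_integral_finite[OF _ nn *]) simp
  show "integral\<^sup>L lborel (exponential_density l) = 1"
    by (subst integral_eq_nn_integral) (use nn * in auto)
qed

lemma tensor_upd: "tensor (\<gamma>(i := \<gamma>')) p = \<gamma>' (p $ i) * (\<Prod>j\<in>UNIV - {i}. \<gamma> j (p $ j))"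
proof -
  have "(\<Prod>j\<in>UNIV. (\<gamma>(i := \<gamma>')) j (p $ j)) = \<gamma>' (p $ i) * (\<Prod>j\<in>UNIV - {i}. (\<gamma>(i := \<gamma>')) j (p $ j))"
    by (subst prod.remove[of _ i]) auto
  also have "(\<Prod>j\<in>UNIV - {i}. (\<gamma>(i := \<gamma>')) j (p $ j)) = (\<Prod>j\<in>UNIV - {i}. \<gamma> j (p $ j))"
    by (intro prod.cong) auto
  finally show ?thesis by (simp add: tensor_def)
qed

lemma continuous_tensor:
  assumes "\<And>i. reg (\<gamma> i)"
  shows "continuous_on UNIV (tensor \<gamma>)"
  unfolding tensor_def[abs_def]
proof (rule continuous_on_prod)
  fix i
  have "continuous_on UNIV (\<gamma> i)" using assms by (simp add: reg_def)
  then show "continuous_on UNIV (\<lambda>p. \<gamma> i (p $ i))"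
    by (rule continuous_on_compose2) (auto intro: continuous_intros)
qed

lemma has_vector_derivative_tensor:
  assumes "\<And>t. (\<gamma> i has_real_derivative \<gamma>' t) (at t)"
  shows "((\<lambda>s. complex_of_real (tensor \<gamma> (p + s *\<^sub>R axis i 1))) has_vector_derivative
    of_real (tensor (\<gamma>(i := \<gamma>')) (p + s *\<^sub>R axis i 1))) (at s)"
proof -
  let ?R = "\<Prod>j\<in>UNIV - {i}. \<gamma> j (p $ j)"
  have R: "(\<Prod>j\<in>UNIV - {i}. \<gamma> j ((p + s *\<^sub>R axis i 1) $ j)) = ?R" for s
    by (intro prod.cong) (auto simp: axis_def)
  have "tensor \<gamma> (p + s *\<^sub>R axis i 1) = \<gamma> i (p $ i + s) * ?R" for s
    using tensor_upd[of \<gamma> i "\<gamma> i" "p + s *\<^sub>R axis i 1", unfolded R] by simp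
  moreover have "tensor (\<gamma>(i := \<gamma>')) (p + s *\<^sub>R axis i 1) = \<gamma>' (p $ i + s) * ?R" for s
    using tensor_upd[of \<gamma> i \<gamma>' "p + s *\<^sub>R axis i 1", unfolded R] by simp
  moreover have "((\<lambda>s. \<gamma> i (p $ i + s) * ?R) has_real_derivative \<gamma>' (p $ i + s) * ?R) (at s)"
    by (auto intro!: derivative_eq_intros DERIV_chain2[OF assms])
  ultimately show ?thesis
    by (simp only: has_real_derivative_iff_has_vector_derivative has_vector_derivative_of_real)
qed

lemma has_vector_derivative_osc:
  "((\<lambda>s. osc (q, p + s *\<^sub>R axis i 1, q')) has_vector_derivative
     \<i> * of_real (q $ i - q' $ i) * osc (q, p + s *\<^sub>R axis i 1, q')) (at s)"
proof -
  let ?a = "p \<bullet> (q - q')" and ?b = "q $ i - q' $ i"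
  have e: "osc (q, p + s *\<^sub>R axis i 1, q') = exp (\<i> * (of_real ?a + of_real ?b * of_real s))" for s
    by (simp add: osc_def cis_conv_exp inner_add_left inner_axis' algebra_simps)
  have "((\<lambda>z. exp (\<i> * (of_real ?a + of_real ?b * z))) has_field_derivative
      \<i> * of_real ?b * exp (\<i> * (of_real ?a + of_real ?b * of_real s))) (at (of_real s))"
    by (auto intro!: derivative_eq_intros)
  from has_vector_derivative_real_field[OF this] show ?thesis
    unfolding e by simp
qed

lemma i_mult_eq_minus:
  assumes "\<i> * x = - y"
  shows "x = \<i> * y"
proof -
  have "x = - (\<i> * (\<i> * x))" by (simp add: mult.assoc[symmetric])
  then show ?thesis unfolding assms by simp
qed

text \<open>The derivative of the integrand in the i-th coordinate of p has integral 0 and three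
  terms: it falls on the amplitude, on the convergence factor, or on the oscillation, which brings
  down \<i> times q_i - q'_i. The derivative of the convergence factor is written as
  \<open>inverse u * \<gamma>1 t\<close> so that \<open>\<gamma>1\<close> is again bounded by
  1.\<close>

lemma osc_form_by_parts:
  fixes f :: "'n::{finite,linorder} amplitude"
  assumes f: "smooth f" and \<gamma>: "\<And>i. reg (\<gamma> i)" and \<gamma>1: "reg \<gamma>1" and u: "u > 0"
    and deriv: "\<And>t. (\<gamma> i has_real_derivative inverse u * \<gamma>1 t) (at t)"
    and bound: "\<And>q p. q \<in> B \<Longrightarrow> norm (f (q, p, x')) \<le> D"
      "\<And>q p. q \<in> B \<Longrightarrow> norm (dir_deriv (0, axis i 1, 0) f (q, p, x')) \<le> D'"
    and w: "bdd_supp_on B w" and v: "bdd_supp v"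
  shows "integrable lborel (\<lambda>\<omega>. of_real (fst \<omega> $ i - snd (snd \<omega>) $ i) * (frozen x' f \<gamma> \<omega> * (osc \<omega> * (w (fst \<omega>) * v (snd (snd \<omega>))))))"
      (is "integrable lborel ?X")
    and "(LINT \<omega>|lborel. of_real (fst \<omega> $ i - snd (snd \<omega>) $ i) * (frozen x' f \<gamma> \<omega> * (osc \<omega> * (w (fst \<omega>) * v (snd (snd \<omega>))))))
      = \<i> * (osc_form (frozen x' (dir_deriv (0, axis i 1, 0) f) \<gamma>) w v + of_real (inverse u) * osc_form (frozen x' f (\<gamma>(i := \<gamma>1))) w v)"
proof -
  let ?d = "(0, axis i 1, 0) :: 'n point \<times> 'n point \<times> 'n point"
  let ?f' = "dir_deriv ?d f"
  let ?\<gamma>1 = "\<gamma>(i := \<gamma>1)"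
  have \<gamma>1': "reg (?\<gamma>1 j)" for j using \<gamma> \<gamma>1 by simp
  have fc: "continuous_on UNIV f" "continuous_on UNIV ?f'"
    by (auto intro: smooth_continuous smooth_dir_deriv f)
  have f'v: "smooth ?f'" by (rule smooth_dir_deriv[OF f])
  define R where "R \<omega> = osc \<omega> * (w (fst \<omega>) * v (snd (snd \<omega>)))" for \<omega> :: "'n point \<times> 'n point \<times> 'n point"
  have i0: "integrable lborel (\<lambda>\<omega>. frozen x' f \<gamma> \<omega> * R \<omega>)"
    unfolding R_def by (rule integrable_frozen[of f \<gamma>, OF fc(1) \<gamma> w v bound(1)])
  have i1: "integrable lborel (\<lambda>\<omega>. frozen x' ?f' \<gamma> \<omega> * R \<omega>)"
    unfolding R_def by (rule integrable_frozen[of ?f' \<gamma>, OF fc(2) \<gamma> w v bound(2)])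
  have i2: "integrable lborel (\<lambda>\<omega>. frozen x' f ?\<gamma>1 \<omega> * R \<omega>)"
    unfolding R_def by (rule integrable_frozen[of f ?\<gamma>1, OF fc(1) \<gamma>1' w v bound(1)])
  obtain C where C: "\<And>x. w x \<noteq> 0 \<Longrightarrow> norm x \<le> C" using w by (auto simp: bdd_supp_on_def bdd_supp_def bounded_iff)
  obtain C' where C': "\<And>x. v x \<noteq> 0 \<Longrightarrow> norm x \<le> C'" using v by (auto simp: bdd_supp_def bounded_iff)
  have w2: "bdd_supp_on B (\<lambda>q. of_real (q $ i) * w q)"
  proof -
    have "bdd_supp (\<lambda>q. of_real (q $ i) * w q)"
      by (rule bdd_supp_mult[where C=C]) (use w C in \<open>auto simp: bdd_supp_on_def intro: order_trans[OF component_le_norm_cart]\<close>)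
    then show ?thesis using w by (auto simp: bdd_supp_on_def)
  qed
  have v2: "bdd_supp (\<lambda>q. of_real (q $ i) * v q)"
    by (rule bdd_supp_mult[where C=C']) (use v C' in \<open>auto intro: order_trans[OF component_le_norm_cart]\<close>)
  \<comment> \<open>The unbounded factor q_i - q'_i is split in two, and each coordinate is absorbed
    in the function whose bounded support bounds it.\<close>
  have X_eq: "?X \<omega> = frozen x' f \<gamma> \<omega> * (osc \<omega> * ((of_real (fst \<omega> $ i) * w (fst \<omega>)) * v (snd (snd \<omega>))))
      - frozen x' f \<gamma> \<omega> * (osc \<omega> * (w (fst \<omega>) * (of_real (snd (snd \<omega>) $ i) * v (snd (snd \<omega>)))))" for \<omega>
    by (simp add: algebra_simps)
  show X: "integrable lborel ?X"
    unfolding X_eq by (intro Bochner_Integration.integrable_diff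
        integrable_frozen[of f \<gamma>, OF fc(1) \<gamma> w2 v bound(1)] integrable_frozen[of f \<gamma>, OF fc(1) \<gamma> w v2 bound(1)])
  define H where "H \<omega> = frozen x' f \<gamma> \<omega> * R \<omega>" for \<omega>
  define H' where "H' \<omega> = frozen x' ?f' \<gamma> \<omega> * R \<omega> + of_real (inverse u) * (frozen x' f ?\<gamma>1 \<omega> * R \<omega>) + \<i> * ?X \<omega>" for \<omega>
  have "(LINT \<omega>|lborel. H' \<omega>) = 0"
  proof (rule integral_directional_derivative_eq_0[where d="?d" and H=H])
    show "integrable lborel H" unfolding H_def by (rule i0)
    show "integrable lborel H'"
      unfolding H'_def by (intro Bochner_Integration.integrable_add integrable_mult_right i1 i2 X)
  next
    fix x :: "'n point \<times> 'n point \<times> 'n point" and s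
    obtain q p q' where x: "x = (q, p, q')" by (cases x)
    have 1: "((\<lambda>s. f (q, p + s *\<^sub>R axis i 1, x')) has_vector_derivative ?f' (q, p + s *\<^sub>R axis i 1, x')) (at s)"
      using smooth_has_vector_derivative[OF f, of "(q, p, x')" ?d s UNIV] by simp
    have tensor_scale: "tensor (\<gamma>(i := \<lambda>t. inverse u * \<gamma>1 t)) y = inverse u * tensor ?\<gamma>1 y" for y
      by (simp add: tensor_upd)
    note 2 = has_vector_derivative_tensor[of \<gamma> i "\<lambda>t. inverse u * \<gamma>1 t" p s, OF deriv, unfolded tensor_scale]
    have "((\<lambda>s. f (q, p + s *\<^sub>R axis i 1, x') * of_real (tensor \<gamma> (p + s *\<^sub>R axis i 1)) * osc (q, p + s *\<^sub>R axis i 1, q') * (w q * v q'))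
       has_vector_derivative
       ((f (q, p + s *\<^sub>R axis i 1, x') * of_real (tensor \<gamma> (p + s *\<^sub>R axis i 1))) * (\<i> * of_real (q $ i - q' $ i) * osc (q, p + s *\<^sub>R axis i 1, q'))
         + (f (q, p + s *\<^sub>R axis i 1, x') * of_real (inverse u * tensor ?\<gamma>1 (p + s *\<^sub>R axis i 1)) + ?f' (q, p + s *\<^sub>R axis i 1, x') * of_real (tensor \<gamma> (p + s *\<^sub>R axis i 1))) * osc (q, p + s *\<^sub>R axis i 1, q')) * (w q * v q')) (at s)"
      by (intro has_vector_derivative_mult_left has_vector_derivative_mult 1 2 has_vector_derivative_osc)
    then show "((\<lambda>s. H (x + s *\<^sub>R ?d)) has_vector_derivative H' (x + s *\<^sub>R ?d)) (at s)"
      by (simp add: x H_def H'_def frozen_def R_def algebra_simps)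
    have c: "continuous_on UNIV (\<lambda>s. frozen x' h g (x + s *\<^sub>R ?d) * R (x + s *\<^sub>R ?d))"
      if h: "continuous_on UNIV h" and g: "\<And>i. reg (g i)" for h g
    proof -
      have "continuous_on UNIV (\<lambda>s. h (q, p + s *\<^sub>R axis i 1, x'))"
        by (rule continuous_on_compose2[OF h]) (auto intro!: continuous_intros)
      moreover have "continuous_on UNIV (\<lambda>s. tensor g (p + s *\<^sub>R axis i 1))"
        by (rule continuous_on_compose2[OF continuous_tensor[of g, OF g]]) (auto intro!: continuous_intros)
      ultimately show ?thesis
        unfolding frozen_def R_def osc_def x by (auto intro!: continuous_intros)
    qed
    have "continuous_on UNIV (\<lambda>s. (frozen x' ?f' \<gamma> (x + s *\<^sub>R ?d) * R (x + s *\<^sub>R ?d))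
        + of_real (inverse u) * (frozen x' f ?\<gamma>1 (x + s *\<^sub>R ?d) * R (x + s *\<^sub>R ?d))
        + \<i> * (of_real (q $ i - q' $ i) * (frozen x' f \<gamma> (x + s *\<^sub>R ?d) * R (x + s *\<^sub>R ?d))))"
      by (intro continuous_intros c fc \<gamma> \<gamma>1')
    then show "continuous_on UNIV (\<lambda>s. H' (x + s *\<^sub>R ?d))"
      by (simp add: H'_def R_def x)
  qed
  moreover have "(LINT \<omega>|lborel. H' \<omega>) = osc_form (frozen x' ?f' \<gamma>) w v + of_real (inverse u) * osc_form (frozen x' f ?\<gamma>1) w v + \<i> * (LINT \<omega>|lborel. ?X \<omega>)"
  proof -
    have "(LINT \<omega>|lborel. H' \<omega>) = (LINT \<omega>|lborel. frozen x' ?f' \<gamma> \<omega> * R \<omega>) + (LINT \<omega>|lborel. of_real (inverse u) * (frozen x' f ?\<gamma>1 \<omega> * R \<omega>)) + (LINT \<omega>|lborel. \<i> * ?X \<omega>)"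
      unfolding H'_def by (simp only: Bochner_Integration.integral_add Bochner_Integration.integrable_add integrable_mult_right i1 i2 X)
    then show ?thesis
      unfolding Bochner_Integration.integral_mult_right_zero osc_form_def R_def .
  qed
  ultimately have "\<i> * (LINT \<omega>|lborel. ?X \<omega>) = - (osc_form (frozen x' ?f' \<gamma>) w v + of_real (inverse u) * osc_form (frozen x' f ?\<gamma>1) w v)"
    using add.inverse_unique[of "osc_form (frozen x' ?f' \<gamma>) w v + of_real (inverse u) * osc_form (frozen x' f ?\<gamma>1) w v" "\<i> * (LINT \<omega>|lborel. ?X \<omega>)"]
    by metis
  then show "(LINT \<omega>|lborel. ?X \<omega>) = \<i> * (osc_form (frozen x' ?f' \<gamma>) w v + of_real (inverse u) * osc_form (frozen x' f ?\<gamma>1) w v)"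
    by (rule i_mult_eq_minus)
qed

text \<open>
  When the supports are separated in the \<open>i\<close>-th coordinate, the factor \<open>1 / (q\<^sub>i - q'\<^sub>i)\<close> left over by an
  integration by parts is the superposition \<open>\<integral>\<^sub>0\<^sup>\<infinity> e\<^bsup>-s (q\<^sub>i - q'\<^sub>i)\<^esup> ds\<close> of products of a function of \<open>q\<close> and
  a function of \<open>q'\<close>, so that it needs no further derivatives.
\<close>

lemma osc_form_separated:
  fixes f :: "'n::{finite,linorder} amplitude"
  assumes f: "smooth f" and \<gamma>: "\<And>i. reg (\<gamma> i)" and \<gamma>1: "reg \<gamma>1" and u: "u > 0"
    and deriv: "\<And>t. (\<gamma> i has_real_derivative inverse u * \<gamma>1 t) (at t)"
    and bound: "\<And>q p. q \<in> B \<Longrightarrow> norm (f (q, p, x')) \<le> D"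
      "\<And>q p. q \<in> B \<Longrightarrow> norm (dir_deriv (0, axis i 1, 0) f (q, p, x')) \<le> D'"
    and \<sigma>: "\<bar>\<sigma>\<bar> = 1" and sep: "\<And>q. q \<in> B \<Longrightarrow> a \<le> \<sigma> * q $ i" "\<And>q'. q' \<in> B' \<Longrightarrow> \<sigma> * q' $ i \<le> a'" "a' < a"
    and K1: "\<And>w v. bdd_supp_on B w \<Longrightarrow> bdd_supp_on B' v \<Longrightarrow>
      norm (osc_form (frozen x' (dir_deriv (0, axis i 1, 0) f) \<gamma>) w v) \<le> inverse u * K1 * (L2_norm lborel w * L2_norm lborel v)"
    and K2: "\<And>w v. bdd_supp_on B w \<Longrightarrow> bdd_supp_on B' v \<Longrightarrow>
      norm (osc_form (frozen x' f (\<gamma>(i := \<gamma>1))) w v) \<le> K2 * (L2_norm lborel w * L2_norm lborel v)"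
    and w: "bdd_supp_on B w" and v: "bdd_supp_on B' v" and K0: "K1 \<ge> 0" "K2 \<ge> 0"
  shows "norm (osc_form (frozen x' f \<gamma>) w v) \<le> (K1 + K2) / (u * (a - a')) * (L2_norm lborel w * L2_norm lborel v)"
proof -
  let ?\<delta> = "a - a'"
  let ?N = "L2_norm lborel w * L2_norm lborel v"
  have \<delta>: "?\<delta> > 0" using sep by simp
  note [measurable] = borel_measurable_frozen[of f \<gamma>, OF smooth_continuous[OF f] \<gamma>, of x']
  have bw: "bdd_supp w" and bv: "bdd_supp v" using w v by (auto simp: bdd_supp_on_def)
  note [measurable] = bdd_supp_measurable[OF bw] bdd_supp_measurable[OF bv]
  \<comment> \<open>Subtracting the thresholds \<open>a\<close> and \<open>a'\<close> in the
    exponents makes both factors at most 1 on their sets, so that the norms of \<open>w\<close> and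
    \<open>v\<close> do not grow. What is left over, \<open>exp (- (s * (a - a')))\<close>, carries
    the decay in \<open>s\<close>.\<close>
  define ws where "ws s q = of_real (exp (- (s * (\<sigma> * q $ i - a)))) * w q" for s q
  define vs where "vs s q = of_real (exp (- (s * (a' - \<sigma> * q $ i)))) * v q" for s q
  have ws: "bdd_supp_on B (ws s)" "L2_norm lborel (ws s) \<le> L2_norm lborel w" if "s \<ge> 0" for s
  proof -
    have e: "norm (complex_of_real (exp (- (s * (\<sigma> * q $ i - a))))) \<le> 1" if "q \<in> B" for q
      using sep(1)[OF that] \<open>s \<ge> 0\<close> by simp
    show "bdd_supp_on B (ws s)" unfolding ws_def by (rule bdd_supp_on_mult[OF w _ e]) measurable
    have "norm (ws s q) \<le> norm (w q)" for q
      using w mult_right_mono[OF e[of q], of "norm (w q)"] by (cases "w q = 0") (auto simp: ws_def norm_mult bdd_supp_on_def)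
    then show "L2_norm lborel (ws s) \<le> L2_norm lborel w"
      using \<open>bdd_supp_on B (ws s)\<close> by (intro bdd_supp_L2_mono[OF bw]) (auto simp: bdd_supp_on_def bdd_supp_def)
  qed
  have vs: "bdd_supp_on B' (vs s)" "L2_norm lborel (vs s) \<le> L2_norm lborel v" if "s \<ge> 0" for s
  proof -
    have e: "norm (complex_of_real (exp (- (s * (a' - \<sigma> * q $ i))))) \<le> 1" if "q \<in> B'" for q
      using sep(2)[OF that] \<open>s \<ge> 0\<close> by simp
    show "bdd_supp_on B' (vs s)" unfolding vs_def by (rule bdd_supp_on_mult[OF v _ e]) measurable
    have "norm (vs s q) \<le> norm (v q)" for q
      using v mult_right_mono[OF e[of q], of "norm (v q)"] by (cases "v q = 0") (auto simp: vs_def norm_mult bdd_supp_on_def)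
    then show "L2_norm lborel (vs s) \<le> L2_norm lborel v"
      using \<open>bdd_supp_on B' (vs s)\<close> by (intro bdd_supp_L2_mono[OF bv]) (auto simp: bdd_supp_on_def bdd_supp_def)
  qed
  obtain C where C: "\<And>x. w x \<noteq> 0 \<Longrightarrow> norm x \<le> C" using bw by (auto simp: bdd_supp_def bounded_iff)
  obtain C' where C': "\<And>x. v x \<noteq> 0 \<Longrightarrow> norm x \<le> C'" using bv by (auto simp: bdd_supp_def bounded_iff)
  define I where "I \<omega> = frozen x' f \<gamma> \<omega> * (osc \<omega> * (w (fst \<omega>) * v (snd (snd \<omega>))))" for \<omega>
  define x where "x \<omega> = fst \<omega> $ i - snd (snd \<omega>) $ i" for \<omega> :: "'n point \<times> 'n point \<times> 'n point"
  have I: "integrable lborel I"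
    unfolding I_def by (rule integrable_frozen[of f \<gamma>, OF smooth_continuous[OF f] \<gamma> w bv bound(1)])
  have Im[measurable]: "I \<in> borel_measurable borel" using I by (auto dest: borel_measurable_integrable)
  have x\<delta>: "?\<delta> \<le> \<sigma> * x \<omega>" and xC: "\<sigma> * x \<omega> \<le> C + C'" if "I \<omega> \<noteq> 0" for \<omega>
  proof -
    have nz: "w (fst \<omega>) \<noteq> 0" "v (snd (snd \<omega>)) \<noteq> 0" using that by (auto simp: I_def)
    then have "fst \<omega> \<in> B" "snd (snd \<omega>) \<in> B'" using w v by (auto simp: bdd_supp_on_def)
    then show "?\<delta> \<le> \<sigma> * x \<omega>" using sep(1,2) by (force simp: x_def right_diff_distrib)
    have "\<bar>fst \<omega> $ i\<bar> \<le> C" "\<bar>snd (snd \<omega>) $ i\<bar> \<le> C'"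
      using C[OF nz(1)] C'[OF nz(2)] by (auto intro: order_trans[OF component_le_norm_cart])
    then have "\<bar>\<sigma> * x \<omega>\<bar> \<le> C + C'" using \<sigma> by (simp add: abs_mult x_def)
    then show "\<sigma> * x \<omega> \<le> C + C'" by simp
  qed
  \<comment> \<open>\<open>I\<close> is multiplied by an exponential density of rate
    \<open>\<sigma> * x \<omega>\<close>, which has integral 1 in \<open>s\<close>. The factor
    \<open>x \<omega>\<close> of that density is the one \<open>osc_form_by_parts\<close> takes up,
    so that a quotient by \<open>x \<omega>\<close> never appears.\<close>
  define U where "U \<omega> s = I \<omega> * of_real (indicator {0..} s * (\<sigma> * x \<omega> * exp (- (s * (\<sigma> * x \<omega>)))))" for \<omega> s
  have U_int: "(LINT s|lborel. U \<omega> s) = I \<omega>" for \<omega>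
  proof (cases "I \<omega> = 0")
    case False
    have l: "\<sigma> * x \<omega> > 0" using x\<delta>[OF False] \<delta> by simp
    have "U \<omega> s = I \<omega> * of_real (exponential_density (\<sigma> * x \<omega>) s)" for s
      by (auto simp: U_def exponential_density_def indicator_def mult_ac)
    then show ?thesis by (simp add: integral_exponential_density[OF l] del: of_real_mult)
  qed (simp add: U_def)
  \<comment> \<open>The bound \<open>C + C'\<close> on the rate comes from the bounded supports. It
    justifies the exchange of integrals and does not enter the estimate.\<close>
  have U: "integrable (lborel \<Otimes>\<^sub>M lborel) (case_prod U)"
  proof (rule Bochner_Integration.integrable_bound)
    show "integrable (lborel \<Otimes>\<^sub>M lborel) (\<lambda>z. norm (I (fst z)) * (\<lambda>s. \<bar>C + C'\<bar> / ?\<delta> * exponential_density ?\<delta> s) (snd z))"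
      by (intro lborel_pair.integrable_mult_pair integrable_norm I integrable_mult_right integrable_exponential_density \<delta>)
    have "case_prod U = (\<lambda>z. I (fst z) * of_real (indicator {0..} (snd z) * (\<sigma> * x (fst z) * exp (- (snd z * (\<sigma> * x (fst z)))))))"
      by (auto simp: U_def)
    also have "\<dots> \<in> borel_measurable borel"
      unfolding x_def by measurable
    finally show "case_prod U \<in> borel_measurable (lborel \<Otimes>\<^sub>M lborel)" by (simp add: lborel_prod)
    show "AE z in lborel \<Otimes>\<^sub>M lborel. norm (case_prod U z) \<le> norm (norm (I (fst z)) * (\<bar>C + C'\<bar> / ?\<delta> * exponential_density ?\<delta> (snd z)))"
    proof (rule AE_I2)
      fix z :: "('n point \<times> 'n point \<times> 'n point) \<times> real"
      obtain \<omega> s where z: "z = (\<omega>, s)" by (cases z)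
      show "norm (case_prod U z) \<le> norm (norm (I (fst z)) * (\<bar>C + C'\<bar> / ?\<delta> * exponential_density ?\<delta> (snd z)))"
      proof (cases "I \<omega> = 0 \<or> s < 0")
        case False
        then have s: "s \<ge> 0" and "I \<omega> \<noteq> 0" by auto
        note b = x\<delta>[OF this(2)] xC[OF this(2)]
        have "exp (- (s * (\<sigma> * x \<omega>))) \<le> exp (- (s * ?\<delta>))"
          using mult_left_mono[OF b(1) s] by simp
        moreover have "0 \<le> \<sigma> * x \<omega>" "\<sigma> * x \<omega> \<le> \<bar>C + C'\<bar>" using b \<delta> by auto
        ultimately have "\<sigma> * x \<omega> * exp (- (s * (\<sigma> * x \<omega>))) \<le> \<bar>C + C'\<bar> * exp (- (s * ?\<delta>))"
          by (intro mult_mono) auto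
        then have "norm (I \<omega>) * \<bar>\<sigma> * x \<omega> * exp (- (s * (\<sigma> * x \<omega>)))\<bar> \<le> norm (I \<omega>) * (\<bar>C + C'\<bar> * exp (- (s * ?\<delta>)))"
          using \<open>0 \<le> \<sigma> * x \<omega>\<close> by (intro mult_left_mono) auto
        moreover have "norm (norm (I (fst z)) * (\<bar>C + C'\<bar> / ?\<delta> * exponential_density ?\<delta> (snd z))) = norm (I \<omega>) * (\<bar>C + C'\<bar> * exp (- (s * ?\<delta>)))"
          using s \<delta> by (simp add: z exponential_density_def abs_mult)
        moreover have "norm (case_prod U z) = norm (I \<omega>) * \<bar>\<sigma> * x \<omega> * exp (- (s * (\<sigma> * x \<omega>)))\<bar>"
          using s by (simp only: z U_def case_prod_conv norm_mult norm_of_real) simp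
        ultimately show ?thesis by simp
      qed (auto simp: z U_def)
    qed
  qed
  have inner: "norm (LINT \<omega>|lborel. U \<omega> s) \<le> exponential_density ?\<delta> s * ((K1 + K2) / (u * ?\<delta>) * ?N)" for s
  proof (cases "s < 0")
    case True
    then show ?thesis by (simp add: U_def exponential_density_def)
  next
    case False
    then have s: "s \<ge> 0" by simp
    have exps: "exp (- (s * (\<sigma> * x \<omega>))) = exp (- (s * ?\<delta>)) * exp (- (s * (\<sigma> * fst \<omega> $ i - a))) * exp (- (s * (a' - \<sigma> * snd (snd \<omega>) $ i)))" for \<omega>
      by (simp add: mult_exp_exp x_def algebra_simps)
    have "(LINT \<omega>|lborel. U \<omega> s) = (LINT \<omega>|lborel. of_real (\<sigma> * exp (- (s * ?\<delta>))) *
        (of_real (fst \<omega> $ i - snd (snd \<omega>) $ i) * (frozen x' f \<gamma> \<omega> * (osc \<omega> * (ws s (fst \<omega>) * vs s (snd (snd \<omega>)))))))"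
      using s by (intro Bochner_Integration.integral_cong refl) (simp only: U_def I_def ws_def vs_def exps, simp add: x_def mult_ac)
    also have "\<dots> = of_real (\<sigma> * exp (- (s * ?\<delta>))) *
        (\<i> * (osc_form (frozen x' (dir_deriv (0, axis i 1, 0) f) \<gamma>) (ws s) (vs s) + of_real (inverse u) * osc_form (frozen x' f (\<gamma>(i := \<gamma>1))) (ws s) (vs s)))"
      unfolding Bochner_Integration.integral_mult_right_zero
      by (rule arg_cong[OF osc_form_by_parts(2)[of f \<gamma>, OF f \<gamma> \<gamma>1 u deriv bound ws(1)[OF s]]])
        (use vs(1)[OF s] in \<open>auto simp: bdd_supp_on_def\<close>)
    finally have "norm (LINT \<omega>|lborel. U \<omega> s) = exp (- (s * ?\<delta>)) *
        norm (osc_form (frozen x' (dir_deriv (0, axis i 1, 0) f) \<gamma>) (ws s) (vs s) + of_real (inverse u) * osc_form (frozen x' f (\<gamma>(i := \<gamma>1))) (ws s) (vs s))"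
      using \<sigma> by (simp add: norm_mult)
    also have "\<dots> \<le> exp (- (s * ?\<delta>)) * (inverse u * K1 * ?N + inverse u * (K2 * ?N))"
    proof (intro mult_left_mono norm_triangle_le add_mono)
      have N: "L2_norm lborel (ws s) * L2_norm lborel (vs s) \<le> ?N"
        using ws(2)[OF s] vs(2)[OF s] by (intro mult_mono) (auto simp: L2_norm_nonneg)
      show "norm (osc_form (frozen x' (dir_deriv (0, axis i 1, 0) f) \<gamma>) (ws s) (vs s)) \<le> inverse u * K1 * ?N"
        using u K0 by (intro order_trans[OF K1[OF ws(1)[OF s] vs(1)[OF s]]] mult_left_mono N) auto
      have "norm (osc_form (frozen x' f (\<gamma>(i := \<gamma>1))) (ws s) (vs s)) \<le> K2 * ?N"
        using K0 by (intro order_trans[OF K2[OF ws(1)[OF s] vs(1)[OF s]]] mult_left_mono N) auto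
      then show "norm (of_real (inverse u) * osc_form (frozen x' f (\<gamma>(i := \<gamma>1))) (ws s) (vs s)) \<le> inverse u * (K2 * ?N)"
        using u by (simp only: norm_mult norm_of_real) (intro mult_mono, auto)
    qed simp
    \<comment> \<open>Writing the exponential as a density of mass 1 divided by its rate exhibits
      the gain 1 / (a - a').\<close>
    also have "\<dots> = exponential_density ?\<delta> s * ((K1 + K2) / (u * ?\<delta>) * ?N)"
      using s u \<delta> by (simp add: exponential_density_def divide_simps) (simp add: algebra_simps)
    finally show ?thesis .
  qed
  have "osc_form (frozen x' f \<gamma>) w v = (LINT \<omega>|lborel. LINT s|lborel. U \<omega> s)"
    unfolding U_int by (simp add: osc_form_def I_def)
  also have "\<dots> = (LINT s|lborel. LINT \<omega>|lborel. U \<omega> s)"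
    using lborel_pair.integral_fst[OF U] lborel_pair.integral_snd[OF U] by simp
  finally have "norm (osc_form (frozen x' f \<gamma>) w v) \<le> (LINT s|lborel. exponential_density ?\<delta> s * ((K1 + K2) / (u * ?\<delta>) * ?N))"
    by (simp only:) (rule norm_integral_le[OF integrable_mult_left[OF integrable_exponential_density[OF \<delta>]] inner])
  then show ?thesis
    unfolding Bochner_Integration.integral_mult_left_zero integral_exponential_density[OF \<delta>] by simp
qed

subsection \<open>The estimate on a pair of boxes\<close>

lemma gauss_deriv: "(gauss \<epsilon> has_real_derivative - (\<epsilon>\<^sup>2 * t) * gauss \<epsilon> t) (at t)"
proof -
  have "((\<lambda>t. exp (- (\<epsilon> * t)\<^sup>2 / 2)) has_real_derivative - (\<epsilon>\<^sup>2 * t) * exp (- (\<epsilon> * t)\<^sup>2 / 2)) (at t)"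
    by (auto intro!: derivative_eq_intros simp: power2_eq_square)
  then show ?thesis by (simp add: gauss_def[abs_def])
qed

text \<open>\<open>u\<close> times the derivative of \<open>gauss \<epsilon>\<close>; likewise
  \<open>gauss2\<close> is \<open>u\<^sup>2\<close> times its second derivative. With
  \<open>u = wgt c i\<close> this is the scaling of the derivatives in p in the seminorms.\<close>

definition gauss1 :: "real \<Rightarrow> real \<Rightarrow> real \<Rightarrow> real" where
  "gauss1 u \<epsilon> t = - (u * \<epsilon>\<^sup>2 * t) * gauss \<epsilon> t"

definition gauss2 :: "real \<Rightarrow> real \<Rightarrow> real \<Rightarrow> real" where
  "gauss2 u \<epsilon> t = u\<^sup>2 * (\<epsilon> ^ 4 * t\<^sup>2 - \<epsilon>\<^sup>2) * gauss \<epsilon> t"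

lemma gauss_deriv1: "u > 0 \<Longrightarrow> (gauss \<epsilon> has_real_derivative inverse u * gauss1 u \<epsilon> t) (at t)"
  using gauss_deriv[of \<epsilon> t] by (simp add: gauss1_def field_simps)

lemma gauss_deriv2: "u > 0 \<Longrightarrow> (gauss1 u \<epsilon> has_real_derivative inverse u * gauss2 u \<epsilon> t) (at t)"
  unfolding gauss1_def[abs_def] gauss2_def
  by (rule derivative_eq_intros gauss_deriv refl)+ (simp add: field_simps power2_eq_square power4_eq_xxxx)

lemma integrable_gauss_power:
  assumes "\<epsilon> > 0"
  shows "integrable lborel (\<lambda>t. t ^ k * gauss \<epsilon> t)"
proof -
  have "integrable lborel (\<lambda>t. sqrt (2 * pi) / \<epsilon> * (normal_density 0 (inverse \<epsilon>) t * (t - 0) ^ k))"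
    by (intro integrable_mult_right integrable_normal_moment) (use assms in auto)
  then show ?thesis using assms by (simp add: gauss_eq_normal_density mult_ac)
qed

text \<open>Apart from the factor \<open>u * \<epsilon>\<close> the modulus is y exp (- y^2 / 2)
  with y = \<bar>\<epsilon> t\<bar>, and y \<le> 1 + y^2 / 2 \<le> exp (y^2 / 2).\<close>

lemma reg_gauss1:
  assumes \<epsilon>: "\<epsilon> > 0" and u: "u > 0" "u * \<epsilon> \<le> 1"
  shows "reg (gauss1 u \<epsilon>)"
proof -
  have "\<bar>gauss1 u \<epsilon> t\<bar> \<le> 1" for t
  proof -
    have "\<bar>\<epsilon> * t\<bar> \<le> 1 + (\<epsilon> * t)\<^sup>2 / 2"
      using sum_squares_bound[of "\<bar>\<epsilon> * t\<bar>" 1] by simp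
    also have "\<dots> \<le> exp ((\<epsilon> * t)\<^sup>2 / 2)" by (rule exp_ge_add_one_self)
    finally have "\<bar>\<epsilon> * t\<bar> * gauss \<epsilon> t \<le> 1"
      by (simp add: gauss_def exp_minus field_simps)
    then have "(u * \<epsilon>) * (\<bar>\<epsilon> * t\<bar> * gauss \<epsilon> t) \<le> 1 * 1"
      using u \<epsilon> by (intro mult_mono mult_nonneg_nonneg less_imp_le[OF gauss_pos]) auto
    then show ?thesis
      using u \<epsilon> gauss_pos[of \<epsilon> t] by (simp add: gauss1_def abs_mult power2_eq_square mult_ac)
  qed
  moreover have "continuous_on UNIV (gauss1 u \<epsilon>)"
    unfolding gauss1_def[abs_def] by (intro continuous_intros continuous_gauss)
  moreover have "integrable lborel (gauss1 u \<epsilon>)"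
    using integrable_mult_right[OF integrable_gauss_power[OF \<epsilon>, of 1], of "- (u * \<epsilon>\<^sup>2)"]
    by (simp add: gauss1_def[abs_def] mult_ac)
  ultimately show ?thesis by (simp add: reg_def)
qed

text \<open>With y = (\<epsilon> t)^2 / 2 the point is \<bar>2 y - 1\<bar> \<le> exp y. For 1 - 2 y
  the bound 1 + y \<le> exp y is enough; for 2 y - 1, which exceeds 1 + y when y > 2, the quadratic
  Taylor term is needed.\<close>

lemma reg_gauss2:
  assumes \<epsilon>: "\<epsilon> > 0" and u: "u > 0" "u * \<epsilon> \<le> 1"
  shows "reg (gauss2 u \<epsilon>)"
proof -
  have eq: "gauss2 u \<epsilon> t = (u * \<epsilon>)\<^sup>2 * (((\<epsilon> * t)\<^sup>2 - 1) * gauss \<epsilon> t)" for t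
    by (simp add: gauss2_def algebra_simps power2_eq_square power4_eq_xxxx)
  have "\<bar>gauss2 u \<epsilon> t\<bar> \<le> 1" for t
  proof -
    define y where "y = (\<epsilon> * t)\<^sup>2 / 2"
    have y: "y \<ge> 0" "(\<epsilon> * t)\<^sup>2 = 2 * y" by (auto simp: y_def)
    have "1 + y + y\<^sup>2 / 2 \<le> exp y" by (rule exp_lower_Taylor_quadratic[OF y(1)])
    moreover have "0 \<le> y\<^sup>2 - 2 * y + 1" using zero_le_power2[of "y - 1"] by (simp add: power2_diff)
    ultimately have "\<bar>(\<epsilon> * t)\<^sup>2 - 1\<bar> \<le> exp ((\<epsilon> * t)\<^sup>2 / 2)"
      using y(1) zero_le_power2[of y] unfolding y(2) abs_le_iff by (auto intro: order_trans[OF _ exp_ge_add_one_self])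
    then have "\<bar>(\<epsilon> * t)\<^sup>2 - 1\<bar> * gauss \<epsilon> t \<le> 1"
      by (simp add: gauss_def exp_minus field_simps)
    moreover have "(u * \<epsilon>)\<^sup>2 \<le> 1" using u \<epsilon> by (simp add: power_le_one)
    ultimately have "(u * \<epsilon>)\<^sup>2 * (\<bar>(\<epsilon> * t)\<^sup>2 - 1\<bar> * gauss \<epsilon> t) \<le> 1 * 1"
      by (intro mult_mono mult_nonneg_nonneg less_imp_le[OF gauss_pos]) auto
    then show ?thesis
      using gauss_pos[of \<epsilon> t] unfolding eq by (simp only: abs_mult) simp
  qed
  moreover have "continuous_on UNIV (gauss2 u \<epsilon>)"
    unfolding gauss2_def[abs_def] by (intro continuous_intros continuous_gauss)
  moreover have "integrable lborel (gauss2 u \<epsilon>)"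
  proof -
    have "integrable lborel (\<lambda>t. u\<^sup>2 * \<epsilon> ^ 4 * (t ^ 2 * gauss \<epsilon> t) - u\<^sup>2 * \<epsilon>\<^sup>2 * gauss \<epsilon> t)"
      by (intro Bochner_Integration.integrable_diff integrable_mult_right integrable_gauss_power integrable_gauss \<epsilon>)
    then show ?thesis by (simp add: gauss2_def[abs_def] algebra_simps)
  qed
  ultimately show ?thesis by (simp add: reg_def)
qed

lemma osc_form_frozen_scaleR: "osc_form (frozen x' (\<lambda>z. r *\<^sub>R f z) \<gamma>) w v = of_real r * osc_form (frozen x' f \<gamma>) w v"
  unfolding osc_form_def frozen_def Bochner_Integration.integral_mult_right_zero[symmetric]
  by (simp add: scaleR_conv_of_real mult_ac)

text \<open>
  The \<open>4\<close> counts the terms left by two integrations by parts, each of which falls on the amplitude or on the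
  Gaussian; a weight \<open>\<kappa> \<ge> 1\<close> is for coordinates in which nothing is done.
\<close>

definition apart :: "real \<Rightarrow> 'n::{finite,linorder} point set \<Rightarrow> 'n point set \<Rightarrow> 'n \<Rightarrow> real \<Rightarrow> bool" where
  "apart c B B' i \<kappa> \<longleftrightarrow> 1 \<le> \<kappa> \<or> (\<exists>\<sigma> a a'. \<bar>\<sigma>\<bar> = 1 \<and> (\<forall>q\<in>B. a \<le> \<sigma> * q $ i) \<and> (\<forall>q'\<in>B'. \<sigma> * q' $ i \<le> a')
     \<and> a' < a \<and> 4 / (wgt c i * (a - a'))\<^sup>2 \<le> \<kappa>)"

lemma wderiv_0: "wderiv e c (\<lambda>_. 0) f = f"
  by (simp add: wderiv_def foldr_id)

text \<open>One coordinate at a time, \<open>osc_form_separated\<close> is applied to the form and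
  then to each of the two forms it leaves. The derivatives fall twice on the amplitude, twice on the
  Gaussian, or once on each, so orders up to two suffice in every coordinate. No condition relates
  different coordinates, hence the gains multiply.\<close>

lemma osc_form_decay_p:
  fixes f :: "'n::{finite,linorder} amplitude"
  assumes f: "smooth f" and c: "c > 0" and \<epsilon>: "\<epsilon> > 0" "\<epsilon> \<le> 1" "c * \<epsilon> \<le> 1"
    and ap: "\<And>i. apart c B B' i (\<kappa> i)" and \<kappa>0: "\<And>i. \<kappa> i \<ge> 0"
    and bound: "\<And>A q p. (\<forall>i. A i \<le> 2) \<Longrightarrow> q \<in> B \<Longrightarrow> norm (deriv_p c A f (q, p, x')) \<le> D"
    and form: "\<And>A \<gamma> w v. (\<forall>i. A i \<le> 2) \<Longrightarrow> (\<forall>i. reg (\<gamma> i)) \<Longrightarrow> bdd_supp_on B w \<Longrightarrow> bdd_supp_on B' v \<Longrightarrow>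
      norm (osc_form (frozen x' (deriv_p c A f) \<gamma>) w v) \<le> K * (L2_norm lborel w * L2_norm lborel v)"
    and K: "K \<ge> 0" and w: "bdd_supp_on B w" and v: "bdd_supp_on B' v"
  shows "norm (osc_form (frozen x' f (\<lambda>_. gauss \<epsilon>)) w v) \<le> (\<Prod>i\<in>UNIV. \<kappa> i) * K * (L2_norm lborel w * L2_norm lborel v)"
proof -
  let ?e = "\<lambda>i. (0, axis i 1, 0) :: 'n point \<times> 'n point \<times> 'n point"
  define d where "d xs A = foldr (\<lambda>i. wderiv1 ?e c i ^^ A i) xs" for xs and A :: "'n \<Rightarrow> nat"
  have d_append: "d (xs @ [i]) A g = d xs A ((wderiv1 ?e c i ^^ A i) g)" for xs i A g
    by (simp add: d_def)
  have d_cong: "d xs (A(i := m)) g = d xs A g" if "i \<notin> set xs" for xs i A m g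
    unfolding d_def using that by (intro foldr_cong[THEN fun_cong] foldr_cong) auto
  have d0: "d xs (\<lambda>_. 0) h = h" for xs h by (simp add: d_def foldr_id)
  \<comment> \<open>Coordinates outside \<open>xs\<close> are done and may already carry
    \<open>gauss1\<close> or \<open>gauss2\<close>; therefore \<gamma> is only required to be
    Gaussian on \<open>xs\<close>.\<close>
  have claim: "norm (osc_form (frozen x' g \<gamma>) w v) \<le> (\<Prod>i\<in>set xs. \<kappa> i) * K * (L2_norm lborel w * L2_norm lborel v)"
    if "distinct xs" "smooth g" "\<And>i. reg (\<gamma> i)" "\<And>i. i \<in> set xs \<Longrightarrow> \<gamma> i = gauss \<epsilon>" "bdd_supp_on B w" "bdd_supp_on B' v"
      and "\<And>A q p. (\<forall>i. A i \<le> 2) \<Longrightarrow> q \<in> B \<Longrightarrow> norm (d xs A g (q, p, x')) \<le> D"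
      and "\<And>A \<gamma> w v. (\<forall>i. A i \<le> 2) \<Longrightarrow> (\<forall>i. reg (\<gamma> i)) \<Longrightarrow> bdd_supp_on B w \<Longrightarrow> bdd_supp_on B' v \<Longrightarrow>
        norm (osc_form (frozen x' (d xs A g) \<gamma>) w v) \<le> K * (L2_norm lborel w * L2_norm lborel v)"
    for xs g \<gamma> w v
    using that
  proof (induction xs arbitrary: g \<gamma> w v rule: rev_induct)
    case Nil
    then show ?case using Nil.prems(8)[of "\<lambda>_. 0" \<gamma> w v] by (simp add: d_def)
  next
    case (snoc i xs)
    have i: "i \<notin> set xs" and xs: "distinct xs" using snoc.prems(1) by auto
    note g = snoc.prems(2) and \<gamma> = snoc.prems(3) and w = snoc.prems(5) and v = snoc.prems(6)
    let ?u = "wgt c i" and ?P = "(\<Prod>i\<in>set xs. \<kappa> i)"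
    let ?N = "\<lambda>w v :: 'n point \<Rightarrow> complex. L2_norm lborel w * L2_norm lborel v"
    let ?g = "\<lambda>j. (wderiv1 ?e c i ^^ j) g"
    have N: "?N w v \<ge> 0" for w v by (simp add: L2_norm_nonneg)
    have P: "?P \<ge> 0" by (intro prod_nonneg) (use \<kappa>0 in auto)
    have u: "?u > 0" by (rule wgt_pos[OF c])
    have u\<epsilon>: "?u * \<epsilon> \<le> 1" using \<epsilon> by (simp add: wgt_def)
    have dj: "d (xs @ [i]) (A(i := j)) h = d xs A ((wderiv1 ?e c i ^^ j) h)" for A h j
      using d_cong[OF i, of A j] by (simp add: d_append)
    have gs: "smooth (?g j)" for j by (rule smooth_wderiv1_pow[OF g])
    have IH: "norm (osc_form (frozen x' (?g j) \<gamma>') w' v') \<le> ?P * K * ?N w' v'"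
      if j: "j \<le> 2" and \<gamma>': "\<And>j. reg (\<gamma>' j)" "\<And>j. j \<in> set xs \<Longrightarrow> \<gamma>' j = gauss \<epsilon>"
        and wv: "bdd_supp_on B w'" "bdd_supp_on B' v'" for j \<gamma>' w' v'
    proof (rule snoc.IH[OF xs gs \<gamma>' wv])
      fix A :: "'n \<Rightarrow> nat" assume A: "\<forall>i. A i \<le> 2"
      show "norm (d xs A (?g j) (q, p, x')) \<le> D" if "q \<in> B" for q p
        using snoc.prems(7)[of "A(i := j)" q p, unfolded dj] A j that by simp
      show "norm (osc_form (frozen x' (d xs A (?g j)) \<gamma>) w v) \<le> K * ?N w v"
        if "\<forall>i. reg (\<gamma> i)" "bdd_supp_on B w" "bdd_supp_on B' v" for \<gamma> w v
        using snoc.prems(8)[of "A(i := j)" \<gamma> w v, unfolded dj] A j that by simp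
    qed
    have gD: "norm (?g j (q, p, x')) \<le> D" if "q \<in> B" "j \<le> 2" for q p j
      using snoc.prems(7)[of "(\<lambda>_. 0)(i := j)" q p, unfolded dj d0] that by simp
    \<comment> \<open>Integration by parts produces unscaled derivatives, the symbol estimates
      control scaled ones. The discrepancy \<open>inverse ?u\<close> is the one built into the
      hypothesis on \<open>K1\<close> in \<open>osc_form_separated\<close>.\<close>
    have dg: "dir_deriv (0, axis i 1, 0) (?g j) = (\<lambda>z. inverse ?u *\<^sub>R ?g (Suc j) z)" for j
      using dir_deriv_eq_wderiv1[OF c, of ?e i "?g j"] by (auto simp: fun_eq_iff)
    have gD': "norm (dir_deriv (0, axis i 1, 0) (?g j) (q, p, x')) \<le> inverse ?u * D" if "q \<in> B" "j \<le> 1" for q p j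
      using gD[of q "Suc j" p] that u unfolding dg norm_scaleR by (intro mult_mono) auto
    have set_eq: "(\<Prod>i\<in>set (xs @ [i]). \<kappa> i) = \<kappa> i * ?P" using i by simp
    show ?case
    proof (cases "1 \<le> \<kappa> i")
      case True
      have "norm (osc_form (frozen x' (?g 0) \<gamma>) w v) \<le> ?P * K * ?N w v"
        using snoc.prems(4) by (intro IH \<gamma> w v) auto
      also have "\<dots> = 1 * (?P * K * ?N w v)" by simp
      also have "\<dots> \<le> \<kappa> i * (?P * K * ?N w v)"
        by (rule mult_right_mono[OF True mult_nonneg_nonneg[OF mult_nonneg_nonneg[OF P K] N]])
      finally show ?thesis unfolding set_eq by (simp add: mult_ac)
    next
      case False
      then obtain \<sigma> a a' where \<sigma>: "\<bar>\<sigma>\<bar> = 1" and sep: "\<And>q. q \<in> B \<Longrightarrow> a \<le> \<sigma> * q $ i" "\<And>q'. q' \<in> B' \<Longrightarrow> \<sigma> * q' $ i \<le> a'" "a' < a"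
        and \<kappa>: "4 / (?u * (a - a'))\<^sup>2 \<le> \<kappa> i"
        using ap[of i] unfolding apart_def by blast
      let ?\<gamma>1 = "\<gamma>(i := gauss1 ?u \<epsilon>)"
      have \<gamma>i: "\<gamma> i = gauss \<epsilon>" using snoc.prems(4) by simp
      have r1: "reg (gauss1 ?u \<epsilon>)" and r2: "reg (gauss2 ?u \<epsilon>)" by (intro reg_gauss1 reg_gauss2 \<epsilon> u u\<epsilon>)+
      have \<gamma>1: "reg (?\<gamma>1 j)" for j using r1 \<gamma> by simp
      have PK: "?P * K \<ge> 0" using P K by simp
      \<comment> \<open>The bound after one integration by parts is already gained: in
        \<open>step1\<close> the other derivative fell on the amplitude, in \<open>step0\<close> on
        the Gaussian.\<close>
      define L where "L = (?P * K + ?P * K) / (?u * (a - a'))"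
      have L0: "L \<ge> 0" using PK u sep(3) unfolding L_def by (intro divide_nonneg_pos add_nonneg_nonneg mult_pos_pos) auto
      have dgN: "norm (osc_form (frozen x' (dir_deriv (0, axis i 1, 0) (?g j)) \<gamma>') w' v') \<le> inverse ?u * M * ?N w' v'"
        if "norm (osc_form (frozen x' (?g (Suc j)) \<gamma>') w' v') \<le> M * ?N w' v'" for j \<gamma>' w' v' M
      proof -
        have "norm (osc_form (frozen x' (dir_deriv (0, axis i 1, 0) (?g j)) \<gamma>') w' v') = inverse ?u * norm (osc_form (frozen x' (?g (Suc j)) \<gamma>') w' v')"
          unfolding dg osc_form_frozen_scaleR norm_mult norm_of_real using u by simp
        also have "\<dots> \<le> inverse ?u * (M * ?N w' v')" using that u by (intro mult_left_mono) auto
        finally show ?thesis by (simp add: mult_ac)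
      qed
      have step1: "norm (osc_form (frozen x' (?g 1) \<gamma>) w' v') \<le> L * ?N w' v'" if wv: "bdd_supp_on B w'" "bdd_supp_on B' v'" for w' v'
        unfolding L_def
      proof (rule osc_form_separated[of "?g 1" \<gamma> "gauss1 ?u \<epsilon>" ?u i B x' D "inverse ?u * D" \<sigma> a B' a', OF gs \<gamma> r1 u _ _ _ \<sigma> sep _ _ wv PK PK])
        show "(\<gamma> i has_real_derivative inverse ?u * gauss1 ?u \<epsilon> t) (at t)" for t unfolding \<gamma>i by (rule gauss_deriv1[OF u])
        show "norm (?g 1 (q, p, x')) \<le> D" if "q \<in> B" for q p by (rule gD[OF that]) simp
        show "norm (dir_deriv (0, axis i 1, 0) (?g 1) (q, p, x')) \<le> inverse ?u * D" if "q \<in> B" for q p by (rule gD'[OF that]) simp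
        show "norm (osc_form (frozen x' (dir_deriv (0, axis i 1, 0) (?g 1)) \<gamma>) w v) \<le> inverse ?u * (?P * K) * ?N w v" if "bdd_supp_on B w" "bdd_supp_on B' v" for w v
          using snoc.prems(4) by (intro dgN IH \<gamma> that) auto
        show "norm (osc_form (frozen x' (?g 1) ?\<gamma>1) w v) \<le> ?P * K * ?N w v" if "bdd_supp_on B w" "bdd_supp_on B' v" for w v
          using snoc.prems(4) i by (intro IH \<gamma>1 that) auto
      qed
      have step0: "norm (osc_form (frozen x' (?g 0) ?\<gamma>1) w' v') \<le> L * ?N w' v'" if wv: "bdd_supp_on B w'" "bdd_supp_on B' v'" for w' v'
        unfolding L_def
      proof (rule osc_form_separated[of "?g 0" ?\<gamma>1 "gauss2 ?u \<epsilon>" ?u i B x' D "inverse ?u * D" \<sigma> a B' a', OF gs \<gamma>1 r2 u _ _ _ \<sigma> sep _ _ wv PK PK])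
        show "(?\<gamma>1 i has_real_derivative inverse ?u * gauss2 ?u \<epsilon> t) (at t)" for t using gauss_deriv2[OF u] by simp
        show "norm (?g 0 (q, p, x')) \<le> D" if "q \<in> B" for q p by (rule gD[OF that]) simp
        show "norm (dir_deriv (0, axis i 1, 0) (?g 0) (q, p, x')) \<le> inverse ?u * D" if "q \<in> B" for q p by (rule gD'[OF that]) simp
        show "norm (osc_form (frozen x' (dir_deriv (0, axis i 1, 0) (?g 0)) ?\<gamma>1) w v) \<le> inverse ?u * (?P * K) * ?N w v" if "bdd_supp_on B w" "bdd_supp_on B' v" for w v
          using snoc.prems(4) i by (intro dgN IH \<gamma>1 that) auto
        show "norm (osc_form (frozen x' (?g 0) (?\<gamma>1(i := gauss2 ?u \<epsilon>))) w v) \<le> ?P * K * ?N w v" if "bdd_supp_on B w" "bdd_supp_on B' v" for w v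
          using snoc.prems(4) i r2 \<gamma> by (intro IH that) auto
      qed
      have "norm (osc_form (frozen x' (?g 0) \<gamma>) w v) \<le> (L + L) / (?u * (a - a')) * ?N w v"
      proof (rule osc_form_separated[of "?g 0" \<gamma> "gauss1 ?u \<epsilon>" ?u i B x' D "inverse ?u * D" \<sigma> a B' a', OF gs \<gamma> r1 u _ _ _ \<sigma> sep _ _ w v L0 L0])
        show "(\<gamma> i has_real_derivative inverse ?u * gauss1 ?u \<epsilon> t) (at t)" for t unfolding \<gamma>i by (rule gauss_deriv1[OF u])
        show "norm (?g 0 (q, p, x')) \<le> D" if "q \<in> B" for q p by (rule gD[OF that]) simp
        show "norm (dir_deriv (0, axis i 1, 0) (?g 0) (q, p, x')) \<le> inverse ?u * D" if "q \<in> B" for q p by (rule gD'[OF that]) simp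
        show "norm (osc_form (frozen x' (dir_deriv (0, axis i 1, 0) (?g 0)) \<gamma>) w v) \<le> inverse ?u * L * ?N w v" if "bdd_supp_on B w" "bdd_supp_on B' v" for w v
          using step1[OF that] by (intro dgN) simp
        show "norm (osc_form (frozen x' (?g 0) ?\<gamma>1) w v) \<le> L * ?N w v" if "bdd_supp_on B w" "bdd_supp_on B' v" for w v
          by (rule step0[OF that])
      qed
      also have "(L + L) / (?u * (a - a')) = 4 / (?u * (a - a'))\<^sup>2 * (?P * K)"
        by (simp add: L_def power2_eq_square add_divide_distrib[symmetric])
      also have "4 / (?u * (a - a'))\<^sup>2 * (?P * K) * ?N w v \<le> \<kappa> i * (?P * K) * ?N w v"
        by (intro mult_right_mono \<kappa> PK N)
      finally show ?thesis unfolding set_eq by (simp add: mult_ac)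
    qed
  qed
  let ?xs = "sorted_list_of_set (UNIV :: 'n set)"
  have "d ?xs A = deriv_p c A" for A by (simp add: d_def wderiv_def deriv_p_def)
  then show ?thesis
    using claim[of ?xs f "\<lambda>_. gauss \<epsilon>" w v] f w v bound form reg_gauss[OF \<epsilon>(1)] by simp
qed

text \<open>The decay in p depends on \<open>w\<close> and \<open>v\<close> only through their
  supports, and freezing a variable keeps these inside the boxes. So the three reductions can be
  nested, each one providing the hypothesis \<open>form\<close> of the one around it. In every
  coordinate the two freezings cost 2 each and Plancherel's inequality 2 \<pi>, together 8
  \<pi>.\<close>

lemma box_estimate:
  fixes f :: "'n::{finite,linorder} amplitude"
  assumes f: "smooth f" and c: "c > 0" and \<epsilon>: "\<epsilon> > 0" "\<epsilon> \<le> 1" "c * \<epsilon> \<le> 1"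
    and box: "\<And>i. hi $ i = lo $ i + wgt (inverse c) i" and box': "\<And>i. hi' $ i = lo' $ i + wgt (inverse c) i"
    and ap: "\<And>i. apart c (cbox lo hi) (cbox lo' hi') i (\<kappa> i)" and \<kappa>0: "\<And>i. \<kappa> i \<ge> 0"
    and bound: "\<And>A B A' q p q'. (\<forall>i. A i \<le> 1) \<Longrightarrow> (\<forall>i. B i \<le> 2) \<Longrightarrow> (\<forall>i. A' i \<le> 1) \<Longrightarrow>
      q \<in> cbox lo hi \<Longrightarrow> q' \<in> cbox lo' hi' \<Longrightarrow>
      norm (deriv_q c A (deriv_p c B (deriv_q' c A' f)) (q, p, q')) \<le> D"
    and w: "bdd_supp_on (cbox lo hi) w" and v: "bdd_supp_on (cbox lo' hi') v"
  shows "norm (osc_form (\<lambda>\<omega>. f \<omega> * of_real (tensor (\<lambda>_. gauss \<epsilon>) (fst (snd \<omega>)))) w v)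
    \<le> (8 * pi) ^ CARD('n) * D * (\<Prod>i\<in>UNIV. \<kappa> i) * (L2_norm lborel w * L2_norm lborel v)"
proof -
  let ?\<gamma> = "\<lambda>_ :: 'n. gauss \<epsilon>"
  have \<gamma>: "reg (?\<gamma> i)" for i by (rule reg_gauss[OF \<epsilon>(1)])
  let ?k = "\<lambda>\<omega> :: 'n point \<times> 'n point \<times> 'n point. of_real (tensor ?\<gamma> (fst (snd \<omega>))) * osc \<omega> * w (fst \<omega>)"
  let ?P = "\<lambda>(x :: 'n point) \<omega> :: 'n point \<times> 'n point \<times> 'n point. (fst \<omega>, fst (snd \<omega>), x)"
  have bw: "bdd_supp w" and bv: "bdd_supp v" using w v by (auto simp: bdd_supp_on_def)
  note [measurable] = tensor_reg_measurable[of ?\<gamma>, OF \<gamma>] bdd_supp_measurable[OF bw]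
  have lo: "lo \<in> cbox lo hi" using box less_imp_le[OF wgt_pos[of "inverse c"]] c by (auto simp: mem_box_cart)
  have lo': "lo' \<in> cbox lo' hi'" using box' less_imp_le[OF wgt_pos[of "inverse c"]] c by (auto simp: mem_box_cart)
  have D: "D \<ge> 0"
    by (rule order_trans[OF norm_ge_zero bound[OF _ _ _ lo lo', of "\<lambda>_. 0" "\<lambda>_. 0" "\<lambda>_. 0" 0]]) simp_all
  have \<kappa>P: "(\<Prod>i\<in>UNIV. \<kappa> i) \<ge> 0" by (intro prod_nonneg) (use \<kappa>0 in auto)
  let ?M = "2 ^ CARD('n) * (D * (2 * pi) ^ CARD('n))"
  let ?K = "(\<Prod>i\<in>UNIV. \<kappa> i) * ?M * L2_norm lborel w"
  have "norm (LINT \<omega>|lborel. f (?P (snd (snd \<omega>)) \<omega>) * (?k \<omega> * v (snd (snd \<omega>)))) \<le> 2 ^ CARD('n) * ?K * L2_norm lborel v"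
  proof (rule freeze_block[where c="inverse c" and e="\<lambda>i. (0, 0, axis i 1)" and lo=lo' and hi=hi' and D=D and X="\<lambda>\<omega>. snd (snd \<omega>)" and P="?P" and k="?k"])
    show "sigma_finite_measure (lborel :: ('n point \<times> 'n point \<times> 'n point) measure)" by (rule sigma_finite_lborel)
    show "(\<lambda>\<omega>. snd (snd \<omega>)) \<in> (lborel :: ('n point \<times> 'n point \<times> 'n point) measure) \<rightarrow>\<^sub>M borel" by measurable
    show "?k \<in> borel_measurable lborel" by measurable
    have "(\<lambda>z :: 'n point \<times> 'n point \<times> 'n point \<times> 'n point. (fst (snd z), fst (snd (snd z)), fst z)) \<in> borel_measurable borel"
      by (intro borel_measurable_continuous_onI continuous_intros)
    then show "(\<lambda>z. ?P (fst z) (snd z)) \<in> borel \<Otimes>\<^sub>M lborel \<rightarrow>\<^sub>M borel"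
      by - (subst measurable_borel_pair_lborel)
    show "integrable lborel (\<lambda>\<omega>. ?k \<omega> * v (snd (snd \<omega>)))" if "bdd_supp_on (cbox lo' hi') v" for v
    proof -
      have "integrable lborel (\<lambda>\<omega>. frozen 0 (\<lambda>_. 1) ?\<gamma> \<omega> * (osc \<omega> * (w (fst \<omega>) * v (snd (snd \<omega>)))))"
        by (rule integrable_frozen[of _ ?\<gamma>, OF _ \<gamma> w, of _ _ _ 1]) (use that in \<open>auto simp: bdd_supp_on_def\<close>)
      then show ?thesis by (simp add: frozen_def mult_ac)
    qed
    show "norm (wderiv (\<lambda>i. (0, 0, axis i 1)) (inverse c) A f (?P x \<omega>)) \<le> D"
      if A: "\<forall>i. A i \<le> 1" and x: "x \<in> cbox lo' hi'" and k: "?k \<omega> \<noteq> 0" for A x \<omega>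
    proof -
      have "fst \<omega> \<in> cbox lo hi" using k w by (auto simp: bdd_supp_on_def)
      from bound[OF _ _ A this x, of "\<lambda>_. 0" "\<lambda>_. 0" "fst (snd \<omega>)"] show ?thesis
        by (simp add: deriv_q_def deriv_p_def deriv_q'_def wderiv_0)
    qed
    show "norm (LINT \<omega>|lborel. wderiv (\<lambda>i. (0, 0, axis i 1)) (inverse c) A f (?P x \<omega>) * (?k \<omega> * v (snd (snd \<omega>)))) \<le> ?K * L2_norm lborel v"
      if A: "\<forall>i. A i \<le> 1" and x: "x \<in> cbox lo' hi'" and v: "bdd_supp_on (cbox lo' hi') v" for A x v
    proof -
      let ?h = "deriv_q' c A f"
      have hs: "smooth ?h" unfolding deriv_q'_def by (rule smooth_wderiv[OF f])
      have "norm (osc_form (frozen x ?h ?\<gamma>) w v) \<le> (\<Prod>i\<in>UNIV. \<kappa> i) * ?M * (L2_norm lborel w * L2_norm lborel v)"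
      proof (rule osc_form_decay_p[where K="?M" and D=D, OF hs c \<epsilon> ap \<kappa>0 _ _ _ w v])
        show "norm (deriv_p c B ?h (q, p, x)) \<le> D" if B: "\<forall>i. B i \<le> 2" and q: "q \<in> cbox lo hi" for B q p
          using bound[OF _ B A q x, of "\<lambda>_. 0" p] by (simp add: deriv_q_def wderiv_0)
        show "norm (osc_form (frozen x (deriv_p c B ?h) \<gamma>) w v) \<le> ?M * (L2_norm lborel w * L2_norm lborel v)"
          if B: "\<forall>i. B i \<le> 2" and \<gamma>: "\<forall>i. reg (\<gamma> i)" and w: "bdd_supp_on (cbox lo hi) w" and v: "bdd_supp_on (cbox lo' hi') v" for B \<gamma> w v
        proof (rule osc_form_freeze_q[OF _ c box _ _ w])
          show "smooth (deriv_p c B ?h)" unfolding deriv_p_def by (rule smooth_wderiv[OF hs])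
          show "reg (\<gamma> i)" for i using \<gamma> by simp
          show "norm (deriv_q c A' (deriv_p c B ?h) (q, p, x)) \<le> D" if "\<forall>i. A' i \<le> 1" "q \<in> cbox lo hi" for A' q p
            by (rule bound[OF that(1) B A that(2) x])
          show "bdd_supp v" using v by (simp add: bdd_supp_on_def)
        qed
        show "?M \<ge> 0" using D by simp
      qed
      then show ?thesis by (simp add: osc_form_def frozen_def deriv_q'_def mult_ac)
    qed
    show "0 \<le> ?K" using \<kappa>P D by (simp add: L2_norm_nonneg)
  qed (use c f v box' in auto)
  also have "2 ^ CARD('n) * ?K * L2_norm lborel v
      = (2 ^ CARD('n) * (2 ^ CARD('n) * (2 * pi) ^ CARD('n))) * D * (\<Prod>i\<in>UNIV. \<kappa> i) * (L2_norm lborel w * L2_norm lborel v)"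
    by (simp only: mult_ac)
  also have "2 ^ CARD('n) * (2 ^ CARD('n) * (2 * pi) ^ CARD('n)) = (8 * pi) ^ CARD('n)"
    unfolding power_mult_distrib[symmetric] by (rule arg_cong[where f="\<lambda>x. x ^ CARD('n)"]) simp
  finally show ?thesis by (simp add: osc_form_def mult_ac)
qed

subsection \<open>Summation over boxes\<close>

text \<open>The constant makes the weight at least \<open>1\<close> for \<open>\<bar>d\<bar> \<le> 1\<close> and at least \<open>4 / (\<bar>d\<bar> - 1)\<^sup>2\<close> for \<open>\<bar>d\<bar> \<ge> 2\<close>.\<close>

definition schur_weight :: "int \<Rightarrow> real" where
  "schur_weight d = 20 / (1 + (of_int d)\<^sup>2)"

lemma schur_weight_pos: "schur_weight d > 0"
  by (simp add: schur_weight_def add_pos_nonneg)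

lemma schur_weight_sum_bounded: "\<exists>S>0. \<forall>F. finite F \<longrightarrow> (\<Sum>d\<in>F. schur_weight d) \<le> S"
proof -
  define f where "f n = 20 / (1 + (real n)\<^sup>2)" for n
  have f0: "f n \<ge> 0" for n by (simp add: f_def)
  have f: "summable f"
  proof (rule summable_comparison_test'[where N=1])
    show "summable (\<lambda>n. 20 * inverse ((real n)\<^sup>2))"
      by (intro summable_mult inverse_power_summable) simp
    show "norm (f n) \<le> 20 * inverse ((real n)\<^sup>2)" if "n \<ge> 1" for n
    proof -
      have "20 / (1 + (real n)\<^sup>2) \<le> 20 / (real n)\<^sup>2"
        using that by (intro divide_left_mono) (auto simp: add_pos_nonneg)
      then show ?thesis by (simp add: f_def divide_inverse)
    qed
  qed
  have part: "(\<Sum>d\<in>F. schur_weight d) \<le> suminf f" if "finite F" "inj_on (\<lambda>d. nat \<bar>d\<bar>) F" for F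
  proof -
    have "(\<Sum>d\<in>F. schur_weight d) = (\<Sum>n\<in>(\<lambda>d. nat \<bar>d\<bar>) ` F. f n)"
      by (subst sum.reindex[OF that(2)]) (auto simp: schur_weight_def f_def)
    also have "\<dots> \<le> suminf f" using f f0 that(1) by (intro sum_le_suminf) auto
    finally show ?thesis .
  qed
  have "(\<Sum>d\<in>F. schur_weight d) \<le> 2 * suminf f" if F: "finite F" for F
  proof -
    have "(\<Sum>d\<in>F. schur_weight d) = (\<Sum>d\<in>F \<inter> {0..}. schur_weight d) + (\<Sum>d\<in>F - {0..}. schur_weight d)"
      using F by (rule sum.Int_Diff)
    also have "\<dots> \<le> suminf f + suminf f"
      using F by (intro add_mono part) (auto simp: inj_on_def)
    finally show ?thesis by simp
  qed
  moreover have "suminf f \<ge> 0" using f f0 by (intro suminf_nonneg) auto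
  \<comment> \<open>The 2 accounts for the two signs of \<open>d\<close>; the \<open>+ 1\<close>
    makes the bound strictly positive.\<close>
  ultimately show ?thesis by (intro exI[of _ "2 * suminf f + 1"]) fastforce
qed

definition cut :: "'n::finite \<Rightarrow> real \<Rightarrow> int \<Rightarrow> ('n point \<Rightarrow> complex) \<Rightarrow> 'n point \<Rightarrow> complex" where
  "cut i h m w x = (if \<lfloor>x $ i / h\<rfloor> = m then w x else 0)"

lemma bdd_supp_cut:
  assumes "bdd_supp w"
  shows "bdd_supp (cut i h m w)"
proof -
  have "bdd_supp (\<lambda>x. (if \<lfloor>x $ i / h\<rfloor> = m then 1 else 0) * w x)"
    by (rule bdd_supp_mult[OF assms, where C=1]) auto
  moreover have "(\<lambda>x. (if \<lfloor>x $ i / h\<rfloor> = m then 1 else 0) * w x) = cut i h m w"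
    by (auto simp: cut_def)
  ultimately show ?thesis by simp
qed

lemma sum_cut: "finite J \<Longrightarrow> (w x \<noteq> 0 \<Longrightarrow> \<lfloor>x $ i / h\<rfloor> \<in> J) \<Longrightarrow> (\<Sum>m\<in>J. cut i h m w x) = w x"
  by (cases "w x = 0") (simp_all add: cut_def)

text \<open>The pieces live on disjoint slabs, so the squares of their moduli add up pointwise. This
  exact orthogonality is the benefit of sharp cut-offs.\<close>

lemma sum_L2_cut:
  assumes w: "bdd_supp w" and J: "finite J" "\<And>x. w x \<noteq> 0 \<Longrightarrow> \<lfloor>x $ i / h\<rfloor> \<in> J"
  shows "(\<Sum>m\<in>J. (L2_norm lborel (cut i h m w))\<^sup>2) = (L2_norm lborel w)\<^sup>2"
proof -
  have "(\<Sum>m\<in>J. (L2_norm lborel (cut i h m w))\<^sup>2) = (LINT x|lborel. (\<Sum>m\<in>J. (norm (cut i h m w x))\<^sup>2))"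
    unfolding L2_norm_sq by (rule Bochner_Integration.integral_sum[symmetric]) (intro bdd_supp_integrable_norm2 bdd_supp_cut w)
  also have "(\<lambda>x. \<Sum>m\<in>J. (norm (cut i h m w x))\<^sup>2) = (\<lambda>x. (norm (w x))\<^sup>2)"
  proof
    fix x
    have "(norm (cut i h m w x))\<^sup>2 = (if \<lfloor>x $ i / h\<rfloor> = m then (norm (w x))\<^sup>2 else 0)" for m
      by (simp add: cut_def)
    then show "(\<Sum>m\<in>J. (norm (cut i h m w x))\<^sup>2) = (norm (w x))\<^sup>2"
      using J by (cases "w x = 0") simp_all
  qed
  finally show ?thesis by (simp add: L2_norm_sq)
qed

text \<open>Schur's test: one square root of the weight goes to each factor before Cauchy-Schwarz.
  Rows and columns of the matrix are injective images of sets of differences, so both have sum at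
  most \<open>S\<close>.\<close>

lemma schur_sum:
  fixes \<alpha> \<beta> :: "int \<Rightarrow> real"
  assumes S: "\<And>F. finite F \<Longrightarrow> (\<Sum>d\<in>F. schur_weight d) \<le> S" and J: "finite J" "finite J'"
    and \<alpha>: "(\<Sum>m\<in>J. (\<alpha> m)\<^sup>2) = A\<^sup>2" and \<beta>: "(\<Sum>m\<in>J'. (\<beta> m)\<^sup>2) = B\<^sup>2" and AB: "A \<ge> 0" "B \<ge> 0"
  shows "(\<Sum>m\<in>J. \<Sum>m'\<in>J'. schur_weight (m - m') * (\<alpha> m * \<beta> m')) \<le> S * (A * B)"
proof -
  have S0: "S \<ge> 0" using S[of "{}"] by simp
  let ?s = "\<lambda>m m'. sqrt (schur_weight (m - m'))"
  have s2: "(?s m m')\<^sup>2 = schur_weight (m - m')" for m m' using schur_weight_pos[of "m - m'"] by simp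
  have s3: "(?s m m' * x) * (?s m m' * y) = schur_weight (m - m') * (x * y)" for m m' x y
  proof -
    have "(?s m m' * x) * (?s m m' * y) = (?s m m')\<^sup>2 * (x * y)" by (simp only: power2_eq_square mult_ac)
    then show ?thesis by (simp only: s2)
  qed
  have eq: "(\<Sum>m\<in>J. \<Sum>m'\<in>J'. schur_weight (m - m') * (\<alpha> m * \<beta> m')) = (\<Sum>z\<in>J \<times> J'. (?s (fst z) (snd z) * \<alpha> (fst z)) * (?s (fst z) (snd z) * \<beta> (snd z)))"
    unfolding sum.cartesian_product by (intro sum.cong refl) (auto simp: s3)
  have 1: "(\<Sum>z\<in>J \<times> J'. (?s (fst z) (snd z) * \<alpha> (fst z))\<^sup>2) \<le> S * A\<^sup>2"
  proof -
    have "(\<Sum>z\<in>J \<times> J'. (?s (fst z) (snd z) * \<alpha> (fst z))\<^sup>2) = (\<Sum>m\<in>J. \<Sum>m'\<in>J'. schur_weight (m - m') * (\<alpha> m)\<^sup>2)"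
      unfolding sum.cartesian_product by (intro sum.cong refl) (auto simp: power_mult_distrib s2)
    also have "\<dots> \<le> (\<Sum>m\<in>J. S * (\<alpha> m)\<^sup>2)"
    proof (rule sum_mono)
      fix m
      have "(\<Sum>m'\<in>J'. schur_weight (m - m')) = (\<Sum>d\<in>(\<lambda>m'. m - m') ` J'. schur_weight d)"
        by (subst sum.reindex) (auto simp: inj_on_def)
      also have "\<dots> \<le> S" using J by (intro S) simp
      finally show "(\<Sum>m'\<in>J'. schur_weight (m - m') * (\<alpha> m)\<^sup>2) \<le> S * (\<alpha> m)\<^sup>2"
        unfolding sum_distrib_right[symmetric] by (rule mult_right_mono) simp
    qed
    finally show ?thesis by (simp add: sum_distrib_left[symmetric] \<alpha>)
  qed
  have 2: "(\<Sum>z\<in>J \<times> J'. (?s (fst z) (snd z) * \<beta> (snd z))\<^sup>2) \<le> S * B\<^sup>2"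
  proof -
    have "(\<Sum>z\<in>J \<times> J'. (?s (fst z) (snd z) * \<beta> (snd z))\<^sup>2) = (\<Sum>m\<in>J. \<Sum>m'\<in>J'. schur_weight (m - m') * (\<beta> m')\<^sup>2)"
      unfolding sum.cartesian_product by (intro sum.cong refl) (auto simp: power_mult_distrib s2)
    also have "\<dots> = (\<Sum>m'\<in>J'. \<Sum>m\<in>J. schur_weight (m - m') * (\<beta> m')\<^sup>2)" by (rule sum.swap)
    also have "\<dots> \<le> (\<Sum>m'\<in>J'. S * (\<beta> m')\<^sup>2)"
    proof (rule sum_mono)
      fix m'
      have "(\<Sum>m\<in>J. schur_weight (m - m')) = (\<Sum>d\<in>(\<lambda>m. m - m') ` J. schur_weight d)"
        by (subst sum.reindex) (auto simp: inj_on_def)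
      also have "\<dots> \<le> S" using J by (intro S) simp
      finally show "(\<Sum>m\<in>J. schur_weight (m - m') * (\<beta> m')\<^sup>2) \<le> S * (\<beta> m')\<^sup>2"
        unfolding sum_distrib_right[symmetric] by (rule mult_right_mono) simp
    qed
    finally show ?thesis by (simp add: sum_distrib_left[symmetric] \<beta>)
  qed
  have "(\<Sum>m\<in>J. \<Sum>m'\<in>J'. schur_weight (m - m') * (\<alpha> m * \<beta> m'))\<^sup>2 \<le> (S * A\<^sup>2) * (S * B\<^sup>2)"
    unfolding eq by (rule order_trans[OF Cauchy_Schwarz_ineq_sum mult_mono[OF 1 2]]) (auto intro!: sum_nonneg mult_nonneg_nonneg S0)
  also have "\<dots> = (S * (A * B))\<^sup>2" by (simp add: power2_eq_square mult_ac)
  finally show ?thesis by (rule power2_le_imp_le) (use S0 AB in simp)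
qed

text \<open>Schur's test in a single coordinate, to be iterated. Bounded supports meet finitely many
  slabs, so no convergence question arises.\<close>

lemma slab_sum:
  fixes b :: "'n::finite amplitude"
  assumes S: "\<And>F. finite F \<Longrightarrow> (\<Sum>d\<in>F. schur_weight d) \<le> S"
    and b: "b \<in> borel_measurable borel" and \<Psi>: "integrable lborel (\<Psi> :: 'n point \<Rightarrow> real)"
    and bound: "\<And>q p q'. norm (b (q, p, q')) \<le> D * \<bar>\<Psi> p\<bar>"
    and w: "bdd_supp w" and v: "bdd_supp v" and K: "K \<ge> 0"
    and J: "finite J" "\<And>x. w x \<noteq> 0 \<Longrightarrow> \<lfloor>x $ i / h\<rfloor> \<in> J"
    and J': "finite J'" "\<And>x. v x \<noteq> 0 \<Longrightarrow> \<lfloor>x $ i / h\<rfloor> \<in> J'"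
    and form: "\<And>m m'. m \<in> J \<Longrightarrow> m' \<in> J' \<Longrightarrow> norm (osc_form b (cut i h m w) (cut i h m' v))
       \<le> K * schur_weight (m - m') * (L2_norm lborel (cut i h m w) * L2_norm lborel (cut i h m' v))"
  shows "norm (osc_form b w v) \<le> K * S * (L2_norm lborel w * L2_norm lborel v)"
proof -
  let ?I = "\<lambda>m m' \<omega>. b \<omega> * (osc \<omega> * (cut i h m w (fst \<omega>) * cut i h m' v (snd (snd \<omega>))))"
  have int: "integrable lborel (?I m m')" for m m'
    by (rule integrable_osc_form[OF b \<Psi> bdd_supp_integrable[OF bdd_supp_cut[OF w]] bdd_supp_integrable[OF bdd_supp_cut[OF v]] bound])
  have "b \<omega> * (osc \<omega> * (w (fst \<omega>) * v (snd (snd \<omega>)))) = (\<Sum>m\<in>J. \<Sum>m'\<in>J'. ?I m m' \<omega>)" for \<omega>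
    by (simp add: sum_distrib_left[symmetric] sum_distrib_right[symmetric] sum_cut[OF J] sum_cut[OF J'])
  then have "osc_form b w v = (\<Sum>m\<in>J. \<Sum>m'\<in>J'. osc_form b (cut i h m w) (cut i h m' v))"
    unfolding osc_form_def by (simp add: Bochner_Integration.integral_sum int)
  then have "norm (osc_form b w v) \<le> (\<Sum>m\<in>J. \<Sum>m'\<in>J'. norm (osc_form b (cut i h m w) (cut i h m' v)))"
    by (auto intro!: order_trans[OF norm_sum] sum_mono norm_sum)
  also have "\<dots> \<le> (\<Sum>m\<in>J. \<Sum>m'\<in>J'. K * (schur_weight (m - m') * (L2_norm lborel (cut i h m w) * L2_norm lborel (cut i h m' v))))"
    using form by (intro sum_mono) (simp add: mult_ac)
  also have "\<dots> = K * (\<Sum>m\<in>J. \<Sum>m'\<in>J'. schur_weight (m - m') * (L2_norm lborel (cut i h m w) * L2_norm lborel (cut i h m' v)))"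
    by (simp add: sum_distrib_left)
  also have "\<dots> \<le> K * (S * (L2_norm lborel w * L2_norm lborel v))"
    by (intro mult_left_mono K schur_sum[OF S J(1) J'(1)] sum_L2_cut w v J J' L2_norm_nonneg)
  finally show ?thesis by (simp add: mult_ac)
qed

lemma apart_slabs:
  fixes m m' :: "'n::{finite,linorder} \<Rightarrow> int"
  assumes c: "c > 0"
  shows "apart c (cbox (\<chi> i. of_int (m i) * wgt (inverse c) i) (\<chi> i. (of_int (m i) + 1) * wgt (inverse c) i))
    (cbox (\<chi> i. of_int (m' i) * wgt (inverse c) i) (\<chi> i. (of_int (m' i) + 1) * wgt (inverse c) i)) i (schur_weight (m i - m' i))"
proof -
  let ?h = "wgt (inverse c) i" and ?d = "real_of_int (m i - m' i)"
  have h: "?h > 0" using c by (simp add: wgt_pos)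
  \<comment> \<open>The scale in p is inverse to the side of the boxes: the scaled distance is a
    number of boxes, in which \<open>c\<close> no longer occurs.\<close>
  have wh: "wgt c i * (x * ?h) = x" for x using c by (simp add: wgt_def)
  have far: "4 / (e - 1)\<^sup>2 \<le> 20 / (1 + e\<^sup>2)" if "e \<ge> 2" for e :: real
  proof -
    \<comment> \<open>The difference 20 (e - 1)^2 - 4 (1 + e^2) is eight times this product. It
      vanishes at e = 2, which is where the constant 20 comes from.\<close>
    have "0 \<le> (2 * e - 1) * (e - 2)" using that by simp
    then have "4 * (1 + e\<^sup>2) \<le> 20 * (e - 1)\<^sup>2" by (simp add: power2_eq_square algebra_simps)
    then show ?thesis using that by (simp add: divide_simps mult_ac add_pos_nonneg)
  qed
  consider "\<bar>m i - m' i\<bar> \<le> 1" | "m i - m' i \<ge> 2" | "m' i - m i \<ge> 2" by linarith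
  then show ?thesis
  proof cases
    case 1
    then have "\<bar>?d\<bar> \<le> 1" by linarith
    then have "?d\<^sup>2 \<le> 1" by (simp add: abs_square_le_1)
    then have "1 \<le> schur_weight (m i - m' i)" by (simp add: schur_weight_def divide_simps add_pos_nonneg)
    then show ?thesis by (simp add: apart_def)
  next
    case 2
    then have d: "?d \<ge> 2" by linarith
    let ?a = "of_int (m i) * ?h" and ?a' = "(of_int (m' i) + 1) * ?h"
    have aa: "?a - ?a' = (?d - 1) * ?h" by (simp add: algebra_simps)
    have "?a' < ?a" using d h by simp
    moreover have "4 / (wgt c i * (?a - ?a'))\<^sup>2 \<le> schur_weight (m i - m' i)"
      unfolding aa wh schur_weight_def by (rule far[OF d])
    ultimately show ?thesis
      unfolding apart_def by (intro disjI2 exI[of _ 1] exI[of _ ?a] exI[of _ ?a']) (auto simp: mem_box_cart)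
  next
    case 3
    then have d: "- ?d \<ge> 2" by linarith
    let ?a = "- ((of_int (m i) + 1) * ?h)" and ?a' = "- (of_int (m' i) * ?h)"
    have aa: "?a - ?a' = (- ?d - 1) * ?h" by (simp add: algebra_simps)
    have "?a' < ?a" using d h by (simp add: mult_less_cancel_right)
    moreover have "4 / (wgt c i * (?a - ?a'))\<^sup>2 \<le> schur_weight (m i - m' i)"
      unfolding aa wh schur_weight_def using far[OF d] by (simp add: power2_commute)
    ultimately show ?thesis
      unfolding apart_def by (intro disjI2 exI[of _ "-1"] exI[of _ ?a] exI[of _ ?a']) (auto simp: mem_box_cart)
  qed
qed

lemma bounded_floor_finite:
  fixes w :: "'n::finite point \<Rightarrow> complex" and h :: real
  assumes "bdd_supp w" "h > 0"
  shows "finite ((\<lambda>x. \<lfloor>x $ i / h\<rfloor>) ` {x. w x \<noteq> 0})"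
proof -
  obtain R where R: "\<And>x. w x \<noteq> 0 \<Longrightarrow> norm x \<le> R" using assms by (auto simp: bdd_supp_def bounded_iff)
  have "\<lfloor>x $ i / h\<rfloor> \<in> {\<lfloor>- R / h\<rfloor>..\<lfloor>R / h\<rfloor>}" if "w x \<noteq> 0" for x
  proof -
    have "\<bar>x $ i\<bar> \<le> R" using R[OF that] component_le_norm_cart order_trans by blast
    then have "- R / h \<le> x $ i / h" "x $ i / h \<le> R / h"
      using assms(2) divide_right_mono[of "- R" "x $ i" h] divide_right_mono[of "x $ i" R h] by auto
    then show ?thesis by (simp add: floor_mono)
  qed
  then have "(\<lambda>x. \<lfloor>x $ i / h\<rfloor>) ` {x. w x \<noteq> 0} \<subseteq> {\<lfloor>- R / h\<rfloor>..\<lfloor>R / h\<rfloor>}"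
    by blast
  then show ?thesis by (rule finite_subset) simp
qed

text \<open>The radial slabs must be cut first, since the pair (j, k) determines the scale
  \<open>\<Lambda> j k\<close> of the angular grid. Each coordinate then contributes one factor
  \<open>S\<close>. The condition on \<epsilon> is imposed only for pairs of slabs that meet the
  supports.\<close>

lemma osc_form_estimate:
  fixes a :: "'n::{finite,linorder} amplitude"
  assumes S: "\<And>F. finite F \<Longrightarrow> (\<Sum>d\<in>F. schur_weight d) \<le> S"
    and a: "smooth a" and \<Lambda>: "\<And>j k. \<Lambda> j k > 0"
    and bound: "\<And>A B A' j k q p q'. (\<forall>i. A i \<le> 1) \<Longrightarrow> (\<forall>i. B i \<le> 2) \<Longrightarrow> (\<forall>i. A' i \<le> 1) \<Longrightarrow> (q, p, q') \<in> cell j k \<Longrightarrow>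
      norm (deriv_q (\<Lambda> j k) A (deriv_p (\<Lambda> j k) B (deriv_q' (\<Lambda> j k) A' a)) (q, p, q')) \<le> D"
    and \<epsilon>: "\<epsilon> > 0" "\<epsilon> \<le> 1"
    and w: "bdd_supp w" and v: "bdd_supp v"
    and \<epsilon>\<Lambda>: "\<And>x x'. w x \<noteq> 0 \<Longrightarrow> v x' \<noteq> 0 \<Longrightarrow> \<Lambda> \<lfloor>x $ radial\<rfloor> \<lfloor>x' $ radial\<rfloor> * \<epsilon> \<le> 1"
  shows "norm (osc_form (\<lambda>\<omega>. a \<omega> * of_real (tensor (\<lambda>_. gauss \<epsilon>) (fst (snd \<omega>)))) w v)
    \<le> (8 * pi) ^ CARD('n) * D * S ^ CARD('n) * (L2_norm lborel w * L2_norm lborel v)"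
proof -
  let ?b = "\<lambda>\<omega> :: 'n point \<times> 'n point \<times> 'n point. a \<omega> * of_real (tensor (\<lambda>_. gauss \<epsilon>) (fst (snd \<omega>)))"
  let ?C = "(8 * pi) ^ CARD('n) * D"
  have S0: "S \<ge> 0" using S[of "{}"] by simp
  note [measurable] = smooth_borel_measurable[OF a]
  have bm: "?b \<in> borel_measurable borel" by measurable
  have \<gamma>: "reg (gauss \<epsilon>)" by (rule reg_gauss[OF \<epsilon>(1)])
  have \<Psi>: "integrable lborel (tensor (\<lambda>_ :: 'n. gauss \<epsilon>))" by (rule tensor_reg_integrable) (rule \<gamma>)
  have aD: "norm (a (q, p, q')) \<le> D" for q p q'
  proof -
    have "(q, p, q') \<in> cell \<lfloor>q $ radial\<rfloor> \<lfloor>q' $ radial\<rfloor>"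
      unfolding cell_def by (simp, linarith)
    from bound[OF _ _ _ this, of "\<lambda>_. 0" "\<lambda>_. 0" "\<lambda>_. 0"] show ?thesis
      by (simp add: deriv_q_def deriv_p_def deriv_q'_def wderiv_0)
  qed
  have D: "D \<ge> 0" using aD[of 0 0 0] norm_ge_zero order_trans by blast
  have bb: "norm (?b (q, p, q')) \<le> D * \<bar>tensor (\<lambda>_. gauss \<epsilon>) p\<bar>" for q p q'
    using aD[of q p q'] by (simp add: norm_mult mult_right_mono)
  have C: "?C \<ge> 0" using D by simp
  \<comment> \<open>\<open>E\<close> holds the coordinates not yet cut; outside \<open>E\<close> the
    functions are confined to the slabs recorded in \<open>m\<close> and \<open>m'\<close>. As
    \<open>radial\<close> is never in \<open>E\<close>, the scale stays fixed during the
    induction.\<close>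
  have angular: "norm (osc_form ?b w v) \<le> ?C * S ^ card E * (\<Prod>i\<in>- E. schur_weight (m i - m' i)) * (L2_norm lborel w * L2_norm lborel v)"
    if c: "\<Lambda> (m radial) (m' radial) * \<epsilon> \<le> 1" and fin: "finite E" "radial \<notin> E" and w: "bdd_supp w" and v: "bdd_supp v"
      and mw: "\<And>x i. w x \<noteq> 0 \<Longrightarrow> i \<notin> E \<Longrightarrow> \<lfloor>x $ i / wgt (inverse (\<Lambda> (m radial) (m' radial))) i\<rfloor> = m i"
      and mv: "\<And>x i. v x \<noteq> 0 \<Longrightarrow> i \<notin> E \<Longrightarrow> \<lfloor>x $ i / wgt (inverse (\<Lambda> (m radial) (m' radial))) i\<rfloor> = m' i"
    for E m m' w v
    using fin(1) fin(2) c w v mw mv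
  proof (induction E arbitrary: m m' w v rule: finite_induct)
    case empty
    let ?c = "\<Lambda> (m radial) (m' radial)"
    have c: "?c > 0" by (rule \<Lambda>)
    let ?h = "wgt (inverse ?c) :: 'n \<Rightarrow> real"
    have h: "?h i > 0" for i using c by (simp add: wgt_pos)
    let ?lo = "\<lambda>m. (\<chi> i. of_int (m i) * ?h i) :: 'n point" and ?hi = "\<lambda>m. (\<chi> i. (of_int (m i) + 1) * ?h i) :: 'n point"
    have inbox: "x \<in> cbox (?lo m) (?hi m)" if "\<And>i. \<lfloor>x $ i / ?h i\<rfloor> = m i" for x :: "'n point" and m
    proof -
      have "of_int (m i) * ?h i \<le> x $ i \<and> x $ i \<le> (of_int (m i) + 1) * ?h i" for i
      proof -
        have "of_int (m i) \<le> x $ i / ?h i" "x $ i / ?h i \<le> of_int (m i) + 1"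
          using that[of i] by linarith+
        then show ?thesis using h[of i] by (simp add: pos_le_divide_eq pos_divide_le_eq)
      qed
      then show ?thesis by (simp add: mem_box_cart)
    qed
    \<comment> \<open>The radial side of a box is [j, j + 1], which lies within distance 1 of j, as
      membership in \<open>cell\<close> demands.\<close>
    have rad: "\<bar>x $ radial - of_int (m radial)\<bar> \<le> 1" if "x \<in> cbox (?lo m) (?hi m)" for x m
      using that by (auto simp: mem_box_cart wgt_def abs_le_iff dest!: spec[of _ radial])
    have "norm (osc_form ?b w v) \<le> (8 * pi) ^ CARD('n) * D * (\<Prod>i\<in>UNIV. schur_weight (m i - m' i)) * (L2_norm lborel w * L2_norm lborel v)"
    proof (rule box_estimate[where lo="?lo m" and hi="?hi m" and lo'="?lo m'" and hi'="?hi m'", OF a c \<epsilon> empty(2) _ _ apart_slabs[OF c]])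
      show "norm (deriv_q ?c A (deriv_p ?c B (deriv_q' ?c A' a)) (q, p, q')) \<le> D"
        if "\<forall>i. A i \<le> 1" "\<forall>i. B i \<le> 2" "\<forall>i. A' i \<le> 1" "q \<in> cbox (?lo m) (?hi m)" "q' \<in> cbox (?lo m') (?hi m')" for A B A' q p q'
        by (rule bound[OF that(1-3)]) (use rad[OF that(4)] rad[OF that(5)] in \<open>simp add: cell_def\<close>)
      show "bdd_supp_on (cbox (?lo m) (?hi m)) w" "bdd_supp_on (cbox (?lo m') (?hi m')) v"
        using empty by (auto simp: bdd_supp_on_def intro!: inbox)
    qed (auto simp: algebra_simps intro: less_imp_le schur_weight_pos)
    then show ?case by simp
  next
    case (insert i E)
    let ?c = "\<Lambda> (m radial) (m' radial)"
    let ?h = "wgt (inverse ?c) :: 'n \<Rightarrow> real"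
    have ir: "i \<noteq> radial" "radial \<notin> E" using insert.prems(1) by auto
    have h: "?h i > 0" using \<Lambda>[of "m radial" "m' radial"] by (simp add: wgt_pos)
    let ?J = "(\<lambda>x. \<lfloor>x $ i / ?h i\<rfloor>) ` {x. w x \<noteq> 0}" and ?J' = "(\<lambda>x. \<lfloor>x $ i / ?h i\<rfloor>) ` {x. v x \<noteq> 0}"
    let ?K = "?C * S ^ card E * (\<Prod>i\<in>- insert i E. schur_weight (m i - m' i))"
    have K: "?K \<ge> 0" by (intro mult_nonneg_nonneg C prod_nonneg) (use S0 in \<open>auto intro: less_imp_le schur_weight_pos\<close>)
    have "norm (osc_form ?b w v) \<le> ?K * S * (L2_norm lborel w * L2_norm lborel v)"
    proof (rule slab_sum[where i=i and h="?h i" and J="?J" and J'="?J'", OF S bm \<Psi> bb insert.prems(3,4) K])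
      show "finite ?J" "finite ?J'" by (intro bounded_floor_finite insert.prems(3,4) h)+
      fix k k'
      let ?w = "cut i (?h i) k w" and ?v = "cut i (?h i) k' v"
      let ?m = "m(i := k)" and ?m' = "m'(i := k')"
      have rr: "?m radial = m radial" "?m' radial = m' radial" using ir by auto
      have "norm (osc_form ?b ?w ?v) \<le> ?C * S ^ card E * (\<Prod>j\<in>- E. schur_weight (?m j - ?m' j)) * (L2_norm lborel ?w * L2_norm lborel ?v)"
      proof (rule insert.IH[of ?m ?m' ?w ?v, unfolded rr, OF ir(2) insert.prems(2)])
        show "bdd_supp ?w" "bdd_supp ?v" by (intro bdd_supp_cut insert.prems(3,4))+
        show "\<lfloor>x $ j / ?h j\<rfloor> = ?m j" if "?w x \<noteq> 0" "j \<notin> E" for x j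
          using that insert.prems(5)[of x j] by (auto simp: cut_def split: if_splits)
        show "\<lfloor>x $ j / ?h j\<rfloor> = ?m' j" if "?v x \<noteq> 0" "j \<notin> E" for x j
          using that insert.prems(6)[of x j] by (auto simp: cut_def split: if_splits)
      qed
      also have "(\<Prod>j\<in>- E. schur_weight (?m j - ?m' j)) = schur_weight (k - k') * (\<Prod>j\<in>- insert i E. schur_weight (m j - m' j))"
      proof -
        have "- E = insert i (- insert i E)" using insert.hyps by auto
        then have "(\<Prod>j\<in>- E. schur_weight (?m j - ?m' j)) = (\<Prod>j\<in>insert i (- insert i E). schur_weight (?m j - ?m' j))" by simp
        also have "\<dots> = schur_weight (k - k') * (\<Prod>j\<in>- insert i E. schur_weight (?m j - ?m' j))"
          by (subst prod.insert) auto
        also have "(\<Prod>j\<in>- insert i E. schur_weight (?m j - ?m' j)) = (\<Prod>j\<in>- insert i E. schur_weight (m j - m' j))"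
          by (intro prod.cong) auto
        finally show ?thesis .
      qed
      finally show "norm (osc_form ?b ?w ?v) \<le> ?K * schur_weight (k - k') * (L2_norm lborel ?w * L2_norm lborel ?v)"
        by (simp add: mult_ac)
    qed auto
    then show ?case using insert.hyps by (simp add: mult_ac)
  qed
  let ?r = "radial :: 'n"
  let ?J = "(\<lambda>x. \<lfloor>x $ ?r / 1\<rfloor>) ` {x. w x \<noteq> 0}" and ?J' = "(\<lambda>x. \<lfloor>x $ ?r / 1\<rfloor>) ` {x. v x \<noteq> 0}"
  let ?K = "?C * S ^ card (- {?r})"
  have "norm (osc_form ?b w v) \<le> ?K * S * (L2_norm lborel w * L2_norm lborel v)"
  proof (rule slab_sum[where i="?r" and h=1 and J="?J" and J'="?J'", OF S bm \<Psi> bb w v])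
    show "?K \<ge> 0" using C S0 by simp
    show "finite ?J" "finite ?J'" by (intro bounded_floor_finite w v zero_less_one)+
    fix j k assume jk: "j \<in> ?J" "k \<in> ?J'"
    let ?w = "cut ?r 1 j w" and ?v = "cut ?r 1 k v"
    have "\<Lambda> j k * \<epsilon> \<le> 1" using jk \<epsilon>\<Lambda> by auto
    \<comment> \<open>Only the values of \<open>m\<close> and \<open>m'\<close> at
      \<open>radial\<close> matter here, so constant functions will do.\<close>
    then have "norm (osc_form ?b ?w ?v) \<le> ?C * S ^ card (- {?r}) * (\<Prod>i\<in>- (- {?r}). schur_weight ((\<lambda>_. j) i - (\<lambda>_. k) i)) * (L2_norm lborel ?w * L2_norm lborel ?v)"
      by (intro angular[of "\<lambda>_. j" "\<lambda>_. k"] bdd_supp_cut w v) (auto simp: cut_def wgt_def split: if_splits)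
    then show "norm (osc_form ?b ?w ?v) \<le> ?K * schur_weight (j - k) * (L2_norm lborel ?w * L2_norm lborel ?v)"
      by simp
  qed auto
  moreover have "S ^ CARD('n) = S ^ card (- {?r}) * S"
  proof -
    have "CARD('n) = Suc (card (- {?r}))"
      using card.remove[of UNIV ?r] by (simp add: Compl_eq_Diff_UNIV)
    then show ?thesis by simp
  qed
  ultimately show ?thesis by (simp add: mult_ac)
qed

subsection \<open>The operator\<close>

lemma jbr_powr_0: "jbr p powr (- 0 + 0 * x) = 1" "jbr p powr (0 - 0 * x) = 1"
proof -
  have "jbr p > 0" unfolding jbr_def by (simp add: add_pos_nonneg)
  then show "jbr p powr (- 0 + 0 * x) = 1" "jbr p powr (0 - 0 * x) = 1" by simp_all
qed

lemma cell_nonempty: "(\<chi> i. of_int j, 0, \<chi> i. of_int k) \<in> cell j k"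
  by (simp add: cell_def)

lemma mi_size_le: "(\<And>i. A i \<le> m) \<Longrightarrow> mi_size A \<le> CARD('n) * m" for A :: "'n::finite multiindex"
  unfolding mi_size_def using sum_bounded_above[of UNIV A m] by simp

text \<open>Membership in \<open>BS\<close> bounds the sets whose suprema are taken, so that each
  supremum is an upper bound; nonempty cells make the summands nonnegative, so that a single one is
  below the sum.\<close>

lemma BS_seminorm_bound:
  fixes a :: "'n::{finite,linorder} amplitude"
  assumes a: "a \<in> BS lam 0 0 t" and size: "mi_size A + mi_size B + mi_size A' \<le> M" and z: "z \<in> cell j k"
  shows "norm (deriv_q (lam_t lam t j k) A (deriv_p (lam_t lam t j k) B (deriv_q' (lam_t lam t j k) A' a)) z)
    \<le> BS_seminorm lam M 0 0 t a"
proof -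
  define F where "F A B A' j k z = norm (deriv_q (lam_t lam t j k) A (deriv_p (lam_t lam t j k) B (deriv_q' (lam_t lam t j k) A' a)) z)"
    for A B A' j k z
  define G where "G = (\<lambda>(A, B, A'). SUP (j, k)\<in>UNIV. SUP z\<in>cell j k. F A B A' j k z)"
  have eq: "BS_seminorm lam M 0 0 t a = (\<Sum>T\<in>{(A, B, A'). mi_size A + mi_size B + mi_size A' \<le> M}. G T)"
    unfolding BS_seminorm_def G_def F_def jbr_powr_0 by (simp add: split_beta)
  have le: "F A B A' j k z \<le> G (A, B, A')" if z: "z \<in> cell j k" for A B A' j k z
  proof -
    obtain C where C: "\<And>j k z. z \<in> cell j k \<Longrightarrow> F A B A' j k z \<le> C"
    proof -
      have "\<exists>C>0. \<forall>j k. \<forall>(q, p, q')\<in>cell j k. F A B A' j k (q, p, q') \<le> C"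
        using a unfolding BS_def jbr_powr_0 F_def by simp
      then show ?thesis using that by fast
    qed
    have inner: "F A B A' j k z \<le> (SUP z\<in>cell j k. F A B A' j k z)" if "z \<in> cell j k" for j k z
      using that C by (intro cSUP_upper bdd_aboveI2[where M=C])
    have "(SUP z\<in>cell j k. F A B A' j k z) \<le> C" for j k
      using C cell_nonempty[of j k] by (intro cSUP_least) auto
    then have "(SUP z\<in>cell j k. F A B A' j k z) \<le> (SUP y\<in>UNIV. (\<lambda>(j, k). SUP z\<in>cell j k. F A B A' j k z) y)"
      using cSUP_upper[of "(j, k)" UNIV "\<lambda>(j, k). SUP z\<in>cell j k. F A B A' j k z"]
        bdd_aboveI2[of UNIV "\<lambda>(j, k). SUP z\<in>cell j k. F A B A' j k z" C] by auto
    then show ?thesis using inner[OF z] by (simp add: G_def)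
  qed
  have G0: "0 \<le> G T" for T
  proof (cases T)
    case (fields A B A')
    show ?thesis unfolding fields by (rule order_trans[OF _ le[OF cell_nonempty[of 0 0]]]) (simp add: F_def)
  qed
  have "F A B A' j k z \<le> G (A, B, A')" by (rule le[OF z])
  also have "\<dots> \<le> (\<Sum>T\<in>{(A, B, A'). mi_size A + mi_size B + mi_size A' \<le> M}. G T)"
    using size by (intro member_le_sum G0 finite_multiindex_triples) auto
  finally show ?thesis unfolding eq F_def .
qed

text \<open>
  Fatou's lemma along a Gaussian regularization suffices: should the integral over \<open>p\<close> fail to converge
  at some \<open>q\<close>, the Bochner integral is \<open>0\<close> there, which is also below the lower limit.
\<close>

lemma L2_bound_of_forms:
  fixes a :: "'n::{finite,linorder} amplitude"
  assumes a: "a \<in> borel_measurable borel" and aD: "\<And>q p q'. norm (a (q, p, q')) \<le> D"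
    and \<Lambda>: "\<And>j k. \<Lambda> j k > 0" and v: "bdd_supp v" and K: "K \<ge> 0"
    and form: "\<And>\<epsilon> w. \<epsilon> > 0 \<Longrightarrow> \<epsilon> \<le> 1 \<Longrightarrow> bdd_supp w \<Longrightarrow>
      (\<And>x x'. w x \<noteq> 0 \<Longrightarrow> v x' \<noteq> 0 \<Longrightarrow> \<Lambda> \<lfloor>x $ radial\<rfloor> \<lfloor>x' $ radial\<rfloor> * \<epsilon> \<le> 1) \<Longrightarrow>
      norm (osc_form (\<lambda>\<omega>. a \<omega> * of_real (tensor (\<lambda>_. gauss \<epsilon>) (fst (snd \<omega>)))) w v) \<le> K * (L2_norm lborel w * L2_norm lborel v)"
  defines "T \<equiv> \<lambda>q. LINT p|lborel. LINT q'|lborel. a (q, p, q') * (cis (p \<bullet> (q - q')) * v q')"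
  shows "T \<in> borel_measurable borel"
    and "(\<integral>\<^sup>+q. ennreal ((norm (T q))\<^sup>2) \<partial>lborel) \<le> ennreal ((K * L2_norm lborel v)\<^sup>2)"
proof -
  note [measurable] = a bdd_supp_measurable[OF v]
  have [measurable]: "(\<lambda>z :: (('n point \<times> 'n point) \<times> 'n point). a (fst (fst z), snd (fst z), snd z)) \<in> borel_measurable borel"
    by (rule measurable_compose[OF borel_measurable_continuous_onI a]) (intro continuous_intros)
  let ?G = "\<lambda>q p. LINT q'|lborel. a (q, p, q') * (cis (p \<bullet> (q - q')) * v q')"
  have Gm: "(\<lambda>z :: 'n point \<times> 'n point. ?G (fst z) (snd z)) \<in> borel_measurable borel"
  proof -
    have "(\<lambda>z :: ('n point \<times> 'n point) \<times> 'n point. a (fst (fst z), snd (fst z), snd z) * (cis (snd (fst z) \<bullet> (fst (fst z) - snd z)) * v (snd z))) \<in> borel_measurable borel"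
      by measurable
    then have "case_prod (\<lambda>(y :: 'n point \<times> 'n point) q'. a (fst y, snd y, q') * (cis (snd y \<bullet> (fst y - q')) * v q')) \<in> borel_measurable (borel \<Otimes>\<^sub>M lborel)"
      by (subst measurable_borel_pair_lborel) (simp add: split_beta)
    from lborel.borel_measurable_lebesgue_integral[OF this] show ?thesis .
  qed
  have param: "(\<lambda>q. LINT p|lborel. f q p) \<in> borel_measurable borel"
    if "(\<lambda>z. f (fst z) (snd z)) \<in> borel_measurable borel" for f :: "'n point \<Rightarrow> 'n point \<Rightarrow> complex"
  proof -
    have "case_prod f \<in> borel_measurable (borel \<Otimes>\<^sub>M lborel)"
      using that by - (subst measurable_borel_pair_lborel, simp add: split_beta)
    from lborel.borel_measurable_lebesgue_integral[OF this] show ?thesis .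
  qed
  show T[measurable]: "T \<in> borel_measurable borel"
    unfolding T_def by (rule param[OF Gm])
  obtain R where R: "\<And>x. v x \<noteq> 0 \<Longrightarrow> norm x \<le> R" using v by (auto simp: bdd_supp_def bounded_iff)
  define J where "J r = {\<lfloor>- r\<rfloor>..\<lfloor>r\<rfloor>}" for r :: real
  have J: "\<lfloor>x $ radial\<rfloor> \<in> J r" if "norm x \<le> r" for x :: "'n point" and r
  proof -
    have "\<bar>x $ radial\<bar> \<le> r" using component_le_norm_cart[of x radial] that by linarith
    then have "- r \<le> x $ radial" "x $ radial \<le> r" by linarith+
    then show ?thesis by (simp add: J_def floor_mono)
  qed
  \<comment> \<open>The sum is a crude upper bound for \<open>\<Lambda>\<close> over the finitely
    many pairs of slabs that meet the ball of radius n and the support of \<open>v\<close>. Put into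
    the denominator of \<open>e n\<close>, it ensures the condition on \<epsilon>, while the term
    \<open>Suc n\<close> sends \<open>e n\<close> to 0.\<close>
  define Z where "Z n = (\<Sum>y\<in>J (real n) \<times> J R. \<Lambda> (fst y) (snd y))" for n
  define e where "e n = 1 / (real (Suc n) + Z n)" for n
  have Z0: "Z n \<ge> 0" for n unfolding Z_def by (intro sum_nonneg less_imp_le[OF \<Lambda>])
  have e: "e n > 0" "e n \<le> 1" "e n \<le> 1 / real (Suc n)" for n
    using Z0[of n] by (auto simp: e_def divide_simps)
  have e_lim: "e \<longlonglongrightarrow> 0"
  proof (rule tendsto_sandwich[OF _ _ tendsto_const])
    show "(\<lambda>n. 1 / real (Suc n)) \<longlonglongrightarrow> 0" by (rule LIMSEQ_Suc[OF lim_1_over_n])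
  qed (use e in \<open>auto intro!: always_eventually less_imp_le\<close>)
  have e\<Lambda>: "\<Lambda> j k * e n \<le> 1" if "j \<in> J (real n)" "k \<in> J R" for j k n
  proof -
    have "\<Lambda> j k \<le> Z n"
      unfolding Z_def using that \<Lambda> by (intro member_le_sum[of "(j, k)" _ "\<lambda>y. \<Lambda> (fst y) (snd y)", simplified]) (auto simp: J_def intro: less_imp_le)
    then show ?thesis using Z0[of n] by (simp add: e_def divide_simps)
  qed
  define Tn where "Tn n q = (LINT p|lborel. of_real (tensor (\<lambda>_. gauss (e n)) p) * ?G q p)" for n q
  have Tnm[measurable]: "Tn n \<in> borel_measurable borel" for n
    unfolding Tn_def by (rule param) (use Gm in measurable)
  define V where "V = (LINT x|lborel. norm (v x))"
  have D: "D \<ge> 0" using aD[of 0 0 0] norm_ge_zero order_trans by blast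
  have Gb: "norm (?G q p) \<le> D * V" for q p
  proof -
    have "norm (?G q p) \<le> (LINT x|lborel. D * norm (v x))"
      by (rule norm_integral_le[OF integrable_mult_right[OF integrable_norm[OF bdd_supp_integrable[OF v]]]])
        (use aD in \<open>simp add: norm_mult mult_right_mono\<close>)
    then show ?thesis by (simp add: V_def)
  qed
  have \<gamma>: "reg (gauss (e n))" for n by (rule reg_gauss[OF e(1)])
  have ti: "integrable lborel (tensor (\<lambda>_. gauss (e n)) :: 'n point \<Rightarrow> real)" for n
    by (rule tensor_reg_integrable) (rule \<gamma>)
  have t0: "tensor (\<lambda>_ :: 'n. gauss (e n)) p \<ge> 0" for n p
    unfolding tensor_def by (intro prod_nonneg ballI less_imp_le[OF gauss_pos])
  have Tnb: "norm (Tn n q) \<le> (LINT p|lborel. tensor (\<lambda>_ :: 'n. gauss (e n)) p * (D * V))" for n q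
    unfolding Tn_def
    by (rule norm_integral_le[OF integrable_mult_left[OF ti]])
      (use Gb t0 in \<open>simp add: norm_mult mult_left_mono\<close>)
  \<comment> \<open>The regularised output is tested against its own conjugate, truncated to a ball:
    the form then equals the square of the L^2 norm of \<open>w n\<close>, and one factor of that
    norm can be divided out.\<close>
  define w where "w n q = indicator (ball 0 (real n)) q *\<^sub>R cnj (Tn n q)" for n and q :: "'n point"
  have w: "bdd_supp (w n)" for n
    unfolding bdd_supp_def
  proof (intro conjI exI allI)
    show "w n \<in> borel_measurable borel" unfolding w_def
      by (intro borel_measurable_scaleR borel_measurable_cnj Tnm borel_measurable_indicator) simp
    show "norm (w n q) \<le> \<bar>LINT p|lborel. tensor (\<lambda>_ :: 'n. gauss (e n)) p * (D * V)\<bar>" for q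
      using order_trans[OF Tnb[of n q] abs_ge_self] by (simp add: w_def indicator_def norm_mult)
    show "bounded {q. w n q \<noteq> 0}"
      by (rule bounded_subset[OF bounded_ball[of 0 "real n"]]) (auto simp: w_def indicator_def)
  qed
  have wL2: "L2_norm lborel (w n) \<le> K * L2_norm lborel v" for n
  proof -
    let ?b = "\<lambda>\<omega> :: 'n point \<times> 'n point \<times> 'n point. a \<omega> * of_real (tensor (\<lambda>_. gauss (e n)) (fst (snd \<omega>)))"
    have int: "integrable lborel (\<lambda>\<omega>. ?b \<omega> * (osc \<omega> * (w n (fst \<omega>) * v (snd (snd \<omega>)))))"
    proof (rule integrable_osc_form[OF _ ti bdd_supp_integrable[OF w] bdd_supp_integrable[OF v]])
      show "?b \<in> borel_measurable borel" by measurable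
      show "norm (?b (q, p, q')) \<le> D * \<bar>tensor (\<lambda>_. gauss (e n)) p\<bar>" for q p q'
        using aD[of q p q'] by (simp add: norm_mult mult_right_mono)
    qed
    have inner: "(LINT z|lborel. ?b (q, z) * (osc (q, z) * (w n q * v (snd z)))) = w n q * Tn n q"
      if i: "integrable lborel (\<lambda>z. ?b (q, z) * (osc (q, z) * (w n q * v (snd z))))" for q
    proof -
      have "(LINT z|lborel. ?b (q, z) * (osc (q, z) * (w n q * v (snd z))))
        = (LINT p|lborel. LINT q'|lborel. ?b (q, p, q') * (osc (q, p, q') * (w n q * v q')))"
        using lborel_fubini(1)[OF i] by simp
      also have "\<dots> = (LINT p|lborel. LINT q'|lborel. w n q * (of_real (tensor (\<lambda>_. gauss (e n)) p) * (a (q, p, q') * (cis (p \<bullet> (q - q')) * v q'))))"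
        by (simp add: osc_def mult_ac)
      finally show ?thesis
        unfolding Bochner_Integration.integral_mult_right_zero Tn_def .
    qed
    have AEi: "AE q in lborel. integrable lborel (\<lambda>z. ?b (q, z) * (osc (q, z) * (w n q * v (snd z))))"
      using lborel_pair.AE_integrable_fst'[of "\<lambda>\<omega>. ?b \<omega> * (osc \<omega> * (w n (fst \<omega>) * v (snd (snd \<omega>))))"] int
      by (simp add: lborel_prod)
    have "osc_form ?b (w n) v = (LINT q|lborel. LINT z|lborel. ?b (q, z) * (osc (q, z) * (w n q * v (snd z))))"
      unfolding osc_form_def lborel_fubini(1)[OF int] by simp
    also have "\<dots> = (LINT q|lborel. of_real ((norm (w n q))\<^sup>2))"
    proof (rule integral_cong_AE)
      show "(\<lambda>q. LINT z|lborel. ?b (q, z) * (osc (q, z) * (w n q * v (snd z)))) \<in> borel_measurable lborel"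
        using borel_measurable_integrable[OF lborel_fubini(4)[OF int]] by simp
      show "(\<lambda>q. complex_of_real ((norm (w n q))\<^sup>2)) \<in> borel_measurable lborel"
        using bdd_supp_measurable[OF w[of n]] by measurable
      show "AE q in lborel. (LINT z|lborel. ?b (q, z) * (osc (q, z) * (w n q * v (snd z)))) = of_real ((norm (w n q))\<^sup>2)"
        using AEi
      proof eventually_elim
        case (elim q)
        have "w n q * Tn n q = of_real ((norm (w n q))\<^sup>2)"
          unfolding complex_norm_square by (simp add: w_def indicator_def)
        then show ?case using inner[OF elim] by simp
      qed
    qed
    also have "\<dots> = of_real ((L2_norm lborel (w n))\<^sup>2)"
      by (simp only: L2_norm_sq integral_complex_of_real)
    finally have "(L2_norm lborel (w n))\<^sup>2 = norm (osc_form ?b (w n) v)"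
      by (simp only: norm_of_real) simp
    also have "\<dots> \<le> K * (L2_norm lborel (w n) * L2_norm lborel v)"
    proof (rule form[OF e(1) e(2) w])
      fix x x' assume "w n x \<noteq> 0" "v x' \<noteq> 0"
      then have "norm x \<le> real n" "norm x' \<le> R" by (auto simp: w_def indicator_def R split: if_splits)
      then show "\<Lambda> \<lfloor>x $ radial\<rfloor> \<lfloor>x' $ radial\<rfloor> * e n \<le> 1" by (intro e\<Lambda> J)
    qed
    finally have *: "L2_norm lborel (w n) * L2_norm lborel (w n) \<le> (K * L2_norm lborel v) * L2_norm lborel (w n)"
      by (simp add: power2_eq_square mult_ac)
    show ?thesis
    proof (cases "L2_norm lborel (w n) = 0")
      case True
      then show ?thesis using K by (simp add: L2_norm_nonneg)
    next
      case False
      then have "L2_norm lborel (w n) > 0" using L2_norm_nonneg[of lborel "w n"] by linarith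
      with * show ?thesis by (simp add: mult_le_cancel_right)
    qed
  qed
  have wn: "(\<integral>\<^sup>+q. ennreal ((norm (w n q))\<^sup>2) \<partial>lborel) \<le> ennreal ((K * L2_norm lborel v)\<^sup>2)" for n
    unfolding nn_integral_eq_integral[OF bdd_supp_integrable_norm2[OF w] AE_I2[OF zero_le_power2]] L2_norm_sq[symmetric]
    by (intro ennreal_leI power_mono wL2 L2_norm_nonneg)
  have lim: "ennreal ((norm (T q))\<^sup>2) \<le> liminf (\<lambda>n. ennreal ((norm (w n q))\<^sup>2))" for q
  proof (cases "integrable lborel (?G q)")
    case False
    then show ?thesis by (simp add: T_def not_integrable_integral_eq)
  next
    case True
    note [measurable] = borel_measurable_integrable[OF True, simplified]
    have "(\<lambda>n. Tn n q) \<longlonglongrightarrow> T q"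
      unfolding Tn_def T_def
    proof (rule integral_dominated_convergence[where w="\<lambda>p. norm (?G q p)"])
      show "AE p in lborel. (\<lambda>n. of_real (tensor (\<lambda>_. gauss (e n)) p) * ?G q p) \<longlonglongrightarrow> ?G q p"
        using tendsto_tensor_gauss[OF e_lim] by (intro AE_I2) (auto intro!: tendsto_eq_intros)
      show "AE p in lborel. norm (of_real (tensor (\<lambda>_. gauss (e n)) p) * ?G q p) \<le> norm (?G q p)" for n
      proof (rule AE_I2)
        fix p :: "'n point"
        have "\<bar>tensor (\<lambda>_. gauss (e n)) p\<bar> \<le> 1" by (rule abs_tensor_le_1) (rule \<gamma>)
        from mult_right_mono[OF this, of "norm (?G q p)"]
        show "norm (of_real (tensor (\<lambda>_. gauss (e n)) p) * ?G q p) \<le> norm (?G q p)" by (simp add: norm_mult)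
      qed
    qed (use True in \<open>auto intro: integrable_norm\<close>)
    then have "(\<lambda>n. ennreal ((norm (Tn n q))\<^sup>2)) \<longlonglongrightarrow> ennreal ((norm (T q))\<^sup>2)"
      by (intro tendsto_ennrealI tendsto_intros)
    moreover have "\<forall>\<^sub>F n in sequentially. ennreal ((norm (Tn n q))\<^sup>2) = ennreal ((norm (w n q))\<^sup>2)"
    proof -
      have "\<forall>\<^sub>F n in sequentially. norm q < real n"
        using filterlim_real_sequentially by (auto simp: filterlim_at_top_dense)
      then show ?thesis by eventually_elim (simp add: w_def indicator_def)
    qed
    ultimately have "(\<lambda>n. ennreal ((norm (w n q))\<^sup>2)) \<longlonglongrightarrow> ennreal ((norm (T q))\<^sup>2)"
      by (rule Lim_transform_eventually)
    from lim_imp_Liminf[OF sequentially_bot this] show ?thesis by (simp only: order_refl)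
  qed
  have "(\<integral>\<^sup>+q. ennreal ((norm (T q))\<^sup>2) \<partial>lborel) \<le> (\<integral>\<^sup>+q. liminf (\<lambda>n. ennreal ((norm (w n q))\<^sup>2)) \<partial>lborel)"
    by (intro nn_integral_mono lim)
  also have "\<dots> \<le> liminf (\<lambda>n. \<integral>\<^sup>+q. ennreal ((norm (w n q))\<^sup>2) \<partial>lborel)"
    by (rule nn_integral_liminf) (use bdd_supp_measurable[OF w] in measurable)
  also have "\<dots> \<le> ennreal ((K * L2_norm lborel v)\<^sup>2)"
    by (intro Liminf_le always_eventually allI wn) simp_all
  finally show "(\<integral>\<^sup>+q. ennreal ((norm (T q))\<^sup>2) \<partial>lborel) \<le> ennreal ((K * L2_norm lborel v)\<^sup>2)" .
qed

theorem theorem2p6: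
  fixes g :: "real ^ 'n::{finite,linorder} \<Rightarrow> real"
    and lam :: "real \<Rightarrow> real"
  assumes "smooth g"
    and "\<And>q. g q > 0"
    and "\<And>r. lam r > 0"
    and "\<exists>C\<^sub>0>0. \<forall>r r'. \<bar>r - r'\<bar> \<le> 1 \<longrightarrow>
           inverse C\<^sub>0 \<le> lam r / lam r' \<and> lam r / lam r' \<le> C\<^sub>0"
  shows "\<exists>C>0. \<exists>M. \<forall>t\<in>{0..1}. \<forall>a\<in>BS lam 0 0 t. \<forall>u. test_function u \<longrightarrow>
           in_L2 (weighted g) (Op g a u) \<and>
           L2_norm (weighted g) (Op g a u)
             \<le> C * BS_seminorm lam M 0 0 t a * L2_norm (weighted g) u"
proof -
  obtain S where S: "S > 0" "\<And>F. finite F \<Longrightarrow> (\<Sum>d\<in>F. schur_weight d) \<le> S" using schur_weight_sum_bounded by blast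
  define c0 where "c0 = (2 * pi) powr (- real CARD('n))"
  define C where "C = (8 * pi) ^ CARD('n) * S ^ CARD('n)"
  \<comment> \<open>At most one derivative in each coordinate of q and of q', and at most two in
    each coordinate of p.\<close>
  define M where "M = 4 * CARD('n)"
  have C: "C > 0" and c0: "c0 > 0" using S by (auto simp: C_def c0_def)
  note gpos = assms(2) and lpos = assms(3)
  note [measurable] = smooth_borel_measurable[OF assms(1)]
  have est: "in_L2 (weighted g) (Op g a u) \<and>
      L2_norm (weighted g) (Op g a u) \<le> c0 * C * BS_seminorm lam M 0 0 t a * L2_norm (weighted g) u"
    if a: "a \<in> BS lam 0 0 t" and u: "test_function u" for t and a :: "'n amplitude" and u :: "'n point \<Rightarrow> complex"
  proof -
    let ?D = "BS_seminorm lam M 0 0 t a"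
    have sa: "smooth a" using a by (simp add: BS_def)
    have bound: "norm (deriv_q (lam_t lam t j k) A (deriv_p (lam_t lam t j k) B (deriv_q' (lam_t lam t j k) A' a)) (q, p, q')) \<le> ?D"
      if "\<forall>i. A i \<le> 1" "\<forall>i. B i \<le> 2" "\<forall>i. A' i \<le> 1" "(q, p, q') \<in> cell j k" for A B A' j k q p q'
    proof (rule BS_seminorm_bound[OF a _ that(4)])
      show "mi_size A + mi_size B + mi_size A' \<le> M"
        using mi_size_le[of A 1] mi_size_le[of B 2] mi_size_le[of A' 1] that by (simp add: M_def)
    qed
    have aD: "norm (a (q, p, q')) \<le> ?D" for q p q'
    proof -
      have "(q, p, q') \<in> cell \<lfloor>q $ radial\<rfloor> \<lfloor>q' $ radial\<rfloor>"
        unfolding cell_def by (simp, linarith)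
      from bound[OF _ _ _ this, of "\<lambda>_. 0" "\<lambda>_. 0" "\<lambda>_. 0"] show ?thesis
        by (simp add: deriv_q_def deriv_p_def deriv_q'_def wderiv_0)
    qed
    have D: "?D \<ge> 0" using aD[of 0 0 0] norm_ge_zero order_trans by blast
    \<comment> \<open>The L^2 norm of \<open>v\<close> is the weighted norm of \<open>u\<close>; on
      the other side the prefactor g^(-1/4) of the operator cancels the density of the
      measure.\<close>
    define v where "v q = of_real (g q powr (1 / 4)) * u q" for q
    have v: "bdd_supp v"
    proof -
      let ?B = "closure {x. u x \<noteq> 0}"
      have B: "compact ?B" and su: "smooth u" using u by (auto simp: test_function_def)
      have sub: "{x. u x \<noteq> 0} \<subseteq> ?B" by (rule closure_subset)
      have "bounded (u ` ?B)" by (intro compact_imp_bounded compact_continuous_image smooth_continuous su B)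
      then obtain c where c: "\<And>x. x \<in> ?B \<Longrightarrow> norm (u x) \<le> c" by (auto simp: bounded_iff)
      have "norm (u x) \<le> max c 0" for x using c[of x] sub by (cases "u x = 0") auto
      then have "bdd_supp u"
        unfolding bdd_supp_def using smooth_borel_measurable[OF su] bounded_subset[OF compact_imp_bounded[OF B] sub] by blast
      moreover have "continuous_on ?B (\<lambda>q. g q powr (1 / 4))"
        using gpos by (intro continuous_on_powr' smooth_continuous[OF assms(1)] continuous_on_const) (auto intro: less_imp_le)
      then have "bounded ((\<lambda>q. g q powr (1 / 4)) ` ?B)" by (intro compact_imp_bounded compact_continuous_image B)
      then obtain c' where "\<And>x. x \<in> ?B \<Longrightarrow> norm (g x powr (1 / 4)) \<le> c'" by (auto simp: bounded_iff)
      ultimately show ?thesis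
        unfolding v_def using sub by (intro bdd_supp_mult[where C=c']) auto
    qed
    define T where "T q = (LINT p|lborel. LINT q'|lborel. a (q, p, q') * (cis (p \<bullet> (q - q')) * v q'))" for q
    have lp: "lam_t lam t j k > 0" for j k by (simp add: lam_t_def lpos)
    have K: "C * ?D \<ge> 0" using C D by simp
    have forms: "norm (osc_form (\<lambda>\<omega>. a \<omega> * of_real (tensor (\<lambda>_. gauss \<epsilon>) (fst (snd \<omega>)))) w v) \<le> C * ?D * (L2_norm lborel w * L2_norm lborel v)"
      if "\<epsilon> > 0" "\<epsilon> \<le> 1" "bdd_supp w"
        "\<And>x x'. w x \<noteq> 0 \<Longrightarrow> v x' \<noteq> 0 \<Longrightarrow> lam_t lam t \<lfloor>x $ radial\<rfloor> \<lfloor>x' $ radial\<rfloor> * \<epsilon> \<le> 1" for \<epsilon> w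
    proof -
      have "norm (osc_form (\<lambda>\<omega>. a \<omega> * of_real (tensor (\<lambda>_. gauss \<epsilon>) (fst (snd \<omega>)))) w v)
          \<le> (8 * pi) ^ CARD('n) * ?D * S ^ CARD('n) * (L2_norm lborel w * L2_norm lborel v)"
        by (rule osc_form_estimate[where \<Lambda>="lam_t lam t", OF S(2) sa lp bound that(1-3) v that(4)])
      then show ?thesis by (simp only: C_def mult_ac)
    qed
    note Tb = L2_bound_of_forms[where \<Lambda>="lam_t lam t", OF smooth_borel_measurable[OF sa] aD lp v K forms, folded T_def]
    have [measurable]: "T \<in> borel_measurable borel" by (rule Tb(1))
    have Tn: "(\<integral>\<^sup>+q. ennreal ((norm (T q))\<^sup>2) \<partial>lborel) \<le> ennreal ((C * ?D * L2_norm lborel v)\<^sup>2)"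
      by (rule Tb(2))
    have Op: "Op g a u q = of_real (c0 * g q powr (- 1 / 4)) * T q" for q
      by (simp add: Op_def c0_def T_def v_def cis_conv_exp mult_ac)
    have p4: "(g q powr (1 / 4))\<^sup>2 = g q powr (1 / 2)" "(g q powr (- 1 / 4))\<^sup>2 * g q powr (1 / 2) = 1" for q
      using gpos[of q] by (simp_all add: power2_eq_square powr_add[symmetric])
    have Opm: "Op g a u \<in> borel_measurable borel" unfolding Op[abs_def] by measurable
    \<comment> \<open>The norm is computed as a nonnegative integral, because square integrability
      of \<open>Op g a u\<close> is itself a conclusion.\<close>
    have "(\<integral>\<^sup>+q. ennreal ((norm (Op g a u q))\<^sup>2) \<partial>weighted g) = (\<integral>\<^sup>+q. ennreal (c0\<^sup>2 * (norm (T q))\<^sup>2) \<partial>lborel)"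
      unfolding weighted_def
    proof (subst nn_integral_density)
      show "(\<integral>\<^sup>+q. ennreal (g q powr (1 / 2)) * ennreal ((norm (Op g a u q))\<^sup>2) \<partial>lborel) = (\<integral>\<^sup>+q. ennreal (c0\<^sup>2 * (norm (T q))\<^sup>2) \<partial>lborel)"
      proof (rule nn_integral_cong)
        fix q
        have "g q powr (1 / 2) * (norm (Op g a u q))\<^sup>2 = ((g q powr (- 1 / 4))\<^sup>2 * g q powr (1 / 2)) * (c0\<^sup>2 * (norm (T q))\<^sup>2)"
          unfolding Op norm_mult norm_of_real power_mult_distrib power2_abs by (simp only: mult_ac)
        then show "ennreal (g q powr (1 / 2)) * ennreal ((norm (Op g a u q))\<^sup>2) = ennreal (c0\<^sup>2 * (norm (T q))\<^sup>2)"
          unfolding p4 by (simp add: ennreal_mult[symmetric])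
      qed
    qed (use Opm in measurable)
    also have "\<dots> = ennreal (c0\<^sup>2) * (\<integral>\<^sup>+q. ennreal ((norm (T q))\<^sup>2) \<partial>lborel)"
      by (subst nn_integral_cmult[symmetric]) (simp_all add: ennreal_mult)
    also have "\<dots> \<le> ennreal (c0\<^sup>2) * ennreal ((C * ?D * L2_norm lborel v)\<^sup>2)"
      by (intro mult_left_mono Tn) simp
    also have "\<dots> = ennreal ((c0 * (C * ?D * L2_norm lborel v))\<^sup>2)"
      by (simp add: ennreal_mult[symmetric] power_mult_distrib)
    finally have nn: "(\<integral>\<^sup>+q. ennreal ((norm (Op g a u q))\<^sup>2) \<partial>weighted g) \<le> ennreal ((c0 * (C * ?D * L2_norm lborel v))\<^sup>2)" .
    have Opw: "Op g a u \<in> borel_measurable (weighted g)" using Opm by (simp add: weighted_def)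
    have int: "integrable (weighted g) (\<lambda>q. (norm (Op g a u q))\<^sup>2)"
      using Opw nn by (intro integrableI_bounded) (auto intro: le_less_trans)
    have "(LINT q|weighted g. (norm (Op g a u q))\<^sup>2) \<le> (c0 * (C * ?D * L2_norm lborel v))\<^sup>2"
      using nn unfolding nn_integral_eq_integral[OF int AE_I2[OF zero_le_power2]] by (simp add: ennreal_le_iff)
    then have "L2_norm (weighted g) (Op g a u) \<le> c0 * (C * ?D * L2_norm lborel v)"
      unfolding L2_norm_def[of "weighted g"]
      by (intro real_le_lsqrt) (use c0 K in \<open>auto simp: L2_norm_nonneg intro!: mult_nonneg_nonneg\<close>)
    moreover have "L2_norm lborel v = L2_norm (weighted g) u"
    proof -
      have um: "u \<in> borel_measurable borel" using u by (auto simp: test_function_def intro: smooth_borel_measurable)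
      have "(LINT q|weighted g. (norm (u q))\<^sup>2) = (LINT q|lborel. g q powr (1 / 2) *\<^sub>R (norm (u q))\<^sup>2)"
        unfolding weighted_def by (rule integral_density) (use um in measurable)
      also have "\<dots> = (LINT q|lborel. (norm (v q))\<^sup>2)"
        by (simp add: v_def norm_mult power_mult_distrib p4)
      finally show ?thesis by (simp add: L2_norm_def)
    qed
    ultimately show ?thesis using int Opw by (simp add: in_L2_def mult_ac)
  qed
  show ?thesis
    using C c0 est by (intro exI[of _ "c0 * C"] conjI exI[of _ M]) auto
qed

end
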